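(* Let $\mu\in\mathcal{M}_{\mathbb{R}_+}^\times$ and $t>1$. With $\mu^{\boxtimes t}$, $u$, $A_t$, $V_t^+$ and $h_t$ as defined in the context, let $$S_t=\left\{\frac{1}{h_t(r)}:r\in V_t^+\right\}.$$ Then the following statements hold. (1) The measure $(\mu^{\boxtimes t})^{\mathrm{ac}}$ is concentrated on the closure of $S_t$. (2) The density of $(\mu^{\boxtimes t})^{\mathrm{ac}}$ is analytic on the set $S_t$ and is given by $$\frac{d(\mu^{\boxtimes t})^{\mathrm{ac}}}{dx}\left(\frac{1}{h_t(r)}\right)=\frac{1}{\pi}\,\frac{h_t(r)\,l_t(r)\sin\theta_t(r)}{1-2l_t(r)\cos\theta_t(r)+l_t^2(r)},\qquad r\in V_t^+,$$ where $l_t(r)=r\exp\left[-\Re u(re^{iA_t(r)})\right]$ and $\theta_t(r)=\frac{tA_t(r)}{t-1}$ for $r\in V_t^+$. (3) The number of connected components of $\mathrm{supp}\,(\mu^{\boxtimes t})^{\mathrm{ac}}$ is a decreasing function of $t\in(1,\infty)$.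
   Context: Notation. $\mathbb{R}_+=[0,\infty)$, $\Omega=\mathbb{C}\setminus[0,\infty)$, $\mathbb{C}^{\pm}$ are the open upper and lower half-planes. $\mathcal{M}_{\mathbb{R}_+}^\times$ is the set of Borel probability measures on $\mathbb{R}_+$ other than $\delta_0$. For such $\mu$ and $z\in\Omega$: $\psi_\mu(z)=\int\frac{zs}{1-zs}\,d\mu(s)$ and $\eta_\mu=\psi_\mu/(1+\psi_\mu)$; $\eta_\mu$ never vanishes on $\Omega$ and is injective on $(-\infty,0)$. With $\eta_\mu^{-1}$ the inverse of $\eta_\mu|_{(-\infty,0)}$, put $\Sigma_\mu(z)=\eta_\mu^{-1}(z)/z$ for $z<0$ close to $0$. For $t>1$, $\mu^{\boxtimes t}$ is the unique measure in $\mathcal{M}_{\mathbb{R}_+}^\times$ with $\Sigma_{\mu^{\boxtimes t}}(z)=\Sigma_\mu(z)^t$ for $z<0$ sufficiently close to $0$. Let $\kappa_\mu(z)=z/\eta_\mu(z)$ on $\Omega$. Then $\kappa_\mu=\exp u$ for a unique analytic $u$ on $\Omega$ with $u(\overline z)=\overline{u(z)}$ and $u(\mathbb{C}^+)\subset\mathbb{C}^-\cup\mathbb{R}$, and $$u(z)=a+\int_0^\infty\frac{1+zs}{z-s}\,d\rho(s),\quad z\in\Omega,$$ where $a\in\mathbb{R}$ and $\rho$ is a finite positive Borel measure on $[0,\infty)$. Let $\Phi_t(z)=z\exp[(t-1)u(z)]$, $z\in\Omega$. For $r\in(0,\infty)$ let $$g(r)=\int_0^\infty\frac{r(s^2+1)}{(r-s)^2}\,d\rho(s)\in[0,+\infty],\qquad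 A_t(r)=\inf\left\{\theta\in(0,\pi):\frac{-\Im u(re^{i\theta})}{\theta}<\frac{1}{t-1}\right\},$$ $$V_t^+=\left\{r\in(0,\infty):g(r)>\frac{1}{t-1}\right\}.$$ Let $\Omega_t=\{re^{i\theta}:r>0,\ A_t(r)<\theta<\pi\}$. The functions $u$ and $\Phi_t$ extend continuously from $\Omega_t$ to the curve $\{re^{iA_t(r)}:r>0\}$, and $h_t(r)=\Phi_t(re^{iA_t(r)})$ is a homeomorphism of $(0,\infty)$ onto itself. $\nu^{\mathrm{ac}}$ denotes the absolutely continuous part of $\nu$ (with respect to Lebesgue measure) and $\mathrm{supp}$ the (closed) support. "Decreasing" is meant in the weak sense (non-increasing), and the number of components may be infinite. *)

theory Defs
  imports "HOL-Probability.Probability" "HOL-Complex_Analysis.Complex_Analysis"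
    "HOL-Library.Extended_Nat"
begin

text \<open>Measures on \<open>[0,\<infinity>)\<close> are Borel measures on the reals that give no mass to the negative
  half-line.\<close>

definition borel_on_nonneg :: "real measure \<Rightarrow> bool" where
  "borel_on_nonneg \<mu> \<longleftrightarrow> sets \<mu> = sets borel \<and> emeasure \<mu> {..<0} = 0"

definition prob_nonneg_nontrivial :: "real measure set" where
  "prob_nonneg_nontrivial =
     {\<mu>. borel_on_nonneg \<mu> \<and> prob_space \<mu> \<and> \<mu> \<noteq> return borel 0}"

definition slit_plane :: "complex set" where
  "slit_plane = - \<real>\<^sub>\<ge>\<^sub>0"

definition psi_transform :: "real measure \<Rightarrow> complex \<Rightarrow> complex" where
  "psi_transform \<mu> z =
     (LINT s|\<mu>. z * complex_of_real s / (1 - z * complex_of_real s))"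

definition eta_transform :: "real measure \<Rightarrow> complex \<Rightarrow> complex" where
  "eta_transform \<mu> z = psi_transform \<mu> z / (1 + psi_transform \<mu> z)"

text \<open>On the negative half-line \<^term>\<open>eta_transform \<mu>\<close> is real valued and injective, so its
  restriction is inverted as a real function. The value of \<open>Sigma_transform \<mu> x\<close> is meaningful
  only for \<open>x\<close> in the range of that restriction, in particular for \<open>x < 0\<close> close to \<open>0\<close>.\<close>

definition Sigma_transform :: "real measure \<Rightarrow> real \<Rightarrow> real" where
  "Sigma_transform \<mu> x =
     inv_into {..<0} (\<lambda>y. Re (eta_transform \<mu> (complex_of_real y))) x / x"

text \<open>\<open>\<nu>\<close> is the free multiplicative convolution power of \<open>\<mu>\<close> with exponent \<open>t\<close>; for \<open>t > 1\<close>
  there is exactly one such \<open>\<nu>\<close>.\<close>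

definition is_free_mult_power :: "real measure \<Rightarrow> real \<Rightarrow> real measure \<Rightarrow> bool" where
  "is_free_mult_power \<mu> t \<nu> \<longleftrightarrow> \<nu> \<in> prob_nonneg_nontrivial \<and>
     (\<forall>\<^sub>F x in at_left 0. Sigma_transform \<nu> x = Sigma_transform \<mu> x powr t)"

definition kappa :: "real measure \<Rightarrow> complex \<Rightarrow> complex" where
  "kappa \<mu> z = z / eta_transform \<mu> z"

text \<open>The conditions below determine \<open>u\<close> uniquely on the slit plane.\<close>

definition is_log_kappa :: "real measure \<Rightarrow> (complex \<Rightarrow> complex) \<Rightarrow> bool" where
  "is_log_kappa \<mu> u \<longleftrightarrow> u analytic_on slit_plane \<and>
     (\<forall>z\<in>slit_plane. exp (u z) = kappa \<mu> z) \<and>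
     (\<forall>z\<in>slit_plane. u (cnj z) = cnj (u z)) \<and>
     (\<forall>z. Im z > 0 \<longrightarrow> Im (u z) \<le> 0)"

definition nevanlinna_rep ::
  "(complex \<Rightarrow> complex) \<Rightarrow> real \<Rightarrow> real measure \<Rightarrow> bool" where
  "nevanlinna_rep u a \<rho> \<longleftrightarrow> borel_on_nonneg \<rho> \<and> finite_measure \<rho> \<and>
     (\<forall>z\<in>slit_plane. u z = complex_of_real a +
        (LINT s|\<rho>. (1 + z * complex_of_real s) / (z - complex_of_real s)))"

definition Phi :: "(complex \<Rightarrow> complex) \<Rightarrow> real \<Rightarrow> complex \<Rightarrow> complex" where
  "Phi u t z = z * exp (complex_of_real (t - 1) * u z)"

text \<open>The quotient is taken in \<^typ>\<open>ennreal\<close>, so that the integrand is \<open>\<infinity>\<close> (and not \<open>0\<close>, as with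
  real division) at \<open>s = r\<close>.\<close>

definition g_fun :: "real measure \<Rightarrow> real \<Rightarrow> ennreal" where
  "g_fun \<rho> r = (\<integral>\<^sup>+s. ennreal (r * (s\<^sup>2 + 1)) / ennreal ((r - s)\<^sup>2) \<partial>\<rho>)"

definition A_fun :: "(complex \<Rightarrow> complex) \<Rightarrow> real \<Rightarrow> real \<Rightarrow> real" where
  "A_fun u t r = Inf {\<theta>\<in>{0<..<pi}. - Im (u (rcis r \<theta>)) / \<theta> < 1 / (t - 1)}"

definition V_plus :: "real measure \<Rightarrow> real \<Rightarrow> real set" where
  "V_plus \<rho> t = {r. r > 0 \<and> g_fun \<rho> r > ennreal (1 / (t - 1))}"

definition Omega_t :: "(complex \<Rightarrow> complex) \<Rightarrow> real \<Rightarrow> complex set" where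
  "Omega_t u t = {rcis r \<theta> |r \<theta>. r > 0 \<and> A_fun u t r < \<theta> \<and> \<theta> < pi}"

text \<open>The value at \<open>r e\<^sup>i\<^sup>A\<close>, \<open>A = A_fun u t r\<close>, of the continuous extension of \<open>f\<close> from
  \<^term>\<open>Omega_t u t\<close> to its boundary curve. This point lies on the slit when \<open>A = 0\<close>.\<close>

definition boundary_value ::
  "(complex \<Rightarrow> complex) \<Rightarrow> real \<Rightarrow> (complex \<Rightarrow> complex) \<Rightarrow> real \<Rightarrow> complex" where
  "boundary_value u t f r = Lim (at (rcis r (A_fun u t r)) within Omega_t u t) f"

text \<open>The boundary values of \<^term>\<open>Phi u t\<close> are positive real numbers.\<close>

definition h_fun :: "(complex \<Rightarrow> complex) \<Rightarrow> real \<Rightarrow> real \<Rightarrow> real" where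
  "h_fun u t r = Re (boundary_value u t (Phi u t) r)"

definition l_fun :: "(complex \<Rightarrow> complex) \<Rightarrow> real \<Rightarrow> real \<Rightarrow> real" where
  "l_fun u t r = r * exp (- Re (boundary_value u t u r))"

definition theta_fun :: "(complex \<Rightarrow> complex) \<Rightarrow> real \<Rightarrow> real \<Rightarrow> real" where
  "theta_fun u t r = t * A_fun u t r / (t - 1)"

definition S_set :: "(complex \<Rightarrow> complex) \<Rightarrow> real measure \<Rightarrow> real \<Rightarrow> real set" where
  "S_set u \<rho> t = (\<lambda>r. 1 / h_fun u t r) ` V_plus \<rho> t"

text \<open>The absolutely continuous part in the Lebesgue decomposition with respect to Lebesgue
  measure (unique for finite \<open>\<nu>\<close>).\<close>

definition singular_lborel :: "real measure \<Rightarrow> bool" where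
  "singular_lborel \<sigma> \<longleftrightarrow> (\<exists>N\<in>null_sets lborel. emeasure \<sigma> (- N) = 0)"

definition ac_part :: "real measure \<Rightarrow> real measure" where
  "ac_part \<nu> = (THE \<tau>. sets \<tau> = sets borel \<and> absolutely_continuous lborel \<tau> \<and>
     (\<exists>\<sigma>. sets \<sigma> = sets borel \<and> singular_lborel \<sigma> \<and>
       (\<forall>B\<in>sets borel. emeasure \<nu> B = emeasure \<tau> B + emeasure \<sigma> B)))"

definition msupport :: "real measure \<Rightarrow> real set" where
  "msupport \<nu> = {x. \<forall>U. open U \<and> x \<in> U \<longrightarrow> emeasure \<nu> U > 0}"

definition concentrated_on :: "real measure \<Rightarrow> real set \<Rightarrow> bool" where
  "concentrated_on \<nu> B \<longleftrightarrow> emeasure \<nu> (- B) = 0"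

definition num_components :: "real set \<Rightarrow> enat" where
  "num_components S =
     (if finite (components S) then enat (card (components S)) else \<infinity>)"

definition real_analytic_on :: "(real \<Rightarrow> real) \<Rightarrow> real set \<Rightarrow> bool" where
  "real_analytic_on f S \<longleftrightarrow>
     (\<forall>x\<in>S. \<exists>e>0. \<exists>c. \<forall>y\<in>ball x e. (\<lambda>n. c n * (y - x) ^ n) sums f y)"

definition is_lebesgue_density :: "(real \<Rightarrow> real) \<Rightarrow> real measure \<Rightarrow> bool" where
  "is_lebesgue_density f \<nu> \<longleftrightarrow> f \<in> borel_measurable borel \<and> (\<forall>x. f x \<ge> 0) \<and>
     \<nu> = density lborel (\<lambda>x. ennreal (f x))"

end

theory Submission
  imports Defs
begin

text \<open>
  Write \<open>q = t - 1\<close> and let \<open>\<nu>\<close> be the power of \<open>\<mu>\<close> with exponent \<open>t\<close>. Unfolding the relation between the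
  two \<open>\<Sigma>\<close>-transforms gives the functional equation \<open>\<eta>\<^sub>\<nu> (\<Phi> z) = \<eta>\<^sub>\<mu> z\<close> for negative \<open>z\<close> near \<open>0\<close>
  (\<open>eta_power_near_0\<close>), and analytic continuation carries it to the whole of \<open>\<Omega>\<^sub>t\<close> (\<open>eta_Phi\<close>).
  Since \<open>\<Phi>\<close> takes the boundary curve \<open>r exp (i A r)\<close> to the point \<open>h r\<close> of the positive half-line, the
  boundary behaviour of \<open>\<eta>\<^sub>\<nu>\<close> at \<open>h r\<close> is the behaviour of \<open>\<eta>\<^sub>\<mu>\<close> at that point of the curve. The Cauchy
  transform of \<open>\<nu>\<close> at \<open>1 / z\<close> is \<open>z / (1 - \<eta>\<^sub>\<nu> z)\<close>, so Stieltjes inversion (\<open>stieltjes_local\<close>) turns an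
  extension of \<open>\<eta>\<^sub>\<nu>\<close> across \<open>h r\<close> into a description of \<open>\<nu>\<close> near \<open>1 / h r\<close>.

  Two kinds of points \<open>r\<close> occur. If \<open>A r > 0\<close>, the curve stays in the upper half-plane, the derivative
  of \<open>\<Phi>\<close> does not vanish (\<open>Re_deriv_pos\<close>), and a local inverse of \<open>\<Phi>\<close> extends \<open>\<eta>\<^sub>\<nu>\<close> analytically; this
  gives the analytic density and its formula (\<open>density_local\<close>). If \<open>A\<close> vanishes near \<open>r\<close>, then \<open>\<rho>\<close> has no
  mass there (\<open>rho_gap\<close>), the same construction works, and the extension is real on the real axis; then
  \<open>\<nu>\<close> lives locally on the isolated solutions of \<open>\<eta>\<^sub>\<nu> = 1\<close> and has no absolutely continuous part
  (\<open>flat_null\<close>). These two kinds suffice for the first two claims as soon as \<open>h\<close> is known to be a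
  homeomorphism of the positive half-line. It is continuous and onto because \<open>u\<close> oscillates by at most
  \<open>\<pi>\<^sup>2 / (2 q)\<close> between \<open>- r\<close> and the curve (\<open>u_int_minus_dist\<close>). It is increasing because the functional
  equation, solved for \<open>z\<close>, exhibits an explicit inverse of \<open>\<Phi>\<close> on the upper half-plane, which forces
  \<open>\<Phi>\<close> to be monotone along the curves where its argument is constant (\<open>Phi_abs_less\<close>); the boundary
  curve is a limit of these.

  For the last claim, the density is strictly positive, so the support of the absolutely continuous
  part is the closure of \<open>S\<^sub>t\<close> (\<open>msupport_ac\<close>), and by the homeomorphism \<open>h\<close> it has as many components as
  the closure of \<open>{1 / r | r \<in> V\<^sub>t}\<close>. The sets \<open>V\<^sub>t\<close> grow with \<open>t\<close>, and a component of a larger one always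
  meets the smaller ones: otherwise \<open>\<rho>\<close> has no mass on that component, where therefore \<open>g\<close> is a convex
  function of \<open>ln r\<close>, and convexity bounds it by its values at the end points, which are at most \<open>1 / q\<close>
  (\<open>component_meets\<close>). Hence growing \<open>t\<close> can merge components but cannot create any.
\<close>

section \<open>Measures on the line\<close>

text \<open>By the Lindelof property countably many of the null neighbourhoods already cover.\<close>

lemma emeasure_open_eq_0_if_locally_0:
  fixes M :: "'a::second_countable_topology measure"
  assumes "sets M = sets borel"
    and "\<And>x. x \<in> O' \<Longrightarrow> \<exists>U. open U \<and> x \<in> U \<and> emeasure M U = 0"
  shows "emeasure M O' = 0"
proof -
  define F where "F = {U. open U \<and> emeasure M U = 0}"
  obtain F' where F': "F' \<subseteq> F" "countable F'" "\<Union>F' = \<Union>F"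
    using Lindelof[of F] by (auto simp: F_def)
  have "(\<Union>F') \<in> null_sets M"
    using null_sets_UN'[of F' "\<lambda>x. x" M, OF F'(2)] F'(1) assms(1) by (auto simp: F_def null_sets_def subset_iff)
  moreover have "O' \<subseteq> \<Union>F'" unfolding F'(3) F_def using assms(2) by auto
  ultimately show ?thesis
    by (metis emeasure_eq_0 null_setsD1 null_setsD2)
qed

lemma norm_integral_le_AE:
  fixes f :: "'a \<Rightarrow> 'b::{banach, second_countable_topology}"
  assumes "integrable M f" "integrable M g" "AE s in M. norm (f s) \<le> g s"
  shows "norm (LINT s|M. f s) \<le> (LINT s|M. g s)"
  using order_trans[OF integral_norm_bound[of M f] integral_mono_AE[of M "\<lambda>s. norm (f s)" g]] assms by auto

text \<open>Uniqueness of the Lebesgue decomposition in the form used below: removing a Lebesgue null set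
  from \<open>\<nu>\<close> leaves the absolutely continuous part as soon as what remains is absolutely continuous. Two
  candidates agree because both agree with \<open>\<nu>\<close> off the union of their exceptional null sets.\<close>

lemma ac_part_eqI:
  assumes "sets \<nu> = sets borel" "sets \<tau> = sets borel" "absolutely_continuous lborel \<tau>"
    and "N \<in> null_sets lborel"
    and \<tau>: "\<And>B. B \<in> sets borel \<Longrightarrow> emeasure \<tau> B = emeasure \<nu> (B - N)"
  shows "ac_part \<nu> = \<tau>"
  unfolding ac_part_def
proof (rule the_equality)
  have N: "N \<in> sets borel" using assms(4) by auto
  let ?\<sigma> = "density \<nu> (indicator N)"
  have e: "emeasure ?\<sigma> B = emeasure \<nu> (B \<inter> N)" if "B \<in> sets borel" for B
    using that N assms(1) by (subst emeasure_density) (auto simp: indicator_inter_arith[symmetric] Int_commute)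
  show "sets \<tau> = sets borel \<and> absolutely_continuous lborel \<tau> \<and>
     (\<exists>\<sigma>. sets \<sigma> = sets borel \<and> singular_lborel \<sigma> \<and>
       (\<forall>B\<in>sets borel. emeasure \<nu> B = emeasure \<tau> B + emeasure \<sigma> B))"
  proof (intro conjI exI[of _ ?\<sigma>] ballI)
    show "singular_lborel ?\<sigma>" unfolding singular_lborel_def
      using assms(4) N by (intro bexI[of _ N]) (auto simp: e)
    fix B :: "real set" assume B: "B \<in> sets borel"
    have "emeasure \<nu> B = emeasure \<nu> ((B - N) \<union> (B \<inter> N))" by (simp add: Un_Diff_Int)
    also have "\<dots> = emeasure \<nu> (B - N) + emeasure \<nu> (B \<inter> N)"
      using B N assms(1) by (intro plus_emeasure[symmetric]) auto
    finally show "emeasure \<nu> B = emeasure \<tau> B + emeasure ?\<sigma> B" using B by (simp add: e \<tau>)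
  qed (use assms in auto)
next
  fix \<tau>' assume "sets \<tau>' = sets borel \<and> absolutely_continuous lborel \<tau>' \<and>
     (\<exists>\<sigma>. sets \<sigma> = sets borel \<and> singular_lborel \<sigma> \<and>
       (\<forall>B\<in>sets borel. emeasure \<nu> B = emeasure \<tau>' B + emeasure \<sigma> B))"
  then obtain \<sigma> N' where t: "sets \<tau>' = sets borel" "absolutely_continuous lborel \<tau>'"
    "sets \<sigma> = sets borel" "N' \<in> null_sets lborel" "emeasure \<sigma> (- N') = 0"
    "\<And>B. B \<in> sets borel \<Longrightarrow> emeasure \<nu> B = emeasure \<tau>' B + emeasure \<sigma> B"
    by (auto simp: singular_lborel_def)
  have N: "N \<in> sets borel" "N' \<in> sets borel" using assms(4) t(4) by auto
  show "\<tau>' = \<tau>"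
  proof (rule measure_eqI)
    show "sets \<tau>' = sets \<tau>" using t assms by simp
    fix B assume "B \<in> sets \<tau>'"
    then have B: "B \<in> sets borel" using t by simp
    have null: "emeasure L (B \<inter> (N \<union> N')) = 0" if "absolutely_continuous lborel L" for L
    proof -
      have "B \<inter> (N \<union> N') \<in> null_sets lborel"
        using assms(4) t(4) B by (auto intro: null_set_Int1 simp: Int_commute)
      then show ?thesis using that by (auto simp: absolutely_continuous_def)
    qed
    have split: "emeasure L B = emeasure L (B - (N \<union> N'))"
      if "absolutely_continuous lborel L" "sets L = sets borel" for L
    proof -
      have "emeasure L B = emeasure L ((B - (N \<union> N')) \<union> (B \<inter> (N \<union> N')))" by (simp add: Un_Diff_Int)
      also have "\<dots> = emeasure L (B - (N \<union> N')) + emeasure L (B \<inter> (N \<union> N'))"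
        using B N that(2) by (intro plus_emeasure[symmetric]) auto
      finally show ?thesis using null[OF that(1)] by simp
    qed
    have s: "emeasure \<sigma> (B - (N \<union> N')) = 0"
      by (rule emeasure_eq_0[OF _ t(5)]) (use N t B in auto)
    have "emeasure \<tau>' B = emeasure \<tau>' (B - (N \<union> N'))" using split t by blast
    also have "\<dots> = emeasure \<nu> (B - (N \<union> N'))" using t(6)[of "B - (N \<union> N')"] s B N by simp
    also have "\<dots> = emeasure \<tau> (B - (N \<union> N'))"
      using \<tau>[of "B - (N \<union> N')"] B N by (simp add: Diff_Un Diff_Int Diff_Diff_Int double_diff set_diff_eq) metis
    also have "\<dots> = emeasure \<tau> B" using split assms by metis
    finally show "emeasure \<tau>' B = emeasure \<tau> B" .
  qed
qed

text \<open>Existence of the decomposition: among all Lebesgue null sets there is one, \<open>N\<close>, of largest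
  \<open>\<nu>\<close>-measure (a union of a maximizing sequence), and \<open>\<nu>\<close> restricted to its complement cannot charge any
  further null set.\<close>

lemma ac_part_finite:
  assumes "finite_measure \<nu>" "sets \<nu> = sets borel"
  obtains N where "N \<in> null_sets lborel" "sets (ac_part \<nu>) = sets borel"
    "absolutely_continuous lborel (ac_part \<nu>)"
    "\<And>B. B \<in> sets borel \<Longrightarrow> emeasure (ac_part \<nu>) B = emeasure \<nu> (B - N)"
proof -
  interpret finite_measure \<nu> by fact
  define s where "s = (SUP N\<in>null_sets lborel. measure \<nu> N)"
  have bdd: "bdd_above (measure \<nu> ` null_sets lborel)"
    by (intro bdd_aboveI[of _ "measure \<nu> (space \<nu>)"]) (auto intro: bounded_measure)
  have ne: "null_sets (lborel :: real measure) \<noteq> {}" by auto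
  have "\<exists>N\<in>null_sets lborel. s - 1 / Suc n < measure \<nu> N" for n
    using less_cSUP_iff[OF ne bdd, of "s - 1 / Suc n"] by (simp add: s_def[symmetric])
  then obtain Ns where Ns: "\<And>n. Ns n \<in> null_sets lborel" "\<And>n. s - 1 / Suc n < measure \<nu> (Ns n)"
    by metis
  define N where "N = (\<Union>n. Ns n)"
  have N0: "N \<in> null_sets lborel" unfolding N_def using Ns by auto
  have Nb: "N \<in> sets borel" using N0 by auto
  \<comment> \<open>the union attains the supremum\<close>
  have sN: "s \<le> measure \<nu> N"
  proof (rule LIMSEQ_le_const2)
    show "(\<lambda>n. s - 1 / Suc n) \<longlonglongrightarrow> s"
      using tendsto_diff[OF tendsto_const[of s] LIMSEQ_inverse_real_of_nat] by (simp add: inverse_eq_divide)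
    show "\<exists>k. \<forall>n\<ge>k. s - 1 / Suc n \<le> measure \<nu> N"
    proof (intro exI allI impI)
      fix n
      have "measure \<nu> (Ns n) \<le> measure \<nu> N"
        by (rule finite_measure_mono) (use Nb assms in \<open>auto simp: N_def\<close>)
      then show "s - 1 / Suc n \<le> measure \<nu> N" using Ns(2)[of n] by simp
    qed
  qed
  let ?\<tau> = "density \<nu> (indicator (- N))"
  have e: "emeasure ?\<tau> B = emeasure \<nu> (B - N)" if "B \<in> sets borel" for B
    using that Nb assms(2) by (subst emeasure_density) (auto simp: indicator_inter_arith[symmetric] Int_commute Diff_eq)
  have ac: "absolutely_continuous lborel ?\<tau>"
    unfolding absolutely_continuous_def
  proof
    fix B :: "real set" assume B: "B \<in> null_sets lborel"
    then have Bb: "B \<in> sets borel" by auto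
    have "N \<union> (B - N) \<in> null_sets lborel" using N0 B by (metis Un_Diff_cancel null_sets.Un)
    then have "measure \<nu> (N \<union> (B - N)) \<le> s" unfolding s_def
      by (intro cSUP_upper bdd) auto
    moreover have "measure \<nu> (N \<union> (B - N)) = measure \<nu> N + measure \<nu> (B - N)"
      by (rule finite_measure_Union) (use Nb Bb assms in auto)
    ultimately have "measure \<nu> (B - N) = 0" using sN measure_nonneg[of \<nu> "B - N"] by linarith
    then have "emeasure \<nu> (B - N) = 0" by (simp add: emeasure_eq_measure)
    then show "B \<in> null_sets ?\<tau>" using e[OF Bb] Bb assms by (auto simp: null_sets_def)
  qed
  have "ac_part \<nu> = ?\<tau>" by (rule ac_part_eqI[OF assms(2) _ ac N0]) (use assms e in auto)
  then show thesis using that[OF N0] e ac assms by simp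
qed

definition cauchy_tr :: "real measure \<Rightarrow> complex \<Rightarrow> complex" where
  "cauchy_tr M w = (LINT s|M. 1 / (w - complex_of_real s))"

lemma cauchy_tr_bound_integrable:
  assumes "finite_measure M" "sets M = sets borel" "d > 0" "AE s in M. d \<le> norm (w - of_real s)"
  shows "integrable M (\<lambda>s. 1 / (w - complex_of_real s))"
    and "integrable M (\<lambda>s. 1 / (w - complex_of_real s)^2)"
proof -
  interpret finite_measure M by fact
  have [measurable_cong]: "sets M = sets borel" by fact
  show "integrable M (\<lambda>s. 1 / (w - complex_of_real s))"
    by (rule integrable_const_bound[where B = "1/d"])
       (use assms(3,4) in \<open>auto simp: norm_divide elim!: eventually_mono intro!: divide_left_mono mult_pos_pos\<close>)
  show "integrable M (\<lambda>s. 1 / (w - complex_of_real s)^2)"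
    by (rule integrable_const_bound[where B = "1/d^2"])
       (use assms(3,4) in \<open>auto simp: norm_divide norm_power elim!: eventually_mono intro!: divide_left_mono mult_pos_pos power_mono\<close>)
qed

text \<open>The difference quotient differs from its limit by an integral of
  \<open>(v - w) / ((v - s) (w - s)\<^sup>2)\<close>, which is of order \<open>v - w\<close> as long as \<open>M\<close> stays away from \<open>w\<close>.\<close>

lemma cauchy_tr_has_field_derivative:
  assumes fin: "finite_measure M" and sets: "sets M = sets borel"
    and d: "d > 0" "AE s in M. d \<le> norm (w - of_real s)"
  shows "(cauchy_tr M has_field_derivative - (LINT s|M. 1 / (w - complex_of_real s)^2)) (at w)"
proof -
  interpret finite_measure M by fact
  have [measurable_cong]: "sets M = sets borel" by fact
  define D where "D = - (LINT s|M. 1 / (w - complex_of_real s)^2)"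
  have AEpos: "AE s in M. d/2 \<le> norm (v - of_real s)" if "norm (v - w) < d/2" for v
    using d(2)
  proof eventually_elim
    case (elim s)
    have "norm (w - of_real s) \<le> norm (w - v) + norm (v - of_real s)"
      by (metis norm_triangle_ineq diff_add_cancel add_diff_eq)
    then show ?case using elim that by (simp add: norm_minus_commute)
  qed
  have bound: "norm ((cauchy_tr M v - cauchy_tr M w) / (v - w) - D) \<le> norm (v - w) * (2 / d^3 * measure M (space M))"
    if v: "norm (v - w) < d/2" "v \<noteq> w" for v
  proof -
    note iw = cauchy_tr_bound_integrable[OF fin sets d]
    note iv = cauchy_tr_bound_integrable(1)[OF fin sets _ AEpos[OF v(1)]]
    have "(cauchy_tr M v - cauchy_tr M w) / (v - w) - D =
       (LINT s|M. (1/(v - of_real s) - 1/(w - of_real s)) / (v - w) + 1 / (w - complex_of_real s)^2)"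
      unfolding cauchy_tr_def D_def using iw iv d(1)
      by (simp add: Bochner_Integration.integral_add Bochner_Integration.integral_diff)
    also have "norm \<dots> \<le> (LINT s|M. norm (v - w) * (2 / d^3))"
    proof (rule norm_integral_le_AE)
      show "integrable M (\<lambda>s. (1/(v - of_real s) - 1/(w - of_real s)) / (v - w) + 1 / (w - complex_of_real s)^2)"
        using iw iv d(1) by auto
      show "AE s in M. norm ((1/(v - of_real s) - 1/(w - of_real s)) / (v - w) + 1 / (w - complex_of_real s)^2) \<le> norm (v - w) * (2 / d^3)"
        using d(2) AEpos[OF v(1)]
      proof eventually_elim
        case (elim s)
        define p q where "p = v - of_real s" and "q = w - of_real s"
        have pq: "p \<noteq> 0" "q \<noteq> 0" using elim d(1) by (auto simp: p_def q_def)
        have vw: "v - w = p - q" by (simp add: p_def q_def)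
        have "p - q \<noteq> 0" using v(2) vw by auto
        moreover have "1/p - 1/q = (p - q) * (- 1 / (p * q))" using pq by (simp add: field_simps)
        ultimately have "(1/p - 1/q) / (p - q) = - 1 / (p * q)" by simp
        moreover have "- 1 / (p * q) + 1 / q^2 = (p - q) / (p * q^2)"
          using pq by (simp add: field_simps power2_eq_square)
        ultimately have "(1/p - 1/q) / (p - q) + 1 / q^2 = (p - q) / (p * q^2)" by simp
        then have "norm ((1/p - 1/q) / (p - q) + 1 / q^2) = norm (p - q) * (1 / (norm p * norm q^2))"
          by (simp add: norm_divide norm_mult norm_power)
        also have "\<dots> \<le> norm (p - q) * (1 / (d/2 * d^2))"
          using elim d(1) pq by (intro mult_left_mono divide_left_mono mult_mono power_mono mult_pos_pos)
            (auto simp: p_def[symmetric] q_def[symmetric])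
        finally show ?case using d(1) by (simp add: vw p_def[symmetric] q_def[symmetric] power2_eq_square power3_eq_cube)
      qed
    qed auto
    finally show ?thesis by (simp add: mult_ac)
  qed
  have "((\<lambda>v. (cauchy_tr M v - cauchy_tr M w) / (v - w) - D) \<longlongrightarrow> 0) (at w)"
  proof (rule Lim_null_comparison)
    show "\<forall>\<^sub>F v in at w. norm ((cauchy_tr M v - cauchy_tr M w) / (v - w) - D) \<le> norm (v - w) * (2 / d^3 * measure M (space M))"
      unfolding eventually_at using bound d(1) by (intro exI[of _ "d/2"]) (auto simp: dist_norm)
    show "((\<lambda>v. norm (v - w) * (2 / d^3 * measure M (space M))) \<longlongrightarrow> 0) (at w)"
      using d(1) by (auto intro!: tendsto_eq_intros)
  qed
  then show ?thesis unfolding has_field_derivative_iff D_def[symmetric] by (simp add: LIM_zero_iff)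
qed

section \<open>Stieltjes inversion\<close>

text \<open>Just below the real axis the imaginary part of the Cauchy transform is a Poisson integral.\<close>

lemma Im_cauchy_tr_lower:
  assumes "finite_measure M" "sets M = sets borel" "y > 0"
  shows "Im (cauchy_tr M (Complex x (-y))) = (LINT s|M. y / ((x - s)^2 + y^2))"
    and "integrable M (\<lambda>s. y / ((x - s)^2 + y^2))"
proof -
  have Im: "Im (1 / (Complex x (-y) - complex_of_real s)) = y / ((x - s)^2 + y^2)" for s
    by (simp add: complex_eq_iff Im_divide)
  have "AE s in M. y \<le> norm (Complex x (-y) - of_real s)"
    using abs_Im_le_cmod[of "Complex x (-y) - of_real _"] assms(3) by (intro always_eventually allI) (metis (no_types, lifting) Im_complex_of_real abs_minus_cancel abs_of_pos complex.sel(2) diff_zero minus_complex.simps(2))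
  note i = cauchy_tr_bound_integrable(1)[OF assms this]
  show "Im (cauchy_tr M (Complex x (-y))) = (LINT s|M. y / ((x - s)^2 + y^2))"
    unfolding cauchy_tr_def integral_Im[OF i, symmetric] Im ..
  show "integrable M (\<lambda>s. y / ((x - s)^2 + y^2))"
    using integrable_Im[OF i] unfolding Im .
qed

text \<open>Tonelli's theorem; the Poisson kernel integrates to a difference of arctangents.\<close>

lemma poisson_interval_integral:
  assumes "finite_measure M" "sets M = sets borel" "y > 0" "a \<le> b"
  shows "(\<integral>\<^sup>+x\<in>{a..b}. ennreal (Im (cauchy_tr M (Complex x (-y)))) \<partial>lborel) =
     (\<integral>\<^sup>+s. ennreal (arctan ((b - s) / y) - arctan ((a - s) / y)) \<partial>M)"
proof -
  interpret finite_measure M by fact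
  interpret pair_sigma_finite M lborel ..
  have [measurable_cong]: "sets M = sets borel" by fact
  have "(\<integral>\<^sup>+x\<in>{a..b}. ennreal (Im (cauchy_tr M (Complex x (-y)))) \<partial>lborel) =
     (\<integral>\<^sup>+x. (\<integral>\<^sup>+s. ennreal (y / ((x - s)^2 + y^2)) * indicator {a..b} x \<partial>M) \<partial>lborel)"
    using assms(3) by (intro nn_integral_cong)
      (simp add: Im_cauchy_tr_lower[OF assms(1-3)] nn_integral_multc nn_integral_eq_integral)
  also have "\<dots> = (\<integral>\<^sup>+s. (\<integral>\<^sup>+x. ennreal (y / ((x - s)^2 + y^2)) * indicator {a..b} x \<partial>lborel) \<partial>M)"
    by (rule Fubini') measurable
  also have "\<dots> = (\<integral>\<^sup>+s. ennreal (arctan ((b - s) / y) - arctan ((a - s) / y)) \<partial>M)"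
  proof (rule nn_integral_cong)
    fix s
    have pos: "(x - s)^2 + y^2 > 0" for x using assms(3) by (simp add: add_nonneg_pos)
    show "(\<integral>\<^sup>+x. ennreal (y / ((x - s)^2 + y^2)) * indicator {a..b} x \<partial>lborel) =
       ennreal (arctan ((b - s) / y) - arctan ((a - s) / y))"
    proof (rule nn_integral_FTC_Icc)
      fix x assume "x \<in> {a..b}"
      have "((\<lambda>x. arctan ((x - s) / y)) has_real_derivative inverse (1 + ((x - s) / y)\<^sup>2) * (1 / y)) (at x)"
        using assms(3) by (auto intro!: derivative_eq_intros)
      moreover have "inverse (1 + ((x - s) / y)\<^sup>2) * (1 / y) = y / ((x - s)^2 + y^2)"
        using assms(3) pos[of x] by (simp add: field_simps power2_eq_square)
      ultimately show "((\<lambda>x. arctan ((x - s) / y)) has_real_derivative y / ((x - s)^2 + y^2)) (at x)"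
        by simp
    qed (use assms in \<open>auto\<close>)
  qed
  finally show ?thesis .
qed

lemma tendsto_arctan_scaled:
  "(\<lambda>n. arctan (c * real (Suc n))) \<longlonglongrightarrow> (if c > 0 then pi/2 else if c < 0 then - pi/2 else 0)"
proof -
  have top: "filterlim (\<lambda>n. real (Suc n)) at_top sequentially"
    using filterlim_compose[OF filterlim_real_sequentially filterlim_Suc] by simp
  consider "c > 0" | "c < 0" | "c = 0" by linarith
  then show ?thesis
  proof cases
    case 1
    then have "filterlim (\<lambda>n. c * real (Suc n)) at_top sequentially"
      by (intro filterlim_tendsto_pos_mult_at_top[OF tendsto_const _ top])
    then show ?thesis using 1 filterlim_compose[OF tendsto_arctan_at_top] by auto
  next
    case 2
    then have "filterlim (\<lambda>n. c * real (Suc n)) at_bot sequentially"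
      by (intro filterlim_tendsto_neg_mult_at_bot[OF tendsto_const _ top])
    then show ?thesis using 2 filterlim_compose[OF tendsto_arctan_at_bot] by auto
  qed auto
qed

lemma Im_line_borel_measurable:
  fixes H :: "complex \<Rightarrow> complex"
  assumes "continuous_on R H" "\<And>x. a \<le> x \<Longrightarrow> x \<le> b \<Longrightarrow> Complex x (-t) \<in> R"
  shows "(\<lambda>x. indicator {a..b} x *\<^sub>R Im (H (Complex x (- t)))) \<in> borel_measurable borel"
proof -
  have "continuous_on {a..b} (\<lambda>x. Complex x (-t))" by (intro continuous_intros)
  then have "continuous_on {a..b} (\<lambda>x. H (Complex x (-t)))"
    by (rule continuous_on_compose2[OF assms(1)]) (use assms(2) in force)
  then show ?thesis by (intro borel_measurable_continuous_on_indicator continuous_on_Im) auto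
qed

text \<open>Stieltjes inversion on an interval. Both sides of the Poisson identity \<open>poisson_interval_integral\<close>
  have a limit as \<open>y\<close> decreases to \<open>0\<close>: the left one because \<open>H\<close> continues the Cauchy transform up to the
  axis, the right one because the difference of arctangents tends to \<open>\<pi>\<close> inside the interval, to \<open>\<pi> / 2\<close> at
  its end points and to \<open>0\<close> outside.\<close>

lemma stieltjes_interval:
  fixes H :: "complex \<Rightarrow> complex"
  assumes fin: "finite_measure M" and sets: "sets M = sets borel" and "a < b"
    and cont: "continuous_on (cbox (Complex a (-e)) (Complex b 0)) H" and e: "e > 0"
    and H: "\<And>x y. a \<le> x \<Longrightarrow> x \<le> b \<Longrightarrow> - e \<le> y \<Longrightarrow> y < 0 \<Longrightarrow> cauchy_tr M (Complex x y) = H (Complex x y)"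
  shows "(LINT x:{a..b}|lborel. Im (H (of_real x))) =
     (LINT s|M. (if a < s \<and> s < b then pi else if s = a \<or> s = b then pi/2 else 0))"
    and "\<And>x. a \<le> x \<Longrightarrow> x \<le> b \<Longrightarrow> Im (H (of_real x)) \<ge> 0"
proof -
  interpret finite_measure M by fact
  have [measurable_cong]: "sets M = sets borel" by fact
  define R where "R = cbox (Complex a (-e)) (Complex b 0)"
  note cont = cont[folded R_def]
  define y where "y n = e / real (Suc n)" for n
  have y: "y n > 0" "y n \<le> e" for n using e by (auto simp: y_def field_simps)
  have y0: "y \<longlonglongrightarrow> 0" unfolding y_def using tendsto_mult[OF tendsto_const[of e] LIMSEQ_inverse_real_of_nat]
    by (simp add: divide_inverse)
  have mem: "Complex x (- t) \<in> R" if "a \<le> x" "x \<le> b" "0 \<le> t" "t \<le> e" for x t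
    using that by (auto simp: R_def in_cbox_complex_iff)
  have memr: "complex_of_real x \<in> R" if "a \<le> x" "x \<le> b" for x
    using mem[OF that, of 0] e by (simp add: complex_of_real_def)
  have HC: "H (Complex x (- y n)) = cauchy_tr M (Complex x (- y n))" if "a \<le> x" "x \<le> b" for x n
    using H[of x "- y n"] that y[of n] by simp
  have lim: "(\<lambda>n. H (Complex x (- y n))) \<longlonglongrightarrow> H (of_real x)" if "a \<le> x" "x \<le> b" for x
  proof (rule continuous_on_tendsto_compose[OF cont])
    show "(\<lambda>n. Complex x (- y n)) \<longlonglongrightarrow> of_real x"
      using tendsto_Complex[OF tendsto_const[of x] tendsto_minus[OF y0]] by (simp add: complex_of_real_def)
    show "\<forall>\<^sub>F n in sequentially. Complex x (- y n) \<in> R"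
      using mem that y by (intro always_eventually) (simp add: less_imp_le)
  qed (use memr that in auto)
  have nonneg: "Im (H (Complex x (- y n))) \<ge> 0" if "a \<le> x" "x \<le> b" for x n
    unfolding HC[OF that] Im_cauchy_tr_lower(1)[OF fin sets y(1)]
    using y(1)[of n] by (intro integral_nonneg_AE) auto
  show "Im (H (of_real x)) \<ge> 0" if "a \<le> x" "x \<le> b" for x
    by (rule LIMSEQ_le_const[OF tendsto_Im[OF lim[OF that]]]) (use nonneg that in auto)
  have "bounded (H ` R)" by (intro compact_imp_bounded compact_continuous_image cont) (auto simp: R_def)
  then obtain B where B: "\<And>z. z \<in> R \<Longrightarrow> norm (H z) \<le> B" by (auto simp: bounded_iff)
  have B0: "B \<ge> 0" by (rule order_trans[OF norm_ge_zero B[OF memr[of a]]]) (use \<open>a < b\<close> in auto)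
  have meas: "(\<lambda>x. indicator {a..b} x *\<^sub>R Im (H (Complex x (- t)))) \<in> borel_measurable borel"
    if "0 \<le> t" "t \<le> e" for t
    by (rule Im_line_borel_measurable[OF cont]) (rule mem[OF _ _ that])
  have L1: "(\<lambda>n. LINT x:{a..b}|lborel. Im (H (Complex x (- y n)))) \<longlonglongrightarrow> (LINT x:{a..b}|lborel. Im (H (of_real x)))"
    unfolding set_lebesgue_integral_def
  proof (rule integral_dominated_convergence[where w = "\<lambda>x. B * indicator {a..b} x"])
    show "(\<lambda>x. indicator {a..b} x *\<^sub>R Im (H (complex_of_real x))) \<in> borel_measurable lborel"
      using meas[of 0] e by (simp add: complex_of_real_def)
    show "(\<lambda>x. indicator {a..b} x *\<^sub>R Im (H (Complex x (- y n)))) \<in> borel_measurable lborel" for n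
      using meas[of "y n"] y[of n] by simp
    show "integrable lborel (\<lambda>x. B * indicator {a..b} x)" using \<open>a < b\<close> by auto
    show "AE x in lborel. (\<lambda>n. indicator {a..b} x *\<^sub>R Im (H (Complex x (- y n)))) \<longlonglongrightarrow> indicator {a..b} x *\<^sub>R Im (H (of_real x))"
      using lim by (intro always_eventually) (auto simp: indicator_def intro!: tendsto_Im)
    show "AE x in lborel. norm (indicator {a..b} x *\<^sub>R Im (H (Complex x (- y n)))) \<le> B * indicator {a..b} x" for n
    proof (intro always_eventually allI)
      fix x
      have "\<bar>Im (H (Complex x (- y n)))\<bar> \<le> B" if "a \<le> x" "x \<le> b"
        using B[OF mem[OF that, of "y n"]] y[of n] abs_Im_le_cmod order_trans by (metis less_imp_le)
      then show "norm (indicator {a..b} x *\<^sub>R Im (H (Complex x (- y n)))) \<le> B * indicator {a..b} x"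
        by (auto simp: indicator_def)
    qed
  qed
  have mono: "arctan ((a - s) / y n) \<le> arctan ((b - s) / y n)" for s n
    using y(1)[of n] \<open>a < b\<close> by (intro arctan_monotone' divide_right_mono) auto
  have eq: "(LINT x:{a..b}|lborel. Im (H (Complex x (- y n)))) =
      (LINT s|M. arctan ((b - s) / y n) - arctan ((a - s) / y n))" for n
  proof -
    have "(LINT x:{a..b}|lborel. Im (H (Complex x (- y n)))) =
       enn2real (\<integral>\<^sup>+x. ennreal (indicator {a..b} x *\<^sub>R Im (H (Complex x (- y n)))) \<partial>lborel)"
      unfolding set_lebesgue_integral_def using meas[of "y n"] y[of n] nonneg
      by (intro integral_eq_nn_integral) (auto simp: indicator_def)
    also have "(\<integral>\<^sup>+x. ennreal (indicator {a..b} x *\<^sub>R Im (H (Complex x (- y n)))) \<partial>lborel) =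
       (\<integral>\<^sup>+x\<in>{a..b}. ennreal (Im (cauchy_tr M (Complex x (- y n)))) \<partial>lborel)"
      using HC by (intro nn_integral_cong) (auto simp: indicator_def)
    also have "\<dots> = (\<integral>\<^sup>+s. ennreal (arctan ((b - s) / y n) - arctan ((a - s) / y n)) \<partial>M)"
      using \<open>a < b\<close> by (intro poisson_interval_integral fin sets y) auto
    also have "enn2real \<dots> = (LINT s|M. arctan ((b - s) / y n) - arctan ((a - s) / y n))"
      using mono by (intro integral_eq_nn_integral[symmetric]) auto
    finally show ?thesis .
  qed
  have L2: "(\<lambda>n. LINT s|M. arctan ((b - s) / y n) - arctan ((a - s) / y n)) \<longlonglongrightarrow>
     (LINT s|M. (if a < s \<and> s < b then pi else if s = a \<or> s = b then pi/2 else 0))"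
  proof (rule integral_dominated_convergence[where w = "\<lambda>s. pi"])
    show "AE s in M. (\<lambda>n. arctan ((b - s) / y n) - arctan ((a - s) / y n)) \<longlonglongrightarrow> (if a < s \<and> s < b then pi else if s = a \<or> s = b then pi/2 else 0)"
    proof (intro always_eventually allI)
      fix s
      have *: "(c - s) / y n = ((c - s) / e) * real (Suc n)" for c n
        using e by (simp add: y_def)
      have c: "((c - s) / e > 0) = (c > s)" "((c - s) / e < 0) = (c < s)" for c
        using e by (auto simp: field_simps)
      show "(\<lambda>n. arctan ((b - s) / y n) - arctan ((a - s) / y n)) \<longlonglongrightarrow> (if a < s \<and> s < b then pi else if s = a \<or> s = b then pi/2 else 0)"
        unfolding *
        by (rule tendsto_eq_rhs[OF tendsto_diff[OF tendsto_arctan_scaled tendsto_arctan_scaled]])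
          (use \<open>a < b\<close> e in \<open>auto simp: divide_less_0_iff zero_less_divide_iff\<close>)
    qed
    show "AE s in M. norm (arctan ((b - s) / y n) - arctan ((a - s) / y n)) \<le> pi" for n
    proof (intro always_eventually allI)
      fix s
      show "norm (arctan ((b - s) / y n) - arctan ((a - s) / y n)) \<le> pi"
        using arctan_bounded[of "(b - s) / y n"] arctan_bounded[of "(a - s) / y n"]
        unfolding real_norm_def abs_le_iff by linarith
    qed
  qed auto
  show "(LINT x:{a..b}|lborel. Im (H (of_real x))) =
     (LINT s|M. (if a < s \<and> s < b then pi else if s = a \<or> s = b then pi/2 else 0))"
    using LIMSEQ_unique[OF L1[unfolded eq] L2] .
qed

text \<open>A continuous extension of the Cauchy transform up to the axis from below excludes atoms, since
  the mass at \<open>c\<close> is bounded by the integral of \<open>Im H\<close> over arbitrarily short intervals starting at \<open>c\<close>.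
  With atoms excluded, \<open>stieltjes_interval\<close> identifies the measure with a density on all intervals, hence
  on all Borel sets.\<close>

lemma stieltjes_local:
  fixes H :: "complex \<Rightarrow> complex"
  assumes fin: "finite_measure M" and sets: "sets M = sets borel" and e: "e > 0"
    and cont: "continuous_on (ball (of_real x0) (2 * e)) H"
    and H: "\<And>w. w \<in> ball (of_real x0) (2 * e) \<Longrightarrow> Im w < 0 \<Longrightarrow> cauchy_tr M w = H w"
  shows "\<And>x. \<bar>x - x0\<bar> < e \<Longrightarrow> Im (H (of_real x)) \<ge> 0"
    and "\<And>B. B \<in> sets borel \<Longrightarrow> B \<subseteq> {x0-e<..<x0+e} \<Longrightarrow>
       emeasure M B = (\<integral>\<^sup>+x\<in>B. ennreal (Im (H (of_real x)) / pi) \<partial>lborel)"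
proof -
  interpret finite_measure M by fact
  have [measurable_cong]: "sets M = sets borel" by fact
  \<comment> \<open>the larger radius leaves room to treat the right end point of the final interval as an interior point\<close>
  define d where "d = 3 * e / 2"
  define J where "J a b = (LINT x:{a..b}|lborel. Im (H (of_real x)))" for a b
  have sub: "cbox (Complex a (- (e/4))) (Complex b 0) \<subseteq> ball (of_real x0) (2 * e)" if "x0 - d \<le> a" "b \<le> x0 + d" for a b
  proof
    fix z assume z: "z \<in> cbox (Complex a (- (e/4))) (Complex b 0)"
    have "norm (z - of_real x0) \<le> \<bar>Re (z - of_real x0)\<bar> + \<bar>Im (z - of_real x0)\<bar>" by (rule cmod_le)
    also have "\<dots> < 2 * e" using z that e d_def by (auto simp: in_cbox_complex_iff)
    finally show "z \<in> ball (of_real x0) (2 * e)" by (simp add: dist_norm norm_minus_commute)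
  qed
  have st: "J a b = (LINT s|M. (if a < s \<and> s < b then pi else if s = a \<or> s = b then pi/2 else 0))"
     "\<And>x. a \<le> x \<Longrightarrow> x \<le> b \<Longrightarrow> Im (H (of_real x)) \<ge> 0"
    if "x0 - d \<le> a" "a < b" "b \<le> x0 + d" for a b
  proof -
    have c: "Complex x y \<in> ball (of_real x0) (2 * e)" if "a \<le> x" "x \<le> b" "-(e/4) \<le> y" "y \<le> 0" for x y
      using sub[OF \<open>x0 - d \<le> a\<close> \<open>b \<le> x0 + d\<close>] that by (auto simp: in_cbox_complex_iff subset_iff)
    note st = stieltjes_interval[OF fin sets \<open>a < b\<close>, of "e/4" H, OF continuous_on_subset[OF cont sub]]
    show "J a b = (LINT s|M. (if a < s \<and> s < b then pi else if s = a \<or> s = b then pi/2 else 0))"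
      unfolding J_def using that e c H by (intro st(1)) auto
    show "Im (H (of_real x)) \<ge> 0" if "a \<le> x" "x \<le> b" for x
      using \<open>x0 - d \<le> a\<close> \<open>b \<le> x0 + d\<close> e c H that by (intro st(2)) auto
  qed
  have nn: "Im (H (of_real x)) \<ge> 0" if "\<bar>x - x0\<bar> \<le> d" for x
    using st(2)[of "x0-d" "x0+d" x] that e unfolding d_def by linarith
  then show "\<And>x. \<bar>x - x0\<bar> < e \<Longrightarrow> Im (H (of_real x)) \<ge> 0" using e by (simp add: d_def)
  have contR: "continuous_on {x0-d..x0+d} (\<lambda>x. Im (H (of_real x)))"
  proof -
    have "continuous_on {x0-d..x0+d} (\<lambda>x. H (of_real x))"
      by (rule continuous_on_compose2[OF cont]) (use e d_def in \<open>auto intro!: continuous_intros simp: dist_real_def\<close>)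
    then show ?thesis by (intro continuous_intros)
  qed
  obtain B0 where B0: "\<And>x. \<bar>x - x0\<bar> \<le> d \<Longrightarrow> Im (H (of_real x)) \<le> B0"
  proof -
    have "bounded ((\<lambda>x. Im (H (of_real x))) ` {x0-d..x0+d})"
      by (intro compact_imp_bounded compact_continuous_image contR) auto
    then obtain B0 where "\<forall>x\<in>{x0-d..x0+d}. \<bar>Im (H (of_real x))\<bar> \<le> B0" by (auto simp: bounded_iff)
    then show thesis by (intro that[of B0]) (auto simp: abs_le_iff)
  qed
  have meas[measurable]: "(\<lambda>x. indicator {a..b} x *\<^sub>R Im (H (of_real x))) \<in> borel_measurable borel"
    if "x0 - d \<le> a" "b \<le> x0 + d" for a b
    using that by (intro borel_measurable_continuous_on_indicator continuous_on_subset[OF contR]) auto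
  have intg: "integrable lborel (\<lambda>x. indicator {a..b} x *\<^sub>R Im (H (of_real x)))"
    if "x0 - d \<le> a" "b \<le> x0 + d" for a b
    using borel_integrable_atLeastAtMost'[of a b "\<lambda>x. Im (H (of_real x))"] continuous_on_subset[OF contR, of "{a..b}"] that
    by (auto simp: set_integrable_def)
  have noatom: "measure M {c} = 0" if c: "x0 - d \<le> c" "c < x0 + d" for c
  proof (rule ccontr)
    define m where "m = measure M {c}"
    assume "measure M {c} \<noteq> 0"
    then have m: "m > 0" unfolding m_def by (simp add: less_le)
    have B00: "B0 \<ge> 0" using B0[of x0] nn[of x0] e by (simp add: d_def)
    \<comment> \<open>an interval so short that the integral of the density over it is below the mass of the supposed atom\<close>
    define b where "b = min (x0 + d) (c + m / (2 * (B0 + 1)))"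
    have b: "c < b" "b \<le> x0 + d" "(b - c) * B0 \<le> m / 2"
    proof -
      have "m / (2 * (B0 + 1)) > 0" using m B00 by simp
      then show "c < b" using c by (simp add: b_def)
      show "b \<le> x0 + d" by (simp add: b_def)
      have "(b - c) * B0 \<le> m / (2 * (B0 + 1)) * B0" using B00 by (intro mult_right_mono) (auto simp: b_def)
      also have "\<dots> \<le> m / 2" using B00 m by (simp add: field_simps)
      finally show "(b - c) * B0 \<le> m / 2" .
    qed
    have "pi/2 * m = (LINT s|M. pi/2 * indicator {c} s)" by (simp add: m_def)
    also have "\<dots> \<le> (LINT s|M. (if c < s \<and> s < b then pi else if s = c \<or> s = b then pi/2 else 0))"
      by (intro integral_mono integrable_const_bound[where B = pi]) (auto simp: indicator_def)
    also have "\<dots> = J c b" using st(1)[of c b] c b by simp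
    also have "J c b \<le> (LINT x|lborel. B0 * indicator {c..b} x)"
      unfolding J_def set_lebesgue_integral_def
    proof (rule integral_mono[OF intg])
      show "integrable lborel (\<lambda>x. B0 * indicator {c..b} x)" using b by auto
      show "indicator {c..b} x *\<^sub>R Im (H (of_real x)) \<le> B0 * indicator {c..b} x" for x
        using c b B0 by (auto simp: indicator_def)
    qed (use c b in auto)
    also have "\<dots> = (b - c) * B0" using b by simp
    also have "\<dots> \<le> m / 2" by fact
    finally have "pi * m \<le> m" by simp
    then show False using m pi_gt3 by (simp add: mult_le_cancel_right)
  qed
  define U where "U = {x0-e<..<x0+e}"
  define f where "f x = Im (H (of_real x)) / pi" for x
  have fm[measurable]: "(\<lambda>x. ennreal (f x) * indicator U x) \<in> borel_measurable borel"
  proof -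
    have "(\<lambda>x. ennreal (f x) * indicator U x) = (\<lambda>x. ennreal ((indicator {x0-e..x0+e} x *\<^sub>R Im (H (of_real x))) / pi) * indicator U x)"
      by (auto simp: U_def f_def indicator_def fun_eq_iff)
    then show ?thesis using meas[of "x0-e" "x0+e"] e by (simp add: U_def d_def)
  qed
  have key: "emeasure M {a<..<x0+e} = (\<integral>\<^sup>+x. ennreal (f x) * indicator {a<..<x0+e} x \<partial>lborel)"
    if "x0 - e \<le> a" "a < x0 + e" for a
  proof -
    let ?b = "x0 + e"
    have ab: "x0 - d \<le> a" "?b \<le> x0 + d" "a < ?b" "?b < x0 + d" "a < x0 + d" using that e by (auto simp: d_def)
    have ne: "AE s in M. s \<noteq> c" if "x0 - d \<le> c" "c < x0 + d" for c
      by (rule AE_I[where N = "{c}"]) (use noatom[OF that] sets in \<open>auto simp: emeasure_eq_measure\<close>)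
    have AE: "AE s in M. s \<noteq> a \<and> s \<noteq> ?b"
      using ne[of a] ne[of ?b] ab by auto
    have J': "J a ?b = (LINT s|M. pi * indicator {a<..<?b} s)" unfolding st(1)[OF ab(1,3,2)]
      by (intro integral_cong_AE) (use AE in \<open>auto elim!: eventually_mono simp: indicator_def\<close>)
    have nnf: "0 \<le> Im (H (of_real x)) / pi" if "a \<le> x" "x \<le> ?b" for x
      using nn[of x] that ab by auto
    from J' have J: "J a ?b / pi = measure M {a<..<?b}" by simp
    have "(\<integral>\<^sup>+x. ennreal (f x) * indicator {a<..<x0+e} x \<partial>lborel) = (\<integral>\<^sup>+x. ennreal (indicator {a..x0+e} x *\<^sub>R Im (H (of_real x)) / pi) \<partial>lborel)"
      by (intro nn_integral_cong_AE) (use AE_lborel_singleton[of a] AE_lborel_singleton[of ?b] in \<open>eventually_elim, auto simp: f_def indicator_def\<close>)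
    also have "\<dots> = ennreal (LINT x|lborel. indicator {a..x0+e} x *\<^sub>R Im (H (of_real x)) / pi)"
      by (intro nn_integral_eq_integral integrable_divide intg always_eventually allI)
        (use ab nnf in \<open>auto simp: indicator_def\<close>)
    also have "\<dots> = ennreal (J a ?b / pi)" by (simp add: J_def set_lebesgue_integral_def)
    finally show ?thesis by (simp add: J emeasure_eq_measure)
  qed
  have "density M (indicator U) = density lborel (\<lambda>x. ennreal (f x) * indicator U x)"
  proof (rule measure_eqI_lessThan)
    fix x
    have Ub: "U \<in> sets borel" by (simp add: U_def)
    have e1: "emeasure (density M (indicator U)) {x<..} = emeasure M (U \<inter> {x<..})"
      using Ub by (subst emeasure_density) (auto simp: indicator_inter_arith[symmetric])
    show "emeasure (density M (indicator U)) {x<..} < \<infinity>" unfolding e1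
      by (simp add: emeasure_eq_measure)
    have [measurable]: "{x<..} \<in> sets borel" by simp
    have e2: "emeasure (density lborel (\<lambda>x. ennreal (f x) * indicator U x)) {x<..} = (\<integral>\<^sup>+v. ennreal (f v) * indicator (U \<inter> {x<..}) v \<partial>lborel)"
      by (subst emeasure_density) (auto simp: indicator_inter_arith mult_ac intro!: nn_integral_cong)
    have U': "U \<inter> {x<..} = {max x (x0-e)<..<x0+e}" by (auto simp: U_def)
    show "emeasure (density M (indicator U)) {x<..} = emeasure (density lborel (\<lambda>x. ennreal (f x) * indicator U x)) {x<..}"
      unfolding e1 e2 U' using key[of "max x (x0-e)"] e by (cases "max x (x0-e) < x0 + e") auto
  qed (use sets in auto)
  then show "emeasure M B = (\<integral>\<^sup>+x\<in>B. ennreal (Im (H (of_real x)) / pi) \<partial>lborel)"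
    if B: "B \<in> sets borel" "B \<subseteq> {x0-e<..<x0+e}" for B
  proof -
    have UB: "U \<inter> B = B" "U \<in> sets borel" using B by (auto simp: U_def)
    have "emeasure M B = emeasure (density M (indicator U)) B"
      using B UB by (subst emeasure_density) (auto simp: indicator_inter_arith[symmetric] sets)
    also have "\<dots> = emeasure (density lborel (\<lambda>x. ennreal (f x) * indicator U x)) B"
      using \<open>density M (indicator U) = _\<close> by simp
    also have "\<dots> = (\<integral>\<^sup>+x. ennreal (f x) * indicator (U \<inter> B) x \<partial>lborel)"
      using B by (subst emeasure_density) (auto simp: indicator_inter_arith mult_ac intro!: nn_integral_cong)
    finally show ?thesis unfolding UB f_def .
  qed
qed

section \<open>The transforms of a measure on the half-line\<close>

lemma slit_plane_iff: "z \<in> slit_plane \<longleftrightarrow> Im z \<noteq> 0 \<or> Re z < 0"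
  by (auto simp: slit_plane_def complex_nonneg_Reals_iff)

lemma open_slit_plane: "open slit_plane"
  unfolding slit_plane_def by (simp add: closed_nonneg_Reals_complex open_Compl)

lemma slit_plane_upper: "Im z > 0 \<Longrightarrow> z \<in> slit_plane"
  by (simp add: slit_plane_iff)

lemma slit_plane_neg: "y < 0 \<Longrightarrow> complex_of_real y \<in> slit_plane"
  by (simp add: slit_plane_iff)

lemma slit_plane_inverse: "z \<in> slit_plane \<Longrightarrow> 1 / z \<in> slit_plane"
  by (auto simp: slit_plane_iff Re_divide Im_divide divide_simps sum_power2_eq_zero_iff not_less)

lemma slit_plane_nz: "z \<in> slit_plane \<Longrightarrow> z \<noteq> 0"
  by (auto simp: slit_plane_iff)

lemma slit_plane_dist:
  assumes "z \<in> slit_plane"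
  obtains d where "d > 0" "\<And>s. s \<ge> 0 \<Longrightarrow> d \<le> norm (z - complex_of_real s)"
proof -
  obtain d where d: "d > 0" "ball z d \<subseteq> slit_plane"
    using open_slit_plane assms open_contains_ball by blast
  show thesis
  proof (rule that[OF d(1)])
    fix s :: real assume "s \<ge> 0"
    then have "complex_of_real s \<notin> slit_plane" by (simp add: slit_plane_iff)
    then have "complex_of_real s \<notin> ball z d" using d by auto
    then show "d \<le> norm (z - complex_of_real s)" by (simp add: dist_norm)
  qed
qed

locale nontrivial_nonneg_prob =
  fixes M :: "real measure"
  assumes M: "M \<in> prob_nonneg_nontrivial"
begin

sublocale prob_space M
  using M by (simp add: prob_nonneg_nontrivial_def)

lemma sets_M[measurable_cong]: "sets M = sets borel"
  using M by (simp add: prob_nonneg_nontrivial_def borel_on_nonneg_def)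

lemma AE_nonneg: "AE s in M. s \<ge> 0"
  using M by (intro AE_I[where N = "{..<0}"]) (auto simp: prob_nonneg_nontrivial_def borel_on_nonneg_def)

text \<open>This is where the exclusion of the point mass at \<open>0\<close> enters; it makes all the strict inequalities
  below strict.\<close>

lemma not_AE_0: "\<not> (AE s in M. s = 0)"
proof
  assume *: "AE s in M. s = 0"
  have "M = return borel 0"
  proof (rule measure_eqI)
    fix A assume "A \<in> sets M"
    then have A: "A \<in> sets borel" by (simp add: sets_M)
    have "emeasure M A = (\<integral>\<^sup>+s. indicator A s \<partial>M)" using A sets_M by simp
    also have "\<dots> = (\<integral>\<^sup>+s. indicator A 0 \<partial>M)"
      by (intro nn_integral_cong_AE) (use * in \<open>auto elim!: eventually_mono\<close>)
    finally show "emeasure M A = emeasure (return borel 0) A" using A by (simp add: emeasure_space_1)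
  qed (simp add: sets_M)
  then show False using M by (simp add: prob_nonneg_nontrivial_def)
qed

lemma AE_dist:
  assumes "z \<in> slit_plane"
  obtains d where "d > 0" "AE s in M. d \<le> norm (z - complex_of_real s)"
proof -
  obtain d where d: "d > 0" "\<And>s. s \<ge> 0 \<Longrightarrow> d \<le> norm (z - complex_of_real s)"
    using slit_plane_dist[OF assms] by metis
  have "AE s in M. d \<le> norm (z - complex_of_real s)" using AE_nonneg by eventually_elim (rule d(2))
  then show thesis using that d(1) by blast
qed

lemma one_minus_nz: "z \<in> slit_plane \<Longrightarrow> s \<ge> 0 \<Longrightarrow> 1 - z * complex_of_real s \<noteq> 0"
  by (auto simp: slit_plane_iff complex_eq_iff) (smt (verit) mult_neg_pos mult_nonneg_nonneg not_le mult_nonpos_nonneg)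

text \<open>The last identity reduces every question about \<open>\<psi>\<close> to the Cauchy transform at the inverted
  point.\<close>

lemma integrable_psi:
  assumes "z \<in> slit_plane"
  shows "integrable M (\<lambda>s. 1 / (1 - z * complex_of_real s))"
    and "integrable M (\<lambda>s. z * complex_of_real s / (1 - z * complex_of_real s))"
    and "1 + psi_transform M z = (LINT s|M. 1 / (1 - z * complex_of_real s))"
    and "1 + psi_transform M z = cauchy_tr M (1 / z) / z"
proof -
  obtain d where d: "d > 0" "AE s in M. d \<le> norm (1 / z - complex_of_real s)"
    using AE_dist[OF slit_plane_inverse[OF assms]] .
  have z0: "z \<noteq> 0" using assms by (auto simp: slit_plane_iff)
  have i: "integrable M (\<lambda>s. 1 / (1 / z - complex_of_real s))"
    by (rule cauchy_tr_bound_integrable(1)[OF finite_measure_axioms sets_M d])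
  have eq: "1 / (1 - z * complex_of_real s) = 1 / (1 / z - complex_of_real s) / z" for s
  proof -
    have "1 - z * complex_of_real s = (1 / z - complex_of_real s) * z" using z0 by (simp add: algebra_simps)
    then show ?thesis by simp
  qed
  show 1: "integrable M (\<lambda>s. 1 / (1 - z * complex_of_real s))" unfolding eq by (intro integrable_divide_zero i)
  have AEeq: "AE s in M. z * complex_of_real s / (1 - z * complex_of_real s) = 1 / (1 - z * complex_of_real s) - 1"
    using AE_nonneg one_minus_nz[OF assms] by (auto elim!: eventually_mono simp: field_simps)
  show "integrable M (\<lambda>s. z * complex_of_real s / (1 - z * complex_of_real s))"
    by (subst integrable_cong_AE[OF _ _ AEeq]) (use 1 in auto)
  have "psi_transform M z = (LINT s|M. 1 / (1 - z * complex_of_real s) - 1)"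
    unfolding psi_transform_def by (intro integral_cong_AE AEeq) auto
  also have "\<dots> = (LINT s|M. 1 / (1 - z * complex_of_real s)) - 1" using 1 by (simp add: prob_space)
  finally show 3: "1 + psi_transform M z = (LINT s|M. 1 / (1 - z * complex_of_real s))" by simp
  show "1 + psi_transform M z = cauchy_tr M (1 / z) / z"
    unfolding 3 eq cauchy_tr_def by (rule integral_divide_zero)
qed

lemma psi_holomorphic: "psi_transform M holomorphic_on slit_plane"
proof -
  have C: "cauchy_tr M holomorphic_on slit_plane"
    unfolding holomorphic_on_def
  proof
    fix w assume "w \<in> slit_plane"
    then obtain d where d: "d > 0" "AE s in M. d \<le> norm (w - complex_of_real s)" using AE_dist by blast
    show "cauchy_tr M field_differentiable at w within slit_plane"
      using cauchy_tr_has_field_derivative[OF finite_measure_axioms sets_M d]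
      by (meson field_differentiable_at_within field_differentiable_def)
  qed
  have "(\<lambda>z. cauchy_tr M (1 / z) / z - 1) holomorphic_on slit_plane"
    by (intro holomorphic_intros holomorphic_on_compose_gen[OF _ C, unfolded o_def])
      (auto simp: slit_plane_inverse slit_plane_nz)
  then show ?thesis
    by (rule holomorphic_transform) (use integrable_psi(4) in \<open>auto simp: algebra_simps eq_diff_eq\<close>)
qed

lemma psi_cnj: "psi_transform M (cnj z) = cnj (psi_transform M z)"
  unfolding psi_transform_def by (subst Bochner_Integration.integral_cnj[symmetric]) (simp del: Bochner_Integration.integral_cnj)

lemma integral_pos_AE:
  assumes "integrable M f" "AE s in M. s \<noteq> 0 \<longrightarrow> f s > (0::real)" "AE s in M. f s \<ge> 0"
  shows "(LINT s|M. f s) > 0"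
proof -
  have "(LINT s|M. f s) \<noteq> 0"
  proof
    assume "(LINT s|M. f s) = 0"
    then have "AE s in M. f s = 0" using integral_nonneg_eq_0_iff_AE assms by blast
    then have "AE s in M. s = 0" using assms(2) by eventually_elim auto
    then show False using not_AE_0 by simp
  qed
  moreover have "(LINT s|M. f s) \<ge> 0" using assms by (simp add: integral_nonneg_AE)
  ultimately show ?thesis by simp
qed

lemma Im_psi_pos:
  assumes "Im z > 0"
  shows "Im (psi_transform M z) > 0"
proof -
  have z: "z \<in> slit_plane" using assms by (rule slit_plane_upper)
  note i = integrable_psi(2)[OF z]
  have Im: "Im (z * complex_of_real s / (1 - z * complex_of_real s)) = s * Im z / (norm (1 - z * complex_of_real s))^2" for s
    by (simp add: Im_divide cmod_power2 algebra_simps)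
  have "Im (psi_transform M z) = (LINT s|M. s * Im z / (norm (1 - z * complex_of_real s))^2)"
    unfolding psi_transform_def integral_Im[OF i, symmetric] Im ..
  also have "\<dots> > 0"
  proof (rule integral_pos_AE)
    show "integrable M (\<lambda>s. s * Im z / (norm (1 - z * complex_of_real s))^2)"
      using integrable_Im[OF i] unfolding Im .
    show "AE s in M. s \<noteq> 0 \<longrightarrow> s * Im z / (norm (1 - z * complex_of_real s))^2 > 0"
      using AE_nonneg by eventually_elim (use assms one_minus_nz[OF z] in auto)
    show "AE s in M. s * Im z / (norm (1 - z * complex_of_real s))^2 \<ge> 0"
      using AE_nonneg by eventually_elim (use assms in auto)
  qed
  finally show ?thesis .
qed

definition psi_real :: "real \<Rightarrow> real" where "psi_real y = (LINT s|M. 1 / (1 - y * s)) - 1"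

lemma psi_neg:
  assumes "y < 0"
  shows "psi_transform M (of_real y) = of_real (psi_real y)"
    "integrable M (\<lambda>s. 1 / (1 - y * s))"
    "1 + psi_real y > 0" "psi_real y < 0"
proof -
  note z = slit_plane_neg[OF assms]
  have eq: "1 / (1 - complex_of_real y * complex_of_real s) = complex_of_real (1 / (1 - y * s))" for s by simp
  show i: "integrable M (\<lambda>s. 1 / (1 - y * s))"
    using integrable_psi(1)[OF z] unfolding eq by (simp only: complex_of_real_integrable_eq)
  have "1 + psi_transform M (of_real y) = complex_of_real (LINT s|M. 1 / (1 - y * s))"
    unfolding integrable_psi(3)[OF z] eq by (rule integral_complex_of_real)
  then show "psi_transform M (of_real y) = of_real (psi_real y)" by (simp add: psi_real_def algebra_simps eq_diff_eq)
  have pos: "1 - y * s > 0" if "s \<ge> 0" for s using assms that by (smt (verit) mult_nonpos_nonneg)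
  have "(LINT s|M. 1 / (1 - y * s)) > 0"
  proof (rule integral_pos_AE[OF i])
    show "AE s in M. s \<noteq> 0 \<longrightarrow> 1 / (1 - y * s) > 0"
      using AE_nonneg by eventually_elim (use pos in simp)
    show "AE s in M. 1 / (1 - y * s) \<ge> 0"
      using AE_nonneg by eventually_elim (use pos less_imp_le in fastforce)
  qed
  then show "1 + psi_real y > 0" by (simp add: psi_real_def)
  have "(LINT s|M. 1 - 1 / (1 - y * s)) > 0"
  proof (rule integral_pos_AE)
    have 1: "1 - 1 / (1 - y * s) > 0" if "s \<ge> 0" "s \<noteq> 0" for s
      using mult_neg_pos[OF assms, of s] that by simp
    have 2: "1 - 1 / (1 - y * s) \<ge> 0" if "s \<ge> 0" for s
      using 1[OF that] by (cases "s = 0") auto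
    show "AE s in M. s \<noteq> 0 \<longrightarrow> 1 - 1 / (1 - y * s) > 0" "AE s in M. 1 - 1 / (1 - y * s) \<ge> 0"
      by (use AE_nonneg in \<open>eventually_elim, use 1 in blast\<close>) (use AE_nonneg in \<open>eventually_elim, use 2 in blast\<close>)
  qed (use i in auto)
  then show "psi_real y < 0" using i by (simp add: psi_real_def prob_space)
qed

lemma psi_real_strict_mono:
  assumes "x < y" "y < 0"
  shows "psi_real x < psi_real y"
proof -
  have pos: "1 - y * s > 0" "1 - x * s > 0" if "s \<ge> 0" for s using assms that by (smt (verit) mult_nonpos_nonneg)+
  note i = psi_neg(2)[OF assms(2)] psi_neg(2)[of x]
  have "(LINT s|M. 1 / (1 - y * s) - 1 / (1 - x * s)) > 0"
  proof (rule integral_pos_AE)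
    have 1: "1 / (1 - y * s) - 1 / (1 - x * s) > 0" if "s \<ge> 0" "s \<noteq> 0" for s
    proof -
      have "1 / (1 - y * s) - 1 / (1 - x * s) = (y - x) * s / ((1 - y * s) * (1 - x * s))"
        using pos[OF that(1)] by (simp add: field_simps)
      also have "\<dots> > 0" using pos[OF that(1)] that assms by (intro divide_pos_pos mult_pos_pos) auto
      finally show ?thesis .
    qed
    have 2: "1 / (1 - y * s) - 1 / (1 - x * s) \<ge> 0" if "s \<ge> 0" for s
      using 1[OF that] by (cases "s = 0") auto
    show "AE s in M. s \<noteq> 0 \<longrightarrow> 1 / (1 - y * s) - 1 / (1 - x * s) > 0" "AE s in M. 1 / (1 - y * s) - 1 / (1 - x * s) \<ge> 0"
      by (use AE_nonneg in \<open>eventually_elim, use 1 in blast\<close>) (use AE_nonneg in \<open>eventually_elim, use 2 in blast\<close>)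
  qed (use i assms in auto)
  then show ?thesis using i assms by (simp add: psi_real_def)
qed

text \<open>Dominated convergence: the integrand tends to \<open>1\<close> and is at most \<open>1\<close>.\<close>

lemma psi_real_at_left_0: "(psi_real \<longlongrightarrow> 0) (at_left 0)"
proof (rule tendsto_at_left_sequentially[of "-1"])
  fix S :: "nat \<Rightarrow> real" assume S: "\<And>n. S n < 0" "S \<longlonglongrightarrow> 0"
  have "(\<lambda>n. LINT s|M. 1 / (1 - S n * s)) \<longlonglongrightarrow> (LINT s|M. 1)"
  proof (rule integral_dominated_convergence[where w = "\<lambda>_. 1"])
    show "AE s in M. (\<lambda>n. 1 / (1 - S n * s)) \<longlonglongrightarrow> 1"
      using S(2) by (auto intro!: tendsto_eq_intros)
    show "AE s in M. norm (1 / (1 - S n * s)) \<le> 1" for n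
      using AE_nonneg
    proof eventually_elim
      case (elim s)
      then have "S n * s \<le> 0" using S(1)[of n] by (simp add: mult_nonpos_nonneg)
      then show ?case by simp
    qed
  qed auto
  then show "(\<lambda>n. psi_real (S n)) \<longlonglongrightarrow> 0"
    unfolding psi_real_def by (auto intro!: tendsto_eq_intros simp: prob_space)
qed auto

lemma one_psi_nz:
  assumes "z \<in> slit_plane"
  shows "1 + psi_transform M z \<noteq> 0"
proof -
  consider "Im z > 0" | "Im z < 0" | "Im z = 0" "Re z < 0" using assms by (force simp: slit_plane_iff)
  then show ?thesis
  proof cases
    case 1
    then show ?thesis using Im_psi_pos[of z] by (auto simp: complex_eq_iff)
  next
    case 2
    then show ?thesis using Im_psi_pos[of "cnj z"] by (auto simp: complex_eq_iff psi_cnj)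
  next
    case 3
    then have "z = of_real (Re z)" by (simp add: complex_eq_iff)
    then show ?thesis using psi_neg(1,3)[OF 3(2)] by (metis Re_complex_of_real of_real_0 of_real_1 of_real_add less_irrefl)
  qed
qed

lemma eta_alt: "z \<in> slit_plane \<Longrightarrow> eta_transform M z = 1 - 1 / (1 + psi_transform M z)"
  using one_psi_nz[of z] by (simp add: eta_transform_def field_simps)

lemma one_minus_eta: "z \<in> slit_plane \<Longrightarrow> 1 / (1 - eta_transform M z) = 1 + psi_transform M z"
  using one_psi_nz[of z] by (simp add: eta_alt)

text \<open>The bridge from \<open>\<eta>\<close> to Stieltjes inversion.\<close>

lemma cauchy_tr_eta: "z \<in> slit_plane \<Longrightarrow> cauchy_tr M (1 / z) = z / (1 - eta_transform M z)"
  using integrable_psi(4)[of z] one_minus_eta[of z] slit_plane_nz[of z]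
  by (metis mult.commute nonzero_eq_divide_eq times_divide_eq_right mult.right_neutral)

lemma eta_holomorphic: "eta_transform M holomorphic_on slit_plane"
  unfolding eta_transform_def using psi_holomorphic one_psi_nz by (intro holomorphic_intros) auto

lemma Im_eta_pos:
  assumes "Im z > 0" shows "Im (eta_transform M z) > 0"
proof -
  have "Im (1 / (1 + psi_transform M z)) < 0"
    using Im_psi_pos[OF assms] by (simp add: Im_divide divide_neg_pos sum_power2_gt_zero_iff)
  then show ?thesis using eta_alt[OF slit_plane_upper[OF assms]] by simp
qed

definition eta_real :: "real \<Rightarrow> real" where "eta_real y = psi_real y / (1 + psi_real y)"

lemma eta_neg:
  assumes "y < 0"
  shows "eta_transform M (of_real y) = of_real (eta_real y)" "eta_real y < 0"
  using psi_neg[OF assms] by (simp_all add: eta_transform_def eta_real_def divide_neg_pos)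

lemma eta_real_strict_mono:
  assumes "x < y" "y < 0"
  shows "eta_real x < eta_real y"
  using psi_real_strict_mono[OF assms] psi_neg[OF assms(2)] psi_neg[of x] assms
  by (simp add: eta_real_def field_simps)

lemma eta_real_at_left_0: "filterlim eta_real (at_left 0) (at_left 0)"
proof -
  have "(eta_real \<longlongrightarrow> 0) (at_left 0)"
    unfolding eta_real_def using psi_real_at_left_0 by (auto intro!: tendsto_eq_intros)
  then show ?thesis using eta_neg(2)
    by (force simp: filterlim_at eventually_at_left_field intro!: exI[of _ "-1"])
qed

lemma inj_eta: "inj_on eta_real {..<0}"
  by (rule inj_onI) (metis eta_real_strict_mono lessThan_iff less_irrefl linorder_neqE_linordered_idom)

lemma inv_eta_eq: "inv_into {..<0} (\<lambda>y. Re (eta_transform M (complex_of_real y))) x = inv_into {..<0} eta_real x"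
  unfolding inv_into_def by (rule arg_cong[where f = Eps]) (auto simp: eta_neg(1))

lemma Sigma_eta: "y < 0 \<Longrightarrow> Sigma_transform M (eta_real y) = y / eta_real y"
  unfolding Sigma_transform_def inv_eta_eq by (simp add: inj_eta)

text \<open>The defining property of the inverse holds as soon as \<open>x\<close> lies in the range; together with
  \<open>eventually_in_range_eta\<close> it makes \<open>\<Sigma>\<close> meaningful for all negative \<open>x\<close> near \<open>0\<close>.\<close>

lemma eta_Sigma:
  assumes "x \<in> eta_real ` {..<0}"
  shows "eta_real (x * Sigma_transform M x) = x" "x * Sigma_transform M x < 0"
proof -
  have "x \<noteq> 0" using assms eta_neg(2) by force
  then have "x * Sigma_transform M x = inv_into {..<0} eta_real x" by (simp add: Sigma_transform_def inv_eta_eq)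
  then show "eta_real (x * Sigma_transform M x) = x" "x * Sigma_transform M x < 0"
    using f_inv_into_f[OF assms] inv_into_into[OF assms] by auto
qed

lemma continuous_eta_real: "continuous_on {..<0} eta_real"
proof -
  have "continuous_on {..<0} (\<lambda>y. Re (eta_transform M (complex_of_real y)))"
    using continuous_on_compose2[OF holomorphic_on_imp_continuous_on[OF eta_holomorphic], of "{..<0}" complex_of_real]
    by (auto intro!: continuous_intros simp: slit_plane_neg image_subset_iff)
  then show ?thesis by (rule continuous_on_eq) (simp add: eta_neg)
qed

text \<open>Intermediate value theorem between \<open>-1\<close> and a point close to \<open>0\<close>.\<close>

lemma eventually_in_range_eta: "\<forall>\<^sub>F x in at_left 0. x \<in> eta_real ` {..<0}"
proof -
  have "x \<in> eta_real ` {..<0}" if x: "eta_real (-1) < x" "x < 0" for x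
  proof -
    have "\<forall>\<^sub>F y in at_left 0. eta_real y > x \<and> -1 < y \<and> y < 0"
      using eta_real_at_left_0 x(2)
      by (intro eventually_conj order_tendstoD(1)[of eta_real 0])
        (auto simp: filterlim_at eventually_at_left_field intro!: exI[of _ "-1"])
    then obtain y where y: "x < eta_real y" "-1 < y" "y < 0"
      using eventually_happens[of _ "at_left (0::real)"] by auto
    have "\<exists>v\<ge>-1. v \<le> y \<and> eta_real v = x"
      using x y by (intro IVT' continuous_on_subset[OF continuous_eta_real]) auto
    then show ?thesis using y by force
  qed
  then show ?thesis using eta_neg(2)[of "-1"] by (auto simp: eventually_at_left_field intro!: exI[of _ "eta_real (-1)"])
qed

end

text \<open>Put \<open>x = \<eta>\<^sub>\<mu> y\<close>. Then \<open>\<Sigma>\<^sub>\<mu> x = y / x = exp (u y)\<close>, so the inverse of \<open>\<eta>\<^sub>\<nu>\<close> at \<open>x\<close> is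
  \<open>x (y / x)\<^sup>t = y exp ((t - 1) u y)\<close>, which is \<open>\<Phi> y\<close>.\<close>

lemma eta_power_near_0:
  assumes "\<mu> \<in> prob_nonneg_nontrivial" "is_free_mult_power \<mu> t \<nu>" "is_log_kappa \<mu> u"
  shows "\<forall>\<^sub>F y in at_left 0. eta_transform \<nu> (Phi u t (complex_of_real y)) = eta_transform \<mu> (complex_of_real y)"
proof -
  interpret m: nontrivial_nonneg_prob \<mu> by standard fact
  interpret n: nontrivial_nonneg_prob \<nu> by standard (use assms(2) in \<open>simp add: is_free_mult_power_def\<close>)
  have "\<forall>\<^sub>F y in at_left 0. Sigma_transform \<nu> (m.eta_real y) = Sigma_transform \<mu> (m.eta_real y) powr t"
    using assms(2) m.eta_real_at_left_0 by (auto simp: is_free_mult_power_def filterlim_iff)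
  moreover have "\<forall>\<^sub>F y in at_left 0. m.eta_real y \<in> n.eta_real ` {..<0}"
    using n.eventually_in_range_eta m.eta_real_at_left_0 by (auto simp: filterlim_iff)
  moreover have "\<forall>\<^sub>F y in at_left (0::real). y < 0" by (simp add: eventually_at_filter)
  ultimately show ?thesis
  proof eventually_elim
    case (elim y)
    define x where "x = m.eta_real y"
    define c where "c = Re (u (of_real y))"
    have "u (of_real y) = cnj (u (of_real y))"
      using assms(3) slit_plane_neg[OF elim(3)] by (metis complex_cnj_complex_of_real is_log_kappa_def)
    then have uy: "u (of_real y) = of_real c" by (simp add: c_def complex_eq_iff)
    have x: "x < 0" using m.eta_neg[OF elim(3)] by (simp add: x_def)
    have "exp (u (of_real y)) = of_real y / of_real x"
      using assms(3) slit_plane_neg[OF elim(3)] m.eta_neg[OF elim(3)] by (simp add: is_log_kappa_def kappa_def x_def)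
    then have "complex_of_real (exp c) = of_real (y / x)" by (simp add: uy exp_of_real)
    then have ec: "exp c = y / x" using of_real_eq_iff by blast
    have "x * Sigma_transform \<nu> x = x * exp c powr t"
      using elim(1) m.Sigma_eta[OF elim(3)] by (simp add: x_def[symmetric] ec)
    also have "\<dots> = x * exp c * exp ((t - 1) * c)"
      by (simp add: powr_def exp_add[symmetric] algebra_simps)
    also have "x * exp c = y" using x by (simp add: ec)
    finally have *: "x * Sigma_transform \<nu> x = y * exp ((t - 1) * c)" .
    have P: "Phi u t (of_real y) = of_real (x * Sigma_transform \<nu> x)"
      unfolding * Phi_def uy by (simp flip: exp_of_real)
    have im: "x \<in> n.eta_real ` {..<0}" using elim(2) by (simp add: x_def)
    show ?case unfolding P using n.eta_neg(1)[OF n.eta_Sigma(2)[OF im]] n.eta_Sigma(1)[OF im] m.eta_neg(1)[OF elim(3)]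
      by (simp add: x_def)
  qed
qed

section \<open>The integral representation of u\<close>

lemma x_cos_less_sin:
  assumes "0 < x" "x < pi" shows "x * cos x < sin x"
proof -
  have "(\<lambda>x. sin x - x * cos x) 0 < (\<lambda>x. sin x - x * cos x) x"
  proof (rule DERIV_pos_imp_increasing_open[OF assms(1)])
    fix y assume y: "0 < y" "y < x"
    have "((\<lambda>x. sin x - x * cos x) has_real_derivative y * sin y) (at y)"
      by (auto intro!: derivative_eq_intros)
    moreover have "y * sin y > 0" using y assms by (intro mult_pos_pos sin_gt_zero) auto
    ultimately show "\<exists>d. ((\<lambda>x. sin x - x * cos x) has_real_derivative d) (at y) \<and> 0 < d" by blast
  qed (intro continuous_intros)
  then show ?thesis by simp
qed

lemma sin_div_strict_antimono:
  assumes "0 < x" "x < y" "y < pi" shows "x * sin y < y * sin x"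
proof -
  have "(\<lambda>x. sin x / x) y < (\<lambda>x. sin x / x) x"
  proof (rule DERIV_neg_imp_decreasing[OF assms(2)])
    fix z assume z: "x \<le> z" "z \<le> y"
    have "((\<lambda>x. sin x / x) has_real_derivative (cos z * z - sin z) / (z * z)) (at z)"
      using z assms by (auto intro!: derivative_eq_intros)
    moreover have "(cos z * z - sin z) / (z * z) < 0"
      using x_cos_less_sin[of z] z assms by (intro divide_neg_pos) (auto simp: mult.commute)
    ultimately show "\<exists>d. ((\<lambda>x. sin x / x) has_real_derivative d) (at z) \<and> d < 0" by blast
  qed
  then show ?thesis using assms by (simp add: field_simps)
qed

text \<open>A lower bound for the sine that vanishes to first order at both ends; it is doubled from
  \<open>[0, \<pi> / 2]\<close> by symmetry.\<close>

lemma sin_ge_parabola: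
  assumes "0 \<le> x" "x \<le> pi" shows "2 * x * (pi - x) \<le> pi^2 * sin x"
proof -
  have *: "2 * x * (pi - x) \<le> pi^2 * sin x" if x: "0 \<le> x" "x \<le> pi/2" for x
  proof -
    have "2 * x \<le> pi * sin x"
    proof -
      consider "x = 0" | "x = pi/2" | "0 < x" "x < pi/2" using x by linarith
      then show ?thesis
      proof cases
        case 2
        then show ?thesis unfolding 2 by simp
      next
        case 3
        then show ?thesis using sin_div_strict_antimono[of x "pi/2"] by (simp add: field_simps)
      qed simp
    qed
    then have "2 * x * (pi - x) \<le> (pi * sin x) * (pi - x)" using x by (intro mult_right_mono) auto
    also have "\<dots> \<le> (pi * sin x) * pi"
      using x sin_ge_zero[of x] by (intro mult_left_mono) auto
    finally show ?thesis by (simp add: power2_eq_square mult_ac)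
  qed
  show ?thesis
  proof (cases "x \<le> pi/2")
    case False
    then show ?thesis using *[of "pi - x"] assms by (simp add: mult_ac)
  qed (use * assms in auto)
qed

lemma norm_rcis_diff: "(norm (rcis r \<theta> - complex_of_real s))^2 = r^2 + s^2 - 2 * r * s * cos \<theta>"
proof -
  have "(norm (rcis r \<theta> - complex_of_real s))^2 = (r * cos \<theta> - s)^2 + (r * sin \<theta>)^2"
    by (simp add: cmod_power2)
  also have "\<dots> = r^2 * ((sin \<theta>)^2 + (cos \<theta>)^2) + s^2 - 2 * r * s * cos \<theta>"
    by algebra
  finally show ?thesis by simp
qed

text \<open>Turning a point of the circle of radius \<open>r\<close> away from the positive half-line moves it away from
  every nonnegative number.\<close>

lemma norm_rcis_diff_mono:
  assumes "r \<ge> 0" "s \<ge> 0" "0 \<le> \<theta>1" "\<theta>1 \<le> \<theta>2" "\<theta>2 \<le> pi"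
  shows "norm (rcis r \<theta>1 - complex_of_real s) \<le> norm (rcis r \<theta>2 - complex_of_real s)"
proof -
  have "cos \<theta>2 \<le> cos \<theta>1" using assms by (intro cos_monotone_0_pi_le) auto
  then have "2 * r * s * cos \<theta>2 \<le> 2 * r * s * cos \<theta>1" using assms by (intro mult_left_mono) auto
  then have "(norm (rcis r \<theta>1 - complex_of_real s))^2 \<le> (norm (rcis r \<theta>2 - complex_of_real s))^2"
    unfolding norm_rcis_diff by simp
  then show ?thesis by (rule power2_le_imp_le) simp
qed

locale nevanlinna =
  fixes u :: "complex \<Rightarrow> complex" and a :: real and \<rho> :: "real measure"
  assumes rep: "nevanlinna_rep u a \<rho>"
begin

sublocale finite_measure \<rho>
  using rep by (simp add: nevanlinna_rep_def)

lemma sets_rho[measurable_cong]: "sets \<rho> = sets borel"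
  using rep by (simp add: nevanlinna_rep_def borel_on_nonneg_def)

lemma rho_nonneg: "AE s in \<rho>. s \<ge> 0"
  using rep by (intro AE_I[where N = "{..<0}"]) (auto simp: nevanlinna_rep_def borel_on_nonneg_def)

text \<open>The kernel with \<open>- Im u = Im z * \<integral> K z\<close>. At \<open>s = z\<close> it has the default value \<open>0\<close>; \<open>tame\<close> demands
  that such \<open>s\<close> carry no mass.\<close>

definition K :: "complex \<Rightarrow> real \<Rightarrow> real" where
  "K z s = (1 + s\<^sup>2) / (norm (z - complex_of_real s))\<^sup>2"

text \<open>The points at which the integral representation of \<open>u\<close> converges well enough for the estimates
  below. All points off the slit are tame, and so are those points of the slit that lie on the boundary
  of \<open>\<Omega>\<^sub>t\<close> for some \<open>t\<close>.\<close>

definition tame :: "complex \<Rightarrow> bool" where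
  "tame z \<longleftrightarrow> (AE s in \<rho>. z \<noteq> complex_of_real s) \<and> integrable \<rho> (K z)"

definition N :: "complex \<Rightarrow> real" where
  "N z = (LINT s|\<rho>. K z s)"

text \<open>The integral representation taken at every point of the plane. It agrees with \<open>u\<close> off the slit and
  provides the boundary values of \<open>u\<close> on it.\<close>

definition u_int :: "complex \<Rightarrow> complex" where
  "u_int z = complex_of_real a + (LINT s|\<rho>. (1 + z * complex_of_real s) / (z - complex_of_real s))"

lemma K_measurable[measurable]: "K z \<in> borel_measurable borel"
  unfolding K_def by measurable

lemma K_nonneg: "K z s \<ge> 0" by (simp add: K_def)

lemma N_nonneg: "N z \<ge> 0" unfolding N_def by (intro integral_nonneg_AE) (simp add: K_nonneg)

lemma u_eq_u_int: "z \<in> slit_plane \<Longrightarrow> u z = u_int z"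
  using rep by (simp add: nevanlinna_rep_def u_int_def)

text \<open>Away from \<open>z\<close> the kernel \<open>K z\<close> is bounded, by \<open>s\<^sup>2 \<le> 2 |z - s|\<^sup>2 + 2 |z|\<^sup>2\<close>.\<close>

lemma tame_if_dist:
  assumes "d > 0" "AE s in \<rho>. d \<le> norm (z - complex_of_real s)"
  shows "tame z"
  unfolding tame_def
proof
  show "AE s in \<rho>. z \<noteq> complex_of_real s" using assms(2) by eventually_elim (use assms(1) in auto)
  show "integrable \<rho> (K z)"
  proof (rule integrable_const_bound[where B = "2 + (1 + 2 * (norm z)^2) / d^2"])
    show "AE s in \<rho>. norm (K z s) \<le> 2 + (1 + 2 * (norm z)^2) / d^2"
      using assms(2)
    proof eventually_elim
      case (elim s)
      define m where "m = norm (z - complex_of_real s)"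
      have m: "m \<ge> d" "m > 0" using elim assms(1) by (auto simp: m_def)
      have "\<bar>s\<bar> \<le> m + norm z" unfolding m_def
        by (metis norm_of_real norm_minus_commute add.commute norm_triangle_sub)
      then have "s^2 \<le> (m + norm z)^2" by (metis abs_le_square_iff abs_of_nonneg add_nonneg_nonneg less_imp_le m(2) norm_ge_zero)
      also have "\<dots> \<le> 2 * m^2 + 2 * (norm z)^2" using sum_squares_bound[of m "norm z"] by (simp add: power2_sum)
      finally have "1 + s^2 \<le> 2 * m^2 + (1 + 2 * (norm z)^2)" by simp
      then have "(1 + s^2) / m^2 \<le> (2 * m^2 + (1 + 2 * (norm z)^2)) / m^2" by (rule divide_right_mono) simp
      also have "\<dots> = 2 + (1 + 2 * (norm z)^2) / m^2" using m by (simp add: add_divide_distrib)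
      also have "\<dots> \<le> 2 + (1 + 2 * (norm z)^2) / d^2" using m assms(1)
        by (intro add_left_mono divide_left_mono power_mono mult_pos_pos) auto
      finally show ?case using K_nonneg[of z s] by (simp add: K_def m_def)
    qed
  qed simp
qed

lemma slit_AE_dist:
  assumes "z \<in> slit_plane"
  obtains d where "d > 0" "AE s in \<rho>. d \<le> norm (z - complex_of_real s)"
proof -
  obtain d where d: "d > 0" "\<And>s. s \<ge> 0 \<Longrightarrow> d \<le> norm (z - complex_of_real s)"
    using slit_plane_dist[OF assms] by metis
  have "AE s in \<rho>. d \<le> norm (z - complex_of_real s)" using rho_nonneg by eventually_elim (rule d(2))
  then show thesis using that d(1) by blast
qed

lemma tame_slit: "z \<in> slit_plane \<Longrightarrow> tame z"
  using slit_AE_dist[of z] tame_if_dist by metis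

text \<open>Uses \<open>(1 + z s) / (z - s) = (1 + z\<^sup>2) / (z - s) - z\<close>.\<close>

lemma integrable_u_int:
  assumes "tame z"
  shows "integrable \<rho> (\<lambda>s. (1 + z * complex_of_real s) / (z - complex_of_real s))"
proof (rule Bochner_Integration.integrable_bound)
  show "integrable \<rho> (\<lambda>s. norm (1 + z^2) * (1 + K z s) + norm z)"
    using assms by (simp add: tame_def)
  show "AE s in \<rho>. norm ((1 + z * complex_of_real s) / (z - complex_of_real s)) \<le> norm (norm (1 + z^2) * (1 + K z s) + norm z)"
    using assms[unfolded tame_def, THEN conjunct1]
  proof eventually_elim
    case (elim s)
    define p where "p = z - complex_of_real s"
    have p: "p \<noteq> 0" using elim by (simp add: p_def)
    have "1 + z * complex_of_real s = (1 + z^2) - z * p" by (simp add: p_def algebra_simps power2_eq_square)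
    then have "(1 + z * complex_of_real s) / p = (1 + z^2) / p - z" using p by (simp add: field_simps)
    then have "norm ((1 + z * complex_of_real s) / p) \<le> norm (1 + z^2) * (1 / norm p) + norm z"
      by (metis norm_triangle_ineq4 norm_divide times_divide_eq_right mult.right_neutral)
    also have "1 / norm p \<le> 1 + K z s"
    proof -
      have "2 * (1 / norm p) \<le> 1 + (1 / norm p)^2" using sum_squares_bound[of 1 "1 / norm p"] by simp
      moreover have "1 / norm p \<ge> 0" by simp
      moreover have "(1 / norm p)^2 \<le> K z s"
        unfolding K_def p_def[symmetric] power_one_over by (intro divide_right_mono) auto
      ultimately show ?thesis by linarith
    qed
    finally show ?case using K_nonneg[of z s] by (simp add: p_def mult_left_mono)
  qed
qed simp

text \<open>The Lipschitz bound that yields continuity up to the boundary: the difference of the integrands is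
  \<open>(z\<^sub>2 - z\<^sub>1) (1 + s\<^sup>2) / ((z\<^sub>1 - s) (z\<^sub>2 - s))\<close>, to which the arithmetic-geometric mean inequality applies.\<close>

lemma u_int_diff:
  assumes "tame z1" "tame z2"
  shows "integrable \<rho> (\<lambda>s. complex_of_real (1 + s^2) / ((z1 - complex_of_real s) * (z2 - complex_of_real s)))"
    and "u_int z1 - u_int z2 = (z2 - z1) * (LINT s|\<rho>. complex_of_real (1 + s^2) / ((z1 - complex_of_real s) * (z2 - complex_of_real s)))"
    and "norm (u_int z1 - u_int z2) \<le> norm (z1 - z2) * ((N z1 + N z2) / 2)"
proof -
  have iK: "integrable \<rho> (\<lambda>s. (K z1 s + K z2 s) / 2)" using assms by (simp add: tame_def)
  have b: "norm (complex_of_real (1 + s^2) / ((z1 - complex_of_real s) * (z2 - complex_of_real s))) \<le> (K z1 s + K z2 s) / 2" for s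
  proof -
    define x y where "x = 1 / norm (z1 - complex_of_real s)" and "y = 1 / norm (z2 - complex_of_real s)"
    have "2 * (x * y) \<le> x^2 + y^2" using sum_squares_bound[of x y] by simp
    then have "(1 + s^2) * (x * y) \<le> (1 + s^2) * ((x^2 + y^2) / 2)" by (intro mult_left_mono) auto
    moreover have "norm (complex_of_real (1 + s^2) / ((z1 - complex_of_real s) * (z2 - complex_of_real s))) = (1 + s^2) * (x * y)"
      unfolding norm_divide norm_mult norm_of_real by (simp add: x_def y_def)
    moreover have "(K z1 s + K z2 s) / 2 = (1 + s^2) * ((x^2 + y^2) / 2)"
      by (simp add: K_def x_def y_def power_divide distrib_left add_divide_distrib)
    ultimately show ?thesis by simp
  qed
  show i: "integrable \<rho> (\<lambda>s. complex_of_real (1 + s^2) / ((z1 - complex_of_real s) * (z2 - complex_of_real s)))"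
    by (rule Bochner_Integration.integrable_bound[OF iK]) (use b K_nonneg in \<open>auto intro!: always_eventually order_trans[OF b] simp del: of_real_add\<close>)
  have "u_int z1 - u_int z2 = (LINT s|\<rho>. (1 + z1 * complex_of_real s) / (z1 - complex_of_real s) - (1 + z2 * complex_of_real s) / (z2 - complex_of_real s))"
    unfolding u_int_def by (subst Bochner_Integration.integral_diff) (use integrable_u_int assms in auto)
  also have "\<dots> = (LINT s|\<rho>. (z2 - z1) * (complex_of_real (1 + s^2) / ((z1 - complex_of_real s) * (z2 - complex_of_real s))))"
  proof (rule integral_cong_AE)
    show "AE s in \<rho>. (1 + z1 * complex_of_real s) / (z1 - complex_of_real s) - (1 + z2 * complex_of_real s) / (z2 - complex_of_real s) =
       (z2 - z1) * (complex_of_real (1 + s^2) / ((z1 - complex_of_real s) * (z2 - complex_of_real s)))"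
      using assms(1)[unfolded tame_def, THEN conjunct1] assms(2)[unfolded tame_def, THEN conjunct1]
    proof eventually_elim
      case (elim s)
      then have n: "z1 - complex_of_real s \<noteq> 0" "z2 - complex_of_real s \<noteq> 0" by auto
      show ?case using n by (simp add: diff_frac_eq) (simp add: algebra_simps power2_eq_square)
    qed
  qed auto
  finally show eq: "u_int z1 - u_int z2 = (z2 - z1) * (LINT s|\<rho>. complex_of_real (1 + s^2) / ((z1 - complex_of_real s) * (z2 - complex_of_real s)))"
    by (simp only: integral_mult_right_zero)
  have "norm (LINT s|\<rho>. complex_of_real (1 + s^2) / ((z1 - complex_of_real s) * (z2 - complex_of_real s))) \<le> (LINT s|\<rho>. (K z1 s + K z2 s) / 2)"
    by (rule norm_integral_le_AE[OF i iK]) (use b in auto)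
  also have "\<dots> = (N z1 + N z2) / 2" using assms by (simp add: N_def tame_def)
  finally show "norm (u_int z1 - u_int z2) \<le> norm (z1 - z2) * ((N z1 + N z2) / 2)"
    unfolding eq norm_mult norm_minus_commute[of z2 z1] by (intro mult_left_mono) auto
qed

text \<open>The imaginary part of \<open>u\<close> controls the very integral that occurs in the Lipschitz bound.\<close>

lemma Im_u_int:
  assumes "tame z" shows "Im (u_int z) = - Im z * N z"
proof -
  have Im: "Im ((1 + z * complex_of_real s) / (z - complex_of_real s)) = - Im z * K z s" for s
  proof -
    have "Im (1 + z * complex_of_real s) * Re (z - complex_of_real s) - Re (1 + z * complex_of_real s) * Im (z - complex_of_real s)
       = - Im z * (1 + s^2)" by (simp add: algebra_simps power2_eq_square)
    then show ?thesis unfolding Im_divide K_def cmod_power2 by simp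
  qed
  show ?thesis unfolding u_int_def N_def
    using integral_Im[OF integrable_u_int[OF assms], symmetric] unfolding Im by simp
qed

lemma u_int_cnj: "u_int (cnj z) = cnj (u_int z)"
  unfolding u_int_def complex_cnj_add
  by (subst Bochner_Integration.integral_cnj[symmetric]) (simp del: Bochner_Integration.integral_cnj)

lemma u_int_has_field_derivative:
  assumes d: "d > 0" "AE s in \<rho>. d \<le> norm (w - complex_of_real s)"
  shows "(u_int has_field_derivative - (LINT s|\<rho>. complex_of_real (1 + s^2) / (w - complex_of_real s)^2)) (at w)"
    and "integrable \<rho> (\<lambda>s. complex_of_real (1 + s^2) / (w - complex_of_real s)^2)"
proof -
  define D where "D = - (LINT s|\<rho>. complex_of_real (1 + s^2) / (w - complex_of_real s)^2)"
  have w: "tame w" by (rule tame_if_dist[OF d])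
  show iD: "integrable \<rho> (\<lambda>s. complex_of_real (1 + s^2) / (w - complex_of_real s)^2)"
    using u_int_diff(1)[OF w w] by (simp add: power2_eq_square)
  have AEd: "AE s in \<rho>. d/2 \<le> norm (v - complex_of_real s)" if "norm (v - w) < d/2" for v
    using d(2)
  proof eventually_elim
    case (elim s)
    have "norm (w - of_real s) \<le> norm (w - v) + norm (v - of_real s)"
      by (metis norm_triangle_ineq diff_add_cancel add_diff_eq)
    then show ?case using elim that by (simp add: norm_minus_commute)
  qed
  have bound: "norm ((u_int v - u_int w) / (v - w) - D) \<le> norm (v - w) * ((2 / d) * N w)"
    if v: "norm (v - w) < d/2" "v \<noteq> w" for v
  proof -
    have tv: "tame v" using tame_if_dist[of "d/2"] AEd[OF v(1)] d(1) by simp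
    note iv = u_int_diff(1)[OF tv w]
    have "(u_int v - u_int w) / (v - w) = - (LINT s|\<rho>. complex_of_real (1 + s^2) / ((v - complex_of_real s) * (w - complex_of_real s)))"
      using v(2) u_int_diff(2)[OF tv w] by (simp add: divide_eq_eq) (simp add: algebra_simps)
    then have "(u_int v - u_int w) / (v - w) - D = (LINT s|\<rho>. complex_of_real (1 + s^2) / (w - complex_of_real s)^2 - complex_of_real (1 + s^2) / ((v - complex_of_real s) * (w - complex_of_real s)))"
      unfolding D_def by (subst Bochner_Integration.integral_diff[OF iD iv]) simp
    also have "norm \<dots> \<le> (LINT s|\<rho>. norm (v - w) * (2 / d) * K w s)"
    proof (rule norm_integral_le_AE)
      show "AE s in \<rho>. norm (complex_of_real (1 + s^2) / (w - complex_of_real s)^2 - complex_of_real (1 + s^2) / ((v - complex_of_real s) * (w - complex_of_real s))) \<le> norm (v - w) * (2 / d) * K w s"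
        using d(2) AEd[OF v(1)]
      proof eventually_elim
        case (elim s)
        define p q c where "p = v - complex_of_real s" and "q = w - complex_of_real s" and "c = complex_of_real (1 + s^2)"
        have pq: "p \<noteq> 0" "q \<noteq> 0" "norm p \<ge> d/2" using elim d(1) by (auto simp: p_def q_def)
        have "c / q^2 - c / (p * q) = c * (p - q) / (p * q^2)"
          using pq by (simp add: field_simps power2_eq_square)
        also have "norm \<dots> = norm (v - w) * (1 / norm p) * K w s"
          unfolding norm_mult norm_divide norm_power by (simp add: p_def q_def c_def K_def norm_mult[symmetric] del: of_real_add)
        also have "\<dots> \<le> norm (v - w) * (2 / d) * K w s"
          using pq(3) d(1) pq(1) K_nonneg by (intro mult_right_mono mult_left_mono) (auto simp: field_simps)
        finally show ?case by (simp add: c_def p_def q_def)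
      qed
    qed (use iD iv w in \<open>auto simp: tame_def\<close>)
    also have "\<dots> = norm (v - w) * ((2 / d) * N w)" by (simp add: N_def)
    finally show ?thesis .
  qed
  have "((\<lambda>v. (u_int v - u_int w) / (v - w) - D) \<longlongrightarrow> 0) (at w)"
  proof (rule Lim_null_comparison)
    show "\<forall>\<^sub>F v in at w. norm ((u_int v - u_int w) / (v - w) - D) \<le> norm (v - w) * ((2 / d) * N w)"
      unfolding eventually_at using bound d(1) by (intro exI[of _ "d/2"]) (auto simp: dist_norm)
    show "((\<lambda>v. norm (v - w) * ((2 / d) * N w)) \<longlongrightarrow> 0) (at w)"
      using d(1) by (auto intro!: tendsto_eq_intros)
  qed
  then show "(u_int has_field_derivative D) (at w)" unfolding has_field_derivative_iff by (simp add: LIM_zero_iff)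
qed

lemma u_int_holomorphic: "u_int holomorphic_on slit_plane"
  unfolding holomorphic_on_def
proof
  fix w assume "w \<in> slit_plane"
  then obtain d where d: "d > 0" "AE s in \<rho>. d \<le> norm (w - complex_of_real s)" using slit_AE_dist by blast
  show "u_int field_differentiable at w within slit_plane"
    using u_int_has_field_derivative(1)[OF d] by (meson field_differentiable_at_within field_differentiable_def)
qed

lemma K_rcis_mono:
  assumes "r > 0" "0 \<le> \<theta>1" "\<theta>1 \<le> \<theta>2" "\<theta>2 \<le> pi" "s \<ge> 0" "rcis r \<theta>1 \<noteq> complex_of_real s"
  shows "K (rcis r \<theta>2) s \<le> K (rcis r \<theta>1) s"
  unfolding K_def using norm_rcis_diff_mono[of r s \<theta>1 \<theta>2] assms
  by (intro divide_left_mono power_mono mult_pos_pos) (auto simp: zero_less_power2)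

lemma tame_N_mono:
  assumes "r > 0" "0 \<le> \<theta>1" "\<theta>1 \<le> \<theta>2" "\<theta>2 \<le> pi" "tame (rcis r \<theta>1)"
  shows "tame (rcis r \<theta>2)" "N (rcis r \<theta>2) \<le> N (rcis r \<theta>1)"
proof -
  have AE: "AE s in \<rho>. K (rcis r \<theta>2) s \<le> K (rcis r \<theta>1) s"
    using assms(5)[unfolded tame_def, THEN conjunct1] rho_nonneg
    by eventually_elim (use K_rcis_mono assms in auto)
  show t: "tame (rcis r \<theta>2)" unfolding tame_def
  proof
    show "AE s in \<rho>. rcis r \<theta>2 \<noteq> complex_of_real s"
      using assms(5)[unfolded tame_def, THEN conjunct1] rho_nonneg
    proof eventually_elim
      case (elim s)
      then show ?case using norm_rcis_diff_mono[of r s \<theta>1 \<theta>2] assms by auto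
    qed
    show "integrable \<rho> (K (rcis r \<theta>2))"
      by (rule Bochner_Integration.integrable_bound[of _ "K (rcis r \<theta>1)"])
         (use AE assms(5) K_nonneg in \<open>auto simp: tame_def elim!: eventually_mono\<close>)
  qed
  show "N (rcis r \<theta>2) \<le> N (rcis r \<theta>1)"
    unfolding N_def using t assms(5) AE by (intro integral_mono_AE) (auto simp: tame_def)
qed

end

section \<open>The boundary function A\<close>

lemma norm_cis_diff_le: "norm (cis x - cis y) \<le> \<bar>x - y\<bar>"
proof -
  define d where "d = (x - y) / 2"
  have xy: "x - y = 2 * d" by (simp add: d_def)
  have "(norm (cis x - cis y))^2 = (cos x - cos y)^2 + (sin x - sin y)^2" by (simp add: cmod_power2)
  also have "\<dots> = ((sin x)^2 + (cos x)^2) + ((sin y)^2 + (cos y)^2) - 2 * (cos x * cos y + sin x * sin y)" by algebra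
  also have "\<dots> = 2 - 2 * cos (x - y)" unfolding sin_cos_squared_add cos_diff by simp
  also have "\<dots> = (2 * \<bar>sin d\<bar>)^2" unfolding xy cos_double_sin by (simp add: power_mult_distrib)
  also have "\<dots> \<le> (2 * \<bar>d\<bar>)^2" using abs_sin_x_le_abs_x[of d] by (intro power_mono) auto
  also have "2 * \<bar>d\<bar> = \<bar>x - y\<bar>" unfolding xy by simp
  finally show ?thesis by (rule power2_le_imp_le) simp
qed

lemma sin_less_self:
  assumes "0 < x" "x < pi" shows "sin x < (x::real)"
proof -
  have "x / 2 * sin x < x * sin (x / 2)" using sin_div_strict_antimono[of "x/2" x] assms by simp
  also have "\<dots> \<le> x * (x / 2)" using abs_sin_x_le_abs_x[of "x / 2"] assms by (intro mult_left_mono) auto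
  finally have "x * sin x < x * x" by simp
  then show ?thesis using assms by simp
qed

lemma tendsto_inverse_ennreal:
  fixes f :: "'a \<Rightarrow> ennreal"
  assumes "(f \<longlongrightarrow> l) F" shows "((\<lambda>x. inverse (f x)) \<longlongrightarrow> inverse l) F"
proof -
  have "continuous_on UNIV (\<lambda>x::ennreal. inverse x)" by (intro continuous_on_inverse_ennreal continuous_on_id)
  then have "isCont (\<lambda>x::ennreal. inverse x) l" by (simp add: continuous_on_eq_continuous_at)
  then show ?thesis by (rule isCont_tendsto_compose[OF _ assms])
qed

lemma rcis_in_slit: "r > 0 \<Longrightarrow> 0 < \<theta> \<Longrightarrow> \<theta> < pi \<Longrightarrow> rcis r \<theta> \<in> slit_plane"
  by (intro slit_plane_upper) (simp add: sin_gt_zero)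

lemma rcis_pi: "rcis r pi = complex_of_real (- r)" by (simp add: complex_eq_iff)

lemma continuous_rcis[continuous_intros]:
  assumes "continuous F f" "continuous F g" shows "continuous F (\<lambda>x. rcis (f x) (g x))"
  unfolding rcis_def cis_conv_exp using assms by (intro continuous_intros)

locale nevanlinna_power = nevanlinna +
  fixes t :: real
  assumes t: "t > 1"
begin

abbreviation "q \<equiv> t - 1"

lemma q: "q > 0" using t by simp

text \<open>The argument that \<open>z = r exp (i \<theta>)\<close> loses under \<open>\<Phi>\<close>: the point \<open>\<Phi> z\<close> has argument
  \<open>\<theta> - arg_loss r \<theta>\<close>, so that \<open>\<Omega>\<^sub>t\<close> is where \<open>arg_loss r \<theta> < \<theta>\<close>.\<close>

definition arg_loss :: "real \<Rightarrow> real \<Rightarrow> real" where "arg_loss r \<theta> = - q * Im (u_int (rcis r \<theta>))"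

lemma arg_loss_eq: "tame (rcis r \<theta>) \<Longrightarrow> arg_loss r \<theta> = q * r * sin \<theta> * N (rcis r \<theta>)"
  unfolding arg_loss_def by (simp add: Im_u_int algebra_simps)

lemma arg_loss_eq': "r > 0 \<Longrightarrow> 0 < \<theta> \<Longrightarrow> \<theta> < pi \<Longrightarrow> arg_loss r \<theta> = q * r * sin \<theta> * N (rcis r \<theta>)"
  by (intro arg_loss_eq tame_slit rcis_in_slit)

text \<open>Weak monotonicity of \<open>arg_loss r \<theta> / \<theta>\<close>. Both \<open>sin \<theta> / \<theta>\<close> and \<open>N\<close> decrease in \<open>\<theta>\<close>.\<close>

lemma arg_loss_up:
  assumes "r > 0" "0 < x" "x < y" "y < pi"
  shows "x * arg_loss r y \<le> y * arg_loss r x"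
proof -
  have "N (rcis r y) \<le> N (rcis r x)" using assms by (intro tame_N_mono(2) tame_slit rcis_in_slit) auto
  moreover have "x * sin y \<le> y * sin x" using sin_div_strict_antimono[of x y] assms by simp
  moreover have "sin x > 0" using assms by (intro sin_gt_zero) auto
  ultimately have "(x * sin y) * N (rcis r y) \<le> (y * sin x) * N (rcis r y)"
    "(y * sin x) * N (rcis r y) \<le> (y * sin x) * N (rcis r x)"
    using N_nonneg assms by (auto intro!: mult_right_mono mult_left_mono)
  then have "(x * sin y) * N (rcis r y) \<le> (y * sin x) * N (rcis r x)" by simp
  then have "q * r * ((x * sin y) * N (rcis r y)) \<le> q * r * ((y * sin x) * N (rcis r x))"
    using q assms by (intro mult_left_mono) auto
  then show ?thesis using assms by (simp add: arg_loss_eq' mult_ac)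
qed

lemma arg_loss_up_strict:
  assumes "r > 0" "0 < x" "x < y" "y < pi" "arg_loss r y > 0"
  shows "x * arg_loss r y < y * arg_loss r x"
proof -
  have pos: "N (rcis r y) > 0" using assms(5) arg_loss_eq'[of r y] assms N_nonneg[of "rcis r y"] by (cases "N (rcis r y) = 0") auto
  have m: "N (rcis r y) \<le> N (rcis r x)" using assms by (intro tame_N_mono(2) tame_slit rcis_in_slit) auto
  have s: "x * sin y < y * sin x" using sin_div_strict_antimono[of x y] assms by simp
  have "sin x > 0" using assms by (intro sin_gt_zero) auto
  have "(x * sin y) * N (rcis r y) < (y * sin x) * N (rcis r y)" using s pos by simp
  also have "\<dots> \<le> (y * sin x) * N (rcis r x)" using m \<open>sin x > 0\<close> assms by (intro mult_left_mono) auto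
  finally have "q * r * ((x * sin y) * N (rcis r y)) < q * r * ((y * sin x) * N (rcis r x))"
    using q assms by simp
  then show ?thesis using assms by (simp add: arg_loss_eq' mult_ac)
qed

lemma continuous_u_int_slit: "z \<in> slit_plane \<Longrightarrow> isCont u_int z"
  using continuous_on_interior[OF holomorphic_on_imp_continuous_on[OF u_int_holomorphic]] open_slit_plane
  by (simp add: interior_open)

lemma isCont_arg_loss:
  assumes "r > 0" "0 < \<theta>" "\<theta> \<le> pi"
  shows "isCont (\<lambda>r. arg_loss r \<theta>) r" "isCont (\<lambda>\<theta>. arg_loss r \<theta>) \<theta>"
proof -
  have z: "rcis r \<theta> \<in> slit_plane"
    using assms rcis_in_slit[of r \<theta>] by (cases "\<theta> = pi") (auto simp: rcis_pi slit_plane_iff)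
  have "isCont (\<lambda>r. rcis r \<theta>) r" "isCont (\<lambda>\<theta>. rcis r \<theta>) \<theta>" by (intro continuous_intros)+
  from isCont_o2[OF this(1), of u_int] isCont_o2[OF this(2), of u_int]
  have "isCont (\<lambda>r. u_int (rcis r \<theta>)) r" "isCont (\<lambda>\<theta>. u_int (rcis r \<theta>)) \<theta>"
    using continuous_u_int_slit[OF z] by simp_all
  then show "isCont (\<lambda>r. arg_loss r \<theta>) r" "isCont (\<lambda>\<theta>. arg_loss r \<theta>) \<theta>"
    unfolding arg_loss_def by (auto intro!: continuous_intros)
qed

abbreviation "A \<equiv> A_fun u t"

lemma A_eq: "r > 0 \<Longrightarrow> A r = Inf {\<theta>\<in>{0<..<pi}. arg_loss r \<theta> < \<theta>}"
proof -
  assume r: "r > 0"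
  have "- Im (u (rcis r \<theta>)) / \<theta> < 1 / q \<longleftrightarrow> arg_loss r \<theta> < \<theta>" if "0 < \<theta>" "\<theta> < pi" for \<theta>
    using q that u_eq_u_int[OF rcis_in_slit[OF r that]] by (simp add: arg_loss_def field_simps)
  then show ?thesis unfolding A_fun_def by (intro arg_cong[where f = Inf]) auto
qed

text \<open>At \<open>\<theta> = \<pi>\<close> the point lies on the negative half-line, where \<open>u\<close> is real.\<close>

lemma arg_loss_less_near_pi:
  assumes "r > 0" "b < pi"
  shows "\<exists>\<theta>. b < \<theta> \<and> 0 < \<theta> \<and> \<theta> < pi \<and> arg_loss r \<theta> < \<theta>"
proof -
  have "arg_loss r pi = 0" unfolding arg_loss_def using Im_u_int[OF tame_slit, of "of_real (-r)"] assms
    by (simp add: rcis_pi slit_plane_iff)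
  then have "isCont (\<lambda>\<theta>. \<theta> - arg_loss r \<theta>) pi" "pi - arg_loss r pi > 0" using isCont_arg_loss(2)[of r pi] assms by auto
  then have "\<forall>\<^sub>F \<theta> in at pi. \<theta> - arg_loss r \<theta> > 0" unfolding isCont_def by (rule order_tendstoD)
  then have "\<forall>\<^sub>F \<theta> in at_left pi. \<theta> - arg_loss r \<theta> > 0" by (rule filter_leD[rotated]) (simp add: at_le)
  moreover have "\<forall>\<^sub>F \<theta> in at_left pi. max b 0 < \<theta> \<and> \<theta> < pi"
    using assms by (auto simp: eventually_at_left_field intro!: exI[of _ "max b 0"])
  ultimately have "\<forall>\<^sub>F \<theta> in at_left pi. \<theta> - arg_loss r \<theta> > 0 \<and> max b 0 < \<theta> \<and> \<theta> < pi" by eventually_elim auto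
  then obtain \<theta> where "\<theta> - arg_loss r \<theta> > 0 \<and> max b 0 < \<theta> \<and> \<theta> < pi"
    using eventually_happens[of _ "at_left pi"] by auto
  then show ?thesis by (intro exI[of _ \<theta>]) auto
qed

lemma A_bounds:
  assumes "r > 0" shows "0 \<le> A r" "A r < pi"
proof -
  obtain \<theta> where \<theta>: "0 < \<theta>" "\<theta> < pi" "arg_loss r \<theta> < \<theta>" using arg_loss_less_near_pi[OF assms, of 0] by auto
  show "0 \<le> A r" unfolding A_eq[OF assms] by (rule cInf_greatest) (use \<theta> in auto)
  have "A r \<le> \<theta>" unfolding A_eq[OF assms] by (rule cInf_lower) (use \<theta> in \<open>auto intro!: bdd_belowI[of _ 0]\<close>)
  then show "A r < pi" using \<theta> by simp
qed

text \<open>By monotonicity the admissible angles form an upper segment, and by continuity it is open.\<close>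

lemma arg_loss_less_iff:
  assumes r: "r > 0" and \<theta>: "0 < \<theta>" "\<theta> < pi"
  shows "arg_loss r \<theta> < \<theta> \<longleftrightarrow> A r < \<theta>"
proof
  assume "A r < \<theta>"
  obtain \<theta>' where "0 < \<theta>'" "\<theta>' < pi" "arg_loss r \<theta>' < \<theta>'" using arg_loss_less_near_pi[OF r, of 0] by auto
  then have "\<exists>x\<in>{\<theta>\<in>{0<..<pi}. arg_loss r \<theta> < \<theta>}. x < \<theta>"
    using \<open>A r < \<theta>\<close> unfolding A_eq[OF r] by (subst (asm) cInf_less_iff) (auto intro!: bdd_belowI[of _ 0])
  then obtain x where x: "0 < x" "x < \<theta>" "arg_loss r x < x" by auto
  have "x * arg_loss r \<theta> \<le> \<theta> * arg_loss r x" using arg_loss_up[OF r x(1,2) \<theta>(2)] .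
  also have "\<dots> < \<theta> * x" using x \<theta> by simp
  finally show "arg_loss r \<theta> < \<theta>" using x by (simp add: mult.commute)
next
  assume a: "arg_loss r \<theta> < \<theta>"
  have "isCont (\<lambda>\<theta>. \<theta> - arg_loss r \<theta>) \<theta>" using isCont_arg_loss(2)[of r \<theta>] assms by auto
  then have "\<forall>\<^sub>F x in at \<theta>. x - arg_loss r x > 0" using a unfolding isCont_def by (intro order_tendstoD) auto
  then have "\<forall>\<^sub>F x in at_left \<theta>. x - arg_loss r x > 0" by (rule filter_leD[rotated]) (simp add: at_le)
  moreover have "\<forall>\<^sub>F x in at_left \<theta>. 0 < x \<and> x < \<theta>"
    using \<theta> by (auto simp: eventually_at_left_field intro!: exI[of _ 0])
  ultimately have "\<forall>\<^sub>F x in at_left \<theta>. x - arg_loss r x > 0 \<and> 0 < x \<and> x < \<theta>" by eventually_elim auto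
  then obtain x where x: "x - arg_loss r x > 0 \<and> 0 < x \<and> x < \<theta>"
    using eventually_happens[of _ "at_left \<theta>"] by auto
  have "A r \<le> x" unfolding A_eq[OF r] by (rule cInf_lower) (use \<theta> x in \<open>auto intro!: bdd_belowI[of _ 0]\<close>)
  then show "A r < \<theta>" using x by simp
qed

lemma arg_loss_at_A:
  assumes r: "r > 0" and "A r > 0"
  shows "arg_loss r (A r) = A r"
proof (rule antisym)
  have c: "isCont (\<lambda>\<theta>. \<theta> - arg_loss r \<theta>) (A r)" using isCont_arg_loss(2)[of r "A r"] assms A_bounds[OF r] by auto
  show "arg_loss r (A r) \<ge> A r" using arg_loss_less_iff[OF r, of "A r"] assms A_bounds[OF r] by auto
  show "arg_loss r (A r) \<le> A r"
  proof (rule ccontr)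
    assume "\<not> arg_loss r (A r) \<le> A r"
    then have "\<forall>\<^sub>F x in at (A r). x - arg_loss r x < 0" using c unfolding isCont_def by (intro order_tendstoD) auto
    then have "\<forall>\<^sub>F x in at_right (A r). x - arg_loss r x < 0" by (rule filter_leD[rotated]) (simp add: at_le)
    moreover have "\<forall>\<^sub>F x in at_right (A r). A r < x \<and> x < pi"
      using A_bounds[OF r] by (auto simp: eventually_at_right_field intro!: exI[of _ pi])
    ultimately have "\<forall>\<^sub>F x in at_right (A r). x - arg_loss r x < 0 \<and> A r < x \<and> x < pi" by eventually_elim auto
    then obtain x where x: "x - arg_loss r x < 0 \<and> A r < x \<and> x < pi"
      using eventually_happens[of _ "at_right (A r)"] by auto
    then show False using arg_loss_less_iff[OF r, of x] assms by auto
  qed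
qed

text \<open>Upper semicontinuity holds because admissibility is an open condition. For lower semicontinuity,
  strict monotonicity turns the non-strict failure at an angle below \<open>A r\<close> into a strict, hence open, failure
  at a smaller angle.\<close>

lemma isCont_A:
  assumes r: "r > 0" shows "isCont A r"
  unfolding isCont_def
proof (rule order_tendstoI)
  have evpos: "\<forall>\<^sub>F x in at r. x > 0" using order_tendstoD(1)[OF tendsto_ident_at r] .
  fix y assume y: "A r < y"
  obtain \<theta> where \<theta>: "A r < \<theta>" "\<theta> < min y pi" using dense[of "A r" "min y pi"] y A_bounds[OF r] by auto
  then have p: "0 < \<theta>" "\<theta> < pi" using A_bounds(1)[OF r] by auto
  then have "arg_loss r \<theta> < \<theta>" using arg_loss_less_iff[OF r p] \<theta> by simp
  then have "\<forall>\<^sub>F x in at r. arg_loss x \<theta> < \<theta>" using isCont_arg_loss(1)[of r \<theta>] p r unfolding isCont_def by (intro order_tendstoD) auto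
  with evpos show "\<forall>\<^sub>F x in at r. A x < y"
    by eventually_elim (use arg_loss_less_iff p \<theta> in fastforce)
next
  have evpos: "\<forall>\<^sub>F x in at r. x > 0" using order_tendstoD(1)[OF tendsto_ident_at r] .
  fix y assume y: "A r > y"
  show "\<forall>\<^sub>F x in at r. A x > y"
  proof (cases "y < 0")
    case True
    from evpos show ?thesis by eventually_elim (use A_bounds True in fastforce)
  next
    case False
    obtain x2 where x2: "y < x2" "x2 < A r" using dense y by blast
    obtain x1 where x1: "y < x1" "x1 < x2" using dense x2 by blast
    have p: "0 < x1" "x1 < x2" "x2 < pi" using False x1 x2 A_bounds[OF r] by auto
    have "\<not> arg_loss r x2 < x2" using arg_loss_less_iff[OF r, of x2] p x2 by auto
    then have 1: "arg_loss r x2 \<ge> x2" "arg_loss r x2 > 0" using p by auto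
    have "x1 * x2 \<le> x1 * arg_loss r x2" using 1 p by simp
    also have "\<dots> < x2 * arg_loss r x1" using arg_loss_up_strict[OF r p 1(2)] .
    finally have "x1 < arg_loss r x1" using p by (simp add: mult.commute)
    then have "\<forall>\<^sub>F x in at r. arg_loss x x1 > x1" using isCont_arg_loss(1)[of r x1] p r unfolding isCont_def by (intro order_tendstoD) auto
    with evpos show ?thesis
    proof eventually_elim
      case (elim x)
      then have "\<not> A x < x1" using arg_loss_less_iff[of x x1] p by auto
      then show ?case using x1 by simp
    qed
  qed
qed

lemma g_fun_tame:
  assumes "r > 0" "g_fun \<rho> r < \<infinity>"
  shows "tame (complex_of_real r)" "g_fun \<rho> r = ennreal (r * N (complex_of_real r))"
proof -
  have m: "(\<lambda>s. ennreal (r * (s\<^sup>2 + 1)) / ennreal ((r - s)\<^sup>2)) \<in> borel_measurable \<rho>" by measurable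
  have "AE s in \<rho>. ennreal (r * (s\<^sup>2 + 1)) / ennreal ((r - s)\<^sup>2) \<noteq> \<infinity>"
    using nn_integral_PInf_AE[OF m] assms(2) unfolding g_fun_def by simp
  then have ne: "AE s in \<rho>. complex_of_real r \<noteq> complex_of_real s"
  proof eventually_elim
    case (elim s)
    have "r * (s\<^sup>2 + 1) > 0" using assms(1) by (intro mult_pos_pos) (auto simp: add_nonneg_pos)
    then show ?case using elim by (auto simp: ennreal_divide_zero ennreal_zero_divide split: if_splits)
  qed
  have eq: "AE s in \<rho>. ennreal (r * (s\<^sup>2 + 1)) / ennreal ((r - s)\<^sup>2) = ennreal (r * K (complex_of_real r) s)"
    using ne
  proof eventually_elim
    case (elim s)
    have "(norm (complex_of_real r - complex_of_real s))^2 = (r - s)^2" by (simp flip: of_real_diff)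
    then show ?case using elim assms(1) by (simp add: K_def divide_ennreal add.commute)
  qed
  have fin: "(\<integral>\<^sup>+s. ennreal (r * K (complex_of_real r) s) \<partial>\<rho>) = g_fun \<rho> r"
    unfolding g_fun_def using eq by (intro nn_integral_cong_AE) (auto elim: eventually_mono)
  have i: "integrable \<rho> (\<lambda>s. r * K (complex_of_real r) s)"
    using fin assms K_nonneg by (intro integrableI_nonneg) auto
  then have "integrable \<rho> (K (complex_of_real r))" using assms(1) by simp
  then show "tame (complex_of_real r)" using ne by (simp add: tame_def)
  show "g_fun \<rho> r = ennreal (r * N (complex_of_real r))"
    unfolding fin[symmetric] using i K_nonneg assms(1) by (subst nn_integral_eq_integral) (auto simp: N_def)
qed

lemma g_fun_le_tame:
  assumes r: "r > 0" and g: "g_fun \<rho> r \<le> ennreal (1 / q)"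
  shows "tame (complex_of_real r)" "q * r * N (complex_of_real r) \<le> 1"
proof -
  have fin: "g_fun \<rho> r < \<infinity>" using g order_le_less_trans by fastforce
  note tm = g_fun_tame[OF r fin]
  show "tame (complex_of_real r)" by (rule tm(1))
  have "r * N (complex_of_real r) \<le> 1 / q" using g q r N_nonneg unfolding tm(2) by simp
  then show "q * r * N (complex_of_real r) \<le> 1" using q by (simp add: field_simps)
qed

text \<open>Up to the factor \<open>q\<close>, \<open>g r\<close> is the limit of \<open>arg_loss r \<theta> / \<theta>\<close> as \<open>\<theta>\<close> tends to \<open>0\<close>. One direction is
  the comparison \<open>sin \<theta> < \<theta>\<close>, the other one is Fatou's lemma along \<open>\<theta> = 1 / (n + 2)\<close>.\<close>

lemma g_fun_le_iff:
  assumes r: "r > 0"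
  shows "g_fun \<rho> r \<le> ennreal (1 / q) \<longleftrightarrow> A r = 0"
proof
  assume g: "g_fun \<rho> r \<le> ennreal (1 / q)"
  note b = g_fun_le_tame(2)[OF r g]
  have "A r \<le> \<theta>" if \<theta>: "0 < \<theta>" "\<theta> < pi" for \<theta>
  proof -
    have sp: "sin \<theta> > 0" using \<theta> by (intro sin_gt_zero)
    have "arg_loss r \<theta> = sin \<theta> * (q * r * N (rcis r \<theta>))" using arg_loss_eq'[OF r \<theta>] by simp
    also have "\<dots> \<le> sin \<theta> * (q * r * N (complex_of_real r))"
      using tame_N_mono(2)[of r 0 \<theta>] g_fun_le_tame(1)[OF r g] r \<theta> q sp by (intro mult_left_mono) auto
    also have "\<dots> \<le> sin \<theta> * 1" using b sp by (intro mult_left_mono) auto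
    also have "\<dots> < \<theta>" using sin_less_self[OF \<theta>] by simp
    finally show ?thesis using arg_loss_less_iff[OF r \<theta>] by simp
  qed
  then have "A r \<le> 0" using A_bounds[OF r] dense[of 0 "A r"]
    by (metis dual_order.strict_trans less_le_not_le not_le)
  then show "A r = 0" using A_bounds[OF r] by simp
next
  assume A0: "A r = 0"
  define th where "th n = 1 / real (Suc (Suc n))" for n
  have th1: "0 < th n" "th n < 1" for n by (auto simp: th_def)
  then have th: "0 < th n" "th n < pi" "th n < 1" for n using less_trans[OF th1(2), of pi n] pi_gt3 by auto
  have thl: "th \<longlonglongrightarrow> 0" unfolding th_def using LIMSEQ_Suc[OF LIMSEQ_inverse_real_of_nat] by (simp add: inverse_eq_divide)
  define k where "k n s = ennreal (r * (s\<^sup>2 + 1)) * inverse (ennreal ((norm (rcis r (th n) - complex_of_real s))^2))" for n s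
  have lim: "(\<lambda>n. k n s) \<longlonglongrightarrow> ennreal (r * (s\<^sup>2 + 1)) / ennreal ((r - s)\<^sup>2)" for s
  proof -
    have "(\<lambda>n. (norm (rcis r (th n) - complex_of_real s))^2) \<longlonglongrightarrow> r^2 + s^2 - 2 * r * s * cos 0"
      unfolding norm_rcis_diff using thl by (intro tendsto_intros)
    also have "r^2 + s^2 - 2 * r * s * cos 0 = (r - s)^2" by (simp add: power2_diff)
    finally show ?thesis unfolding k_def divide_ennreal_def
      by (intro ennreal_tendsto_cmult tendsto_inverse_ennreal tendsto_ennrealI) auto
  qed
  have kb: "(\<integral>\<^sup>+s. k n s \<partial>\<rho>) \<le> ennreal (th n / sin (th n) / q)" for n
  proof -
    have z: "rcis r (th n) \<in> slit_plane" using rcis_in_slit[OF r th(1,2)] .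
    have sp: "sin (th n) > 0" using th by (intro sin_gt_zero)
    have K: "k n s = ennreal (r * K (rcis r (th n)) s)" if "s \<ge> 0" for s
    proof -
      have "complex_of_real s \<notin> slit_plane" using that by (simp add: slit_plane_iff)
      then have "rcis r (th n) \<noteq> complex_of_real s" using z by metis
      then have "norm (rcis r (th n) - complex_of_real s) > 0" by simp
      then have "k n s = ennreal (r * (s\<^sup>2 + 1) / (norm (rcis r (th n) - complex_of_real s))\<^sup>2)"
        using r unfolding k_def divide_ennreal_def[symmetric] by (intro divide_ennreal) auto
      then show ?thesis by (simp add: K_def add.commute)
    qed
    have "(\<integral>\<^sup>+s. k n s \<partial>\<rho>) = (\<integral>\<^sup>+s. ennreal (r * K (rcis r (th n)) s) \<partial>\<rho>)"
      using rho_nonneg by (intro nn_integral_cong_AE) (auto elim!: eventually_mono simp: K)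
    also have "\<dots> = ennreal (r * N (rcis r (th n)))"
      using tame_slit[OF z] r K_nonneg by (subst nn_integral_eq_integral) (auto simp: N_def tame_def)
    also have "\<dots> \<le> ennreal (th n / sin (th n) / q)"
    proof (rule ennreal_leI)
      have "arg_loss r (th n) < th n" using arg_loss_less_iff[OF r th(1,2)] A0 th by auto
      then show "r * N (rcis r (th n)) \<le> th n / sin (th n) / q"
        using arg_loss_eq'[OF r th(1,2)] sp q by (simp add: field_simps)
    qed
    finally show ?thesis .
  qed
  have "g_fun \<rho> r = (\<integral>\<^sup>+s. liminf (\<lambda>n. k n s) \<partial>\<rho>)"
    unfolding g_fun_def using lim_imp_Liminf[OF _ lim] by (intro nn_integral_cong) simp
  also have "\<dots> \<le> liminf (\<lambda>n. \<integral>\<^sup>+s. k n s \<partial>\<rho>)"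
    by (rule nn_integral_liminf) (simp add: k_def)
  also have "\<dots> \<le> liminf (\<lambda>n. ennreal (th n / sin (th n) / q))"
    by (rule Liminf_mono) (use kb in auto)
  also have "\<dots> = ennreal (1 / q)"
  proof (rule lim_imp_Liminf)
    have "(\<lambda>n. sin (th n) / th n) \<longlonglongrightarrow> 1"
    proof -
      have 1: "((\<lambda>x::real. sin x / x) \<longlongrightarrow> 1) (at 0)"
        using DERIV_sin[of "0::real"] by (simp add: has_field_derivative_iff)
      have 2: "filterlim th (at 0) sequentially"
        using thl th(1) by (auto simp: filterlim_at less_imp_neq[symmetric])
      show ?thesis using filterlim_compose[OF 1 2] .
    qed
    then have "(\<lambda>n. inverse (sin (th n) / th n) / q) \<longlonglongrightarrow> inverse 1 / q" using q by (intro tendsto_intros) auto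
    then show "(\<lambda>n. ennreal (th n / sin (th n) / q)) \<longlonglongrightarrow> ennreal (1 / q)"
      by (intro tendsto_ennrealI) (simp add: inverse_eq_divide)
  qed simp
  finally show "g_fun \<rho> r \<le> ennreal (1 / q)" .
qed

lemma V_plus_iff: "r \<in> V_plus \<rho> t \<longleftrightarrow> r > 0 \<and> A r > 0"
  using g_fun_le_iff[of r] A_bounds[of r] by (auto simp: V_plus_def not_le[symmetric])

lemma N_bound_flat:
  assumes r: "r > 0" and A0: "A r = 0"
  shows "tame (of_real r)" "q * r * N (of_real r) \<le> 1"
  using g_fun_le_tame[OF r] g_fun_le_iff[OF r] A0 by simp_all

text \<open>On the closure of \<open>\<Omega>\<^sub>t\<close> the integral \<open>N\<close> is bounded locally uniformly; with \<open>u_int_diff\<close> this makes \<open>u\<close>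
  locally Lipschitz there.\<close>

lemma closure_bound:
  assumes r: "r > 0" and \<theta>: "A r \<le> \<theta>" "\<theta> < pi"
  shows "tame (rcis r \<theta>)" "q * r * sin \<theta> * N (rcis r \<theta>) \<le> \<theta>" "q * r * (pi - \<theta>) * N (rcis r \<theta>) \<le> pi^2 / 2"
proof -
  have "tame (rcis r \<theta>) \<and> q * r * sin \<theta> * N (rcis r \<theta>) \<le> \<theta> \<and> q * r * (pi - \<theta>) * N (rcis r \<theta>) \<le> pi^2 / 2"
  proof (cases "\<theta> = 0")
    case True
    then have A0: "A r = 0" using \<theta> A_bounds[OF r] by simp
    note tm = N_bound_flat[OF r A0]
    then have "q * r * N (complex_of_real r) * pi \<le> 1 * pi" by (intro mult_right_mono) auto
    also have "\<dots> \<le> pi^2 / 2" using pi_gt3 by (simp add: power2_eq_square)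
    finally show ?thesis using True tm by (simp add: mult_ac)
  next
    case False
    then have p: "0 < \<theta>" using \<theta> A_bounds[OF r] by simp
    have t: "tame (rcis r \<theta>)" using rcis_in_slit[OF r p \<theta>(2)] by (rule tame_slit)
    have "arg_loss r \<theta> \<le> \<theta>"
    proof (cases "A r < \<theta>")
      case True
      then show ?thesis using arg_loss_less_iff[OF r p \<theta>(2)] by simp
    next
      case False
      then have "A r = \<theta>" using \<theta> by simp
      then show ?thesis using arg_loss_at_A[OF r] p by simp
    qed
    then have 1: "q * r * sin \<theta> * N (rcis r \<theta>) \<le> \<theta>" using arg_loss_eq'[OF r p \<theta>(2)] by simp
    have "(2 * \<theta> * (pi - \<theta>)) * (q * r * N (rcis r \<theta>)) \<le> (pi^2 * sin \<theta>) * (q * r * N (rcis r \<theta>))"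
      using sin_ge_parabola[of \<theta>] p \<theta> q r N_nonneg by (intro mult_right_mono) auto
    also have "\<dots> = pi^2 * (q * r * sin \<theta> * N (rcis r \<theta>))" by simp
    also have "\<dots> \<le> pi^2 * \<theta>" using 1 by (intro mult_left_mono) auto
    finally have "\<theta> * (2 * (q * r * (pi - \<theta>) * N (rcis r \<theta>))) \<le> \<theta> * pi^2" by (simp add: algebra_simps)
    then have "2 * (q * r * (pi - \<theta>) * N (rcis r \<theta>)) \<le> pi^2" using p by (rule mult_left_le_imp_le)
    then show ?thesis using t 1 by simp
  qed
  then show "tame (rcis r \<theta>)" "q * r * sin \<theta> * N (rcis r \<theta>) \<le> \<theta>" "q * r * (pi - \<theta>) * N (rcis r \<theta>) \<le> pi^2 / 2" by auto
qed

end

section \<open>The map Phi near the boundary and its logarithm\<close>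

lemma islimpt_of_real_lessThan: "complex_of_real (b - 1) islimpt complex_of_real ` {..<b}"
proof (rule islimptI)
  fix T assume T: "complex_of_real (b - 1) \<in> T" "open T"
  then obtain e where e: "e > 0" "ball (complex_of_real (b - 1)) e \<subseteq> T" using open_contains_ball by blast
  have "complex_of_real (b - 1 - e / 2) \<in> ball (complex_of_real (b - 1)) e"
    using e(1) by (simp add: dist_norm flip: of_real_diff)
  then have "complex_of_real (b - 1 - e / 2) \<in> T" using e by blast
  moreover have "complex_of_real (b - 1 - e / 2) \<in> complex_of_real ` {..<b}" using e by (intro imageI) auto
  moreover have "complex_of_real (b - 1 - e / 2) \<noteq> complex_of_real (b - 1)" using e unfolding of_real_eq_iff by simp
  ultimately show "\<exists>y\<in>complex_of_real ` {..<b}. y \<in> T \<and> y \<noteq> complex_of_real (b - 1)" by blast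
qed

lemma minus_exp_Complex: "- exp (Complex x y) = rcis (exp x) (pi + y)"
  by (simp add: complex_eq_iff Re_exp Im_exp sin_add cos_add)

context nevanlinna_power
begin

text \<open>The boundary curve of \<open>\<Omega>\<^sub>t\<close>.\<close>

definition curve :: "real \<Rightarrow> complex" where "curve r = rcis r (A r)"

definition Phi_abs :: "real \<Rightarrow> real \<Rightarrow> real" where "Phi_abs r \<theta> = r * exp (q * Re (u_int (rcis r \<theta>)))"

text \<open>This agrees with \<open>h_fun\<close> on \<open>V\<^sub>t\<close> (see \<open>boundary_limits\<close>), but is defined by the integral
  representation also where the curve touches the slit.\<close>

definition h :: "real \<Rightarrow> real" where "h r = Phi_abs r (A r)"

text \<open>The modulus of \<open>\<Phi>\<close> at \<open>- r\<close>.\<close>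

definition neg_radius :: "real \<Rightarrow> real" where "neg_radius r = r * exp (q * Re (u_int (of_real (- r))))"

lemma Phi_rcis: "Phi u_int t (rcis r \<theta>) = rcis (Phi_abs r \<theta>) (\<theta> - arg_loss r \<theta>)"
proof -
  have "exp (complex_of_real q * u_int (rcis r \<theta>)) = rcis (exp (q * Re (u_int (rcis r \<theta>)))) (- arg_loss r \<theta>)"
    by (simp add: rcis_def arg_loss_def exp_eq_polar algebra_simps)
  then show ?thesis unfolding Phi_def Phi_abs_def by (simp add: rcis_mult)
qed

text \<open>Along the arc from \<open>r exp (i \<theta>)\<close> to \<open>- r\<close> the function \<open>N\<close> decreases, and the chord is at most
  \<open>r (\<pi> - \<theta>)\<close>; the bound of \<open>closure_bound\<close> is made for this product.\<close>

lemma u_int_minus_dist: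
  assumes r: "r > 0" and \<theta>: "A r \<le> \<theta>" "\<theta> < pi"
  shows "q * norm (u_int (rcis r \<theta>) - u_int (of_real (- r))) \<le> pi^2 / 2"
proof -
  have p: "0 \<le> \<theta>" using A_bounds[OF r] \<theta> by simp
  note cb = closure_bound[OF r \<theta>]
  have m: "tame (of_real (-r))" "N (of_real (-r)) \<le> N (rcis r \<theta>)"
    using tame_N_mono[OF r p _ order_refl cb(1)] \<theta> by (simp_all add: rcis_pi)
  have "norm (rcis r \<theta> - of_real (- r)) = r * norm (cis \<theta> - cis pi)"
    using r unfolding rcis_pi[symmetric] rcis_def right_diff_distrib[symmetric] norm_mult by simp
  also have "\<dots> \<le> r * (pi - \<theta>)" using norm_cis_diff_le[of \<theta> pi] \<theta> r by (intro mult_left_mono) auto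
  finally have d: "norm (rcis r \<theta> - of_real (- r)) \<le> r * (pi - \<theta>)" .
  have "norm (u_int (rcis r \<theta>) - u_int (of_real (- r))) \<le> norm (rcis r \<theta> - of_real (- r)) * ((N (rcis r \<theta>) + N (of_real (-r))) / 2)"
    by (rule u_int_diff(3)[OF cb(1) m(1)])
  also have "\<dots> \<le> (r * (pi - \<theta>)) * N (rcis r \<theta>)" using d m(2) N_nonneg r \<theta> by (intro mult_mono) auto
  finally have "q * norm (u_int (rcis r \<theta>) - u_int (of_real (- r))) \<le> q * ((r * (pi - \<theta>)) * N (rcis r \<theta>))"
    using q by (intro mult_left_mono) auto
  also have "\<dots> \<le> pi^2 / 2" using cb(3) by (simp add: mult_ac)
  finally show ?thesis .
qed

text \<open>Moduli of \<open>\<Phi>\<close> on the closure of \<open>\<Omega>\<^sub>t\<close> are comparable to those on the negative half-line, with a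
  constant that depends on nothing. This gives the limits of \<open>h\<close> at \<open>0\<close> and at infinity.\<close>

lemma Phi_abs_bounds:
  assumes r: "r > 0" and \<theta>: "A r \<le> \<theta>" "\<theta> < pi"
  shows "Phi_abs r \<theta> \<le> exp (pi^2 / 2) * neg_radius r" "neg_radius r \<le> exp (pi^2 / 2) * Phi_abs r \<theta>"
proof -
  have "q * \<bar>Re (u_int (rcis r \<theta>)) - Re (u_int (of_real (- r)))\<bar> \<le> q * norm (u_int (rcis r \<theta>) - u_int (of_real (- r)))"
    using abs_Re_le_cmod[of "u_int (rcis r \<theta>) - u_int (of_real (- r))"] q by (intro mult_left_mono) auto
  then have "q * \<bar>Re (u_int (rcis r \<theta>)) - Re (u_int (of_real (- r)))\<bar> \<le> pi^2/2"
    using u_int_minus_dist[OF assms] by linarith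
  then have "\<bar>q * Re (u_int (rcis r \<theta>)) - q * Re (u_int (of_real (- r)))\<bar> \<le> pi^2/2"
    using q by (simp add: abs_mult flip: right_diff_distrib)
  then have "q * Re (u_int (rcis r \<theta>)) \<le> pi^2/2 + q * Re (u_int (of_real (- r)))"
     "q * Re (u_int (of_real (- r))) \<le> pi^2/2 + q * Re (u_int (rcis r \<theta>))" by linarith+
  then have "exp (q * Re (u_int (rcis r \<theta>))) \<le> exp (pi^2/2) * exp (q * Re (u_int (of_real (- r))))"
     "exp (q * Re (u_int (of_real (- r)))) \<le> exp (pi^2/2) * exp (q * Re (u_int (rcis r \<theta>)))"
    by (simp_all flip: exp_add)
  then show "Phi_abs r \<theta> \<le> exp (pi^2 / 2) * neg_radius r" "neg_radius r \<le> exp (pi^2 / 2) * Phi_abs r \<theta>"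
    using r mult_left_mono[of _ _ r] unfolding Phi_abs_def neg_radius_def by (simp_all add: mult.left_commute)
qed

lemma Re_u_int_neg_mono:
  assumes "0 < x" "x \<le> y"
  shows "Re (u_int (of_real (- x))) \<le> Re (u_int (of_real (- y)))"
proof -
  have tm: "tame (of_real (- x))" "tame (of_real (- y))" using assms by (auto intro!: tame_slit simp: slit_plane_iff)
  define f where "f s = complex_of_real (1 + s^2) / ((complex_of_real (-x) - complex_of_real s) * (complex_of_real (-y) - complex_of_real s))" for s
  have f: "f s = complex_of_real ((1 + s^2) / ((x + s) * (y + s)))" for s
  proof -
    have "(complex_of_real (-x) - complex_of_real s) * (complex_of_real (-y) - complex_of_real s) = complex_of_real ((x + s) * (y + s))"
      by (simp add: algebra_simps)
    then show ?thesis unfolding f_def by (simp only: of_real_divide)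
  qed
  have i: "integrable \<rho> f" using u_int_diff(1)[OF tm] unfolding f_def .
  have eq: "u_int (of_real (- x)) - u_int (of_real (- y)) = (complex_of_real (-y) - complex_of_real (-x)) * (LINT s|\<rho>. f s)"
    using u_int_diff(2)[OF tm] unfolding f_def .
  have "(LINT s|\<rho>. f s) = complex_of_real (LINT s|\<rho>. (1 + s^2) / ((x + s) * (y + s)))"
    unfolding f by (rule integral_complex_of_real)
  then have "Re (LINT s|\<rho>. f s) = (LINT s|\<rho>. (1 + s^2) / ((x + s) * (y + s)))" by simp
  also have "\<dots> \<ge> 0"
  proof (rule integral_nonneg_AE)
    show "AE s in \<rho>. 0 \<le> (1 + s^2) / ((x + s) * (y + s))"
      using rho_nonneg by eventually_elim (use assms in auto)
  qed
  finally have "(x - y) * Re (LINT s|\<rho>. f s) \<le> 0" using assms by (intro mult_nonpos_nonneg) auto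
  then have "Re (u_int (of_real (- x)) - u_int (of_real (- y))) \<le> 0" unfolding eq by (simp flip: of_real_minus of_real_diff)
  then show ?thesis by simp
qed

lemma neg_radius_strict_mono:
  assumes "0 < x" "x < y" shows "neg_radius x < neg_radius y"
proof -
  have "neg_radius x < y * exp (q * Re (u_int (of_real (- x))))" unfolding neg_radius_def using assms by simp
  also have "\<dots> \<le> neg_radius y" unfolding neg_radius_def using Re_u_int_neg_mono[of x y] q assms by simp
  finally show ?thesis .
qed

lemma neg_radius_pos: "r > 0 \<Longrightarrow> neg_radius r > 0" by (simp add: neg_radius_def)

definition growth_const :: real where "growth_const = exp (q * Re (u_int (- 1)))"

lemma neg_radius_bounds: "r \<ge> 1 \<Longrightarrow> growth_const * r \<le> neg_radius r" "0 < r \<Longrightarrow> r \<le> 1 \<Longrightarrow> neg_radius r \<le> growth_const * r"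
  unfolding neg_radius_def growth_const_def using Re_u_int_neg_mono[of 1 r] Re_u_int_neg_mono[of r 1] q by (auto simp: mult.commute)

lemma isCont_curve: "r > 0 \<Longrightarrow> isCont curve r"
  unfolding curve_def by (intro continuous_intros isCont_A)

lemma isCont_u_int_curve:
  assumes r: "r > 0" shows "isCont (\<lambda>r. u_int (curve r)) r"
proof -
  define B where "B x = pi^2 / 2 / (q * x * (pi - A x))" for x
  have NB: "tame (curve x)" "N (curve x) \<le> B x" if "x > 0" for x
  proof -
    show "tame (curve x)" unfolding curve_def using closure_bound(1)[OF that order_refl] A_bounds[OF that] by simp
    have "q * x * (pi - A x) > 0" using q that A_bounds[OF that] by simp
    then show "N (curve x) \<le> B x" using closure_bound(3)[OF that order_refl] A_bounds[OF that]
      unfolding curve_def B_def by (simp add: pos_le_divide_eq mult.commute)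
  qed
  have "isCont (\<lambda>x. norm (curve x - curve r) * ((B x + B r) / 2)) r"
    unfolding B_def using q r A_bounds[OF r] by (intro continuous_intros isCont_A isCont_curve) auto
  then have lim: "((\<lambda>x. norm (curve x - curve r) * ((B x + B r) / 2)) \<longlongrightarrow> 0) (at r)" by (simp add: isCont_def)
  have evpos: "\<forall>\<^sub>F x in at r. x > 0" using order_tendstoD(1)[OF tendsto_ident_at r] .
  have "((\<lambda>x. u_int (curve x) - u_int (curve r)) \<longlongrightarrow> 0) (at r)"
  proof (rule Lim_null_comparison[OF _ lim])
    show "\<forall>\<^sub>F x in at r. norm (u_int (curve x) - u_int (curve r)) \<le> norm (curve x - curve r) * ((B x + B r) / 2)"
      using evpos
    proof eventually_elim
      case (elim x)
      have "norm (u_int (curve x) - u_int (curve r)) \<le> norm (curve x - curve r) * ((N (curve x) + N (curve r)) / 2)"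
        by (rule u_int_diff(3)[OF NB(1)[OF elim] NB(1)[OF r]])
      also have "\<dots> \<le> norm (curve x - curve r) * ((B x + B r) / 2)"
        using NB(2)[OF elim] NB(2)[OF r] by (intro mult_left_mono) auto
      finally show ?case .
    qed
  qed
  then show ?thesis unfolding isCont_def by (simp add: LIM_zero_iff)
qed

lemma h_eq: "h r = r * exp (q * Re (u_int (curve r)))" by (simp add: h_def Phi_abs_def curve_def)

lemma h_pos: "r > 0 \<Longrightarrow> h r > 0" by (simp add: h_eq)

lemma isCont_h: "r > 0 \<Longrightarrow> isCont h r"
  unfolding h_eq[abs_def] by (intro continuous_intros isCont_Re isCont_u_int_curve)

text \<open>Intermediate value theorem; \<open>h r\<close> is squeezed between multiples of \<open>neg_radius r\<close>, which grows at least
  linearly.\<close>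

lemma h_surj:
  assumes "x > 0" shows "\<exists>r>0. h r = x"
proof -
  define E where "E = exp (pi^2 / 2)"
  have E: "E > 0" and C: "growth_const > 0" by (simp_all add: E_def growth_const_def)
  \<comment> \<open>chosen so that the linear bounds give h r1 <= x and x <= h r2\<close>
  define r1 r2 where "r1 = min 1 (x / (E * growth_const))" and "r2 = max 1 (E * x / growth_const)"
  have r1: "0 < r1" "r1 \<le> 1" using assms E C by (auto simp: r1_def)
  have r2: "r2 \<ge> 1" by (simp add: r2_def)
  have hb: "h r \<le> E * neg_radius r" "neg_radius r \<le> E * h r" if "r > 0" for r
    using Phi_abs_bounds[OF that order_refl] A_bounds[OF that] by (simp_all add: h_def E_def)
  have "h r1 \<le> E * neg_radius r1" using hb r1 by simp
  also have "\<dots> \<le> E * (growth_const * r1)" using neg_radius_bounds(2)[OF r1] E by (intro mult_left_mono) auto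
  also have "\<dots> \<le> E * (growth_const * (x / (E * growth_const)))" using E C by (intro mult_left_mono) (auto simp: r1_def)
  also have "\<dots> = x" using E C by simp
  finally have h1: "h r1 \<le> x" .
  have "E * x = growth_const * (E * x / growth_const)" using C by simp
  also have "\<dots> \<le> growth_const * r2" using C by (intro mult_left_mono) (auto simp: r2_def)
  also have "\<dots> \<le> neg_radius r2" using neg_radius_bounds(1)[OF r2] .
  also have "\<dots> \<le> E * h r2" using hb r2 by simp
  finally have h2: "x \<le> h r2" using E by simp
  have "\<exists>r\<ge>r1. r \<le> r2 \<and> h r = x"
    using r1 r2 h1 h2 by (intro IVT allI impI isCont_h) auto
  then show ?thesis using r1 by (metis less_le_trans)
qed

lemma arg_loss_nonneg:
  assumes "r > 0" "0 < \<theta>" "\<theta> \<le> pi" shows "arg_loss r \<theta> \<ge> 0"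
proof -
  have z: "rcis r \<theta> \<in> slit_plane"
    using assms rcis_in_slit[of r \<theta>] by (cases "\<theta> = pi") (auto simp: rcis_pi slit_plane_iff)
  show ?thesis unfolding arg_loss_eq[OF tame_slit[OF z]] using assms q N_nonneg sin_ge_zero[of \<theta>] by auto
qed

lemma curve_arg_loss: "r > 0 \<Longrightarrow> A r - arg_loss r (A r) = 0"
proof (cases "A r = 0")
  case True
  moreover assume r: "r > 0"
  ultimately have "tame (rcis r (A r))" using closure_bound(1)[OF r order_refl] by simp
  then show ?thesis using True by (simp add: arg_loss_eq)
next
  case False
  moreover assume r: "r > 0"
  ultimately show ?thesis using arg_loss_at_A[OF r] A_bounds[OF r] by simp
qed

lemma Phi_curve: "r > 0 \<Longrightarrow> Phi u_int t (curve r) = of_real (h r)"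
  unfolding curve_def Phi_rcis curve_arg_loss h_def by simp

text \<open>A logarithm of \<open>\<Phi>\<close>.\<close>

definition F :: "complex \<Rightarrow> complex" where "F z = Ln z + of_real q * u_int z"

lemma exp_F: "z \<noteq> 0 \<Longrightarrow> exp (F z) = Phi u_int t z"
  by (simp add: F_def Phi_def exp_add)

lemma Im_F_rcis: "r > 0 \<Longrightarrow> -pi < \<theta> \<Longrightarrow> \<theta> \<le> pi \<Longrightarrow> Im (F (rcis r \<theta>)) = \<theta> - arg_loss r \<theta>"
  by (simp add: F_def arg_loss_def Arg_eq_Im_Ln[symmetric] Arg_rcis algebra_simps)

lemma upper_rcis:
  assumes "Im z > 0" obtains r \<theta> where "z = rcis r \<theta>" "r > 0" "0 < \<theta>" "\<theta> < pi"
proof (rule that[of "cmod z" "Arg z"])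
  show "z = rcis (cmod z) (Arg z)" by (simp add: rcis_cmod_Arg)
  show "0 < Arg z" "Arg z < pi" using assms Arg_lt_pi by auto
qed (use assms in auto)

lemma Omega_iff: "z \<in> Omega_t u t \<longleftrightarrow> Im z > 0 \<and> Im (F z) > 0"
proof
  assume "z \<in> Omega_t u t"
  then obtain r \<theta> where z: "z = rcis r \<theta>" "r > 0" "A r < \<theta>" "\<theta> < pi" by (auto simp: Omega_t_def)
  have p: "0 < \<theta>" using z A_bounds[of r] by simp
  then show "Im z > 0 \<and> Im (F z) > 0" using z arg_loss_less_iff[of r \<theta>] by (auto simp: Im_F_rcis sin_gt_zero)
next
  assume *: "Im z > 0 \<and> Im (F z) > 0"
  then obtain r \<theta> where z: "z = rcis r \<theta>" "r > 0" "0 < \<theta>" "\<theta> < pi" using upper_rcis by blast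
  then have "arg_loss r \<theta> < \<theta>" using * by (simp add: Im_F_rcis)
  then show "z \<in> Omega_t u t" using z arg_loss_less_iff[of r \<theta>] by (auto simp: Omega_t_def)
qed

lemma Im_F_less: "Im z > 0 \<Longrightarrow> Im (F z) < pi"
proof -
  assume "Im z > 0"
  then obtain r \<theta> where z: "z = rcis r \<theta>" "r > 0" "0 < \<theta>" "\<theta> < pi" using upper_rcis by blast
  then show ?thesis using arg_loss_nonneg[of r \<theta>] by (simp add: Im_F_rcis)
qed

text \<open>On \<open>\<Omega>\<^sub>t\<close> the imaginary part of \<open>F\<close> lies between \<open>0\<close> and \<open>\<pi>\<close>, so \<open>F\<close> is the principal logarithm.\<close>

lemma Ln_Phi: "z \<in> Omega_t u t \<Longrightarrow> Ln (Phi u_int t z) = F z"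
proof -
  assume "z \<in> Omega_t u t"
  then have "Im z > 0" "Im (F z) > 0" "z \<noteq> 0" using Omega_iff[of z] by auto
  then show ?thesis using Im_F_less[of z] exp_F[of z] Ln_exp[of "F z"] by simp
qed

lemma Im_Phi_pos: "z \<in> Omega_t u t \<Longrightarrow> Im (Phi u_int t z) > 0"
proof -
  assume "z \<in> Omega_t u t"
  then have "Im z > 0" "Im (F z) > 0" "z \<noteq> 0" using Omega_iff[of z] by auto
  then show ?thesis using Im_F_less[of z] by (simp add: exp_F[symmetric] Im_exp sin_gt_zero)
qed

lemma F_holomorphic: "F holomorphic_on {z. Im z > 0}"
  unfolding F_def using slit_plane_upper
  by (intro holomorphic_intros holomorphic_on_subset[OF u_int_holomorphic]) (auto simp: complex_nonpos_Reals_iff)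

lemma Phi_holomorphic: "Phi u_int t holomorphic_on slit_plane"
  unfolding Phi_def by (intro holomorphic_intros u_int_holomorphic)

lemma open_Omega: "open (Omega_t u t)"
proof -
  have "Omega_t u t = {z. Im z > 0} \<inter> F -` {z. Im z > 0}" using Omega_iff by auto
  moreover have "open ({z. Im z > 0} \<inter> F -` {z. Im z > 0})"
    by (intro continuous_open_preimage holomorphic_on_imp_continuous_on F_holomorphic open_halfspace_Im_gt)
  ultimately show ?thesis by simp
qed

text \<open>The region \<open>\<Omega>\<^sub>t\<close> together with its mirror image and the negative half-line, in the coordinate
  \<open>z = - exp w\<close>. In this coordinate the radii become horizontal and the arcs vertical, and the negative
  half-line becomes the real axis.\<close>

definition log_domain :: "complex set" where
  "log_domain = {w. \<bar>Im w\<bar> < pi \<and> \<bar>Im (w + of_real q * u_int (- exp w))\<bar> < pi}"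

lemma log_domain_cnj: "cnj w \<in> log_domain \<longleftrightarrow> w \<in> log_domain"
proof -
  have "u_int (- exp (cnj w)) = cnj (u_int (- exp w))" by (metis complex_cnj_minus exp_cnj u_int_cnj)
  moreover have "\<bar>- x - q * y\<bar> = \<bar>x + q * y\<bar>" for x y :: real by (simp add: abs_if algebra_simps)
  ultimately show ?thesis unfolding log_domain_def by simp
qed

lemma strip_slit: "\<bar>Im w\<bar> < pi \<Longrightarrow> - exp w \<in> slit_plane"
proof -
  assume w: "\<bar>Im w\<bar> < pi"
  show ?thesis
  proof (cases "Im w = 0")
    case True
    then show ?thesis by (simp add: slit_plane_iff Re_exp Im_exp)
  next
    case False
    then have "sin (Im w) \<noteq> 0" using w sin_gt_zero[of "Im w"] sin_gt_zero[of "- Im w"] by (cases "Im w > 0") auto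
    then show ?thesis by (simp add: slit_plane_iff Im_exp)
  qed
qed

lemma log_domain_real: "Complex x 0 \<in> log_domain"
proof -
  have "- exp (Complex x 0) = cnj (- exp (Complex x 0))" by (simp add: complex_eq_iff Im_exp)
  then have "u_int (- exp (Complex x 0)) = cnj (u_int (- exp (Complex x 0)))" by (metis u_int_cnj)
  then have "Im (u_int (- exp (Complex x 0))) = 0" by (simp add: complex_eq_iff)
  then show ?thesis by (simp add: log_domain_def)
qed

lemma log_domain_neg:
  assumes "- pi < y" "y < 0" shows "Complex x y \<in> log_domain \<longleftrightarrow> A (exp x) < pi + y"
proof -
  have "Im (Complex x y + of_real q * u_int (- exp (Complex x y))) = y - arg_loss (exp x) (pi + y)"
    unfolding minus_exp_Complex arg_loss_def by (simp add: algebra_simps)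
  moreover have "arg_loss (exp x) (pi + y) \<ge> 0" using assms by (intro arg_loss_nonneg) auto
  moreover have "arg_loss (exp x) (pi + y) < pi + y \<longleftrightarrow> A (exp x) < pi + y" using assms by (intro arg_loss_less_iff) auto
  ultimately show ?thesis unfolding log_domain_def using assms by auto
qed

lemma log_domain_shrink_neg:
  assumes "Complex x y \<in> log_domain" "y < 0" "0 \<le> k" "k \<le> 1" shows "Complex x (k * y) \<in> log_domain"
proof (cases "k = 0")
  case True
  then show ?thesis using log_domain_real by simp
next
  case False
  have y: "- pi < y" using assms by (simp add: log_domain_def)
  have "y \<le> k * y" using assms by (simp add: mult_le_cancel_right1)
  then have b: "- pi < k * y" "pi + y \<le> pi + k * y" using y by linarith+
  have "k * y < 0" using False assms by (simp add: mult_pos_neg)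
  then show ?thesis using log_domain_neg[OF y assms(2), of x] log_domain_neg[OF b(1), of x] assms(1) b(2) by linarith
qed

text \<open>Vertical segments towards the real axis stay inside, because angles above \<open>A r\<close> remain above \<open>A r\<close>
  when they grow.\<close>

lemma log_domain_shrink:
  assumes "Complex x y \<in> log_domain" "0 \<le> k" "k \<le> 1" shows "Complex x (k * y) \<in> log_domain"
proof -
  consider "y < 0" | "y = 0" | "y > 0" by linarith
  then show ?thesis
  proof cases
    case 1
    then show ?thesis using log_domain_shrink_neg assms by blast
  next
    case 2
    then show ?thesis using log_domain_real by simp
  next
    case 3
    have "cnj (Complex x y) \<in> log_domain" using assms log_domain_cnj by blast
    then have "Complex x (- y) \<in> log_domain" by (simp add: complex_cnj)
    then have "Complex x (k * (- y)) \<in> log_domain" using log_domain_shrink_neg[of x "-y" k] assms 3 by simp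
    then have "cnj (Complex x (k * y)) \<in> log_domain" by (simp add: complex_cnj)
    then show ?thesis using log_domain_cnj by blast
  qed
qed

text \<open>The region is the union of the real axis with vertical segments that end on it.\<close>

lemma connected_log_domain: "connected log_domain"
proof -
  have seg: "closed_segment (Complex (Re w) 0) w \<subseteq> log_domain" if "w \<in> log_domain" for w
  proof
    fix z assume "z \<in> closed_segment (Complex (Re w) 0) w"
    then obtain k where k: "0 \<le> k" "k \<le> 1" "z = (1 - k) *\<^sub>R Complex (Re w) 0 + k *\<^sub>R w"
      by (auto simp: closed_segment_def)
    then have "z = Complex (Re w) (k * Im w)" by (simp add: complex_eq_iff algebra_simps)
    then show "z \<in> log_domain" using log_domain_shrink[of "Re w" "Im w" k] that k by simp
  qed
  have re: "range complex_of_real \<subseteq> log_domain" using log_domain_real by (auto simp: complex_of_real_def)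
  define S where "S w = range complex_of_real \<union> closed_segment (Complex (Re w) 0) w" for w
  have "log_domain = \<Union>(S ` log_domain)" using seg re unfolding S_def by fastforce
  moreover have "connected (\<Union>(S ` log_domain))"
  proof (rule connected_Union)
    show "connected s" if "s \<in> S ` log_domain" for s
    proof -
      obtain w where s: "s = S w" using \<open>s \<in> S ` log_domain\<close> by auto
      have "connected (range complex_of_real)" by (intro connected_continuous_image continuous_intros) auto
      moreover have "range complex_of_real \<inter> closed_segment (Complex (Re w) 0) w \<noteq> {}"
        by (auto simp: complex_of_real_def intro!: exI[of _ "Complex (Re w) 0"])
      ultimately show ?thesis unfolding s S_def by (intro connected_Un connected_segment)
    qed
    have "complex_of_real 0 \<in> \<Inter>(S ` log_domain)" unfolding S_def by blast
    then show "\<Inter>(S ` log_domain) \<noteq> {}" by blast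
  qed
  ultimately show ?thesis by simp
qed

lemma strip_holomorphic:
  assumes "f holomorphic_on slit_plane" shows "(\<lambda>w. f (- exp w)) holomorphic_on {w. \<bar>Im w\<bar> < pi}"
  using strip_slit by (intro holomorphic_on_compose_gen[OF _ assms, unfolded o_def] holomorphic_intros) auto

lemma open_strip: "open {w. \<bar>Im w\<bar> < pi}"
proof -
  have "{w. \<bar>Im w\<bar> < pi} = {w. Im w < pi} \<inter> {w. Im w > - pi}" by auto
  then show ?thesis by (simp add: open_Int open_halfspace_Im_gt open_halfspace_Im_lt)
qed

lemma log_Phi_holomorphic: "(\<lambda>w. w + of_real q * u_int (- exp w)) holomorphic_on {w. \<bar>Im w\<bar> < pi}"
  by (intro holomorphic_intros strip_holomorphic u_int_holomorphic)

lemma open_log_domain: "open log_domain"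
proof -
  have "log_domain = {w. \<bar>Im w\<bar> < pi} \<inter> (\<lambda>w. w + of_real q * u_int (- exp w)) -` {w. \<bar>Im w\<bar> < pi}"
    by (auto simp: log_domain_def)
  moreover have "open \<dots>"
    by (intro continuous_open_preimage holomorphic_on_imp_continuous_on log_Phi_holomorphic open_strip)
  ultimately show ?thesis by simp
qed

end

section \<open>The functional equation and subordination\<close>

locale free_power = nevanlinna_power +
  fixes \<mu> \<nu> :: "real measure"
  assumes mu: "\<mu> \<in> prob_nonneg_nontrivial" and logk: "is_log_kappa \<mu> u"
    and nu: "is_free_mult_power \<mu> t \<nu>"
begin

sublocale m: nontrivial_nonneg_prob \<mu> by standard (rule mu)
sublocale n: nontrivial_nonneg_prob \<nu> by standard (use nu in \<open>simp add: is_free_mult_power_def\<close>)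

lemma Im_Ln_upper: "Im x > 0 \<Longrightarrow> 0 < Im (Ln x)" "Im x > 0 \<Longrightarrow> Im (Ln x) < pi"
  using Arg_lt_pi[of x] Arg_eq_Im_Ln[of x] by (cases "x = 0"; force)+

lemma Phi_u: "z \<in> slit_plane \<Longrightarrow> Phi u t z = Phi u_int t z"
  by (simp add: Phi_def u_eq_u_int)

lemma Phi_minus_exp: "Phi u_int t (- exp w) = - exp (w + of_real q * u_int (- exp w))"
  by (simp add: Phi_def exp_add)

text \<open>The functional equation holds on a left half-line of the real axis by \<open>eta_power_near_0\<close>, and the
  identity theorem spreads it over the connected region.\<close>

lemma eta_log_domain:
  assumes "w \<in> log_domain"
  shows "eta_transform \<nu> (Phi u_int t (- exp w)) = eta_transform \<mu> (- exp w)"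
proof -
  have Dsub: "log_domain \<subseteq> {w. \<bar>Im w\<bar> < pi}" by (auto simp: log_domain_def)
  obtain c where c: "c < 0" "\<And>y. c < y \<Longrightarrow> y < 0 \<Longrightarrow> eta_transform \<nu> (Phi u t (complex_of_real y)) = eta_transform \<mu> (complex_of_real y)"
    using eta_power_near_0[OF mu nu logk] by (auto simp: eventually_at_left_field)
  \<comment> \<open>the interval (c, 0) becomes the half-line below ln (- c)\<close>
  define b where "b = ln (- c)"
  have "(\<lambda>w. eta_transform \<nu> (- exp (w + of_real q * u_int (- exp w)))) holomorphic_on log_domain"
  proof (rule holomorphic_on_compose_gen[OF _ strip_holomorphic[OF n.eta_holomorphic], unfolded o_def])
    show "(\<lambda>w. w + of_real q * u_int (- exp w)) holomorphic_on log_domain"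
      by (rule holomorphic_on_subset[OF log_Phi_holomorphic Dsub])
  qed (auto simp: log_domain_def)
  then have hol: "(\<lambda>w. eta_transform \<nu> (Phi u_int t (- exp w)) - eta_transform \<mu> (- exp w)) holomorphic_on log_domain"
    unfolding Phi_minus_exp by (intro holomorphic_intros holomorphic_on_subset[OF strip_holomorphic[OF m.eta_holomorphic] Dsub])
  have "(\<lambda>w. eta_transform \<nu> (Phi u_int t (- exp w)) - eta_transform \<mu> (- exp w)) w = 0"
  proof (rule analytic_continuation[OF hol open_log_domain connected_log_domain _ _ islimpt_of_real_lessThan[of b] _ assms])
    show "complex_of_real ` {..<b} \<subseteq> log_domain" "complex_of_real (b - 1) \<in> log_domain"
      using log_domain_real by (auto simp: complex_of_real_def)
    fix z assume "z \<in> complex_of_real ` {..<b}"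
    then obtain x where x: "z = complex_of_real x" "x < b" by auto
    have "exp x < exp b" using x by simp
    then have "exp x < - c" using c(1) by (simp add: b_def)
    moreover have "- exp z = complex_of_real (- exp x)" by (simp add: x exp_of_real)
    ultimately show "eta_transform \<nu> (Phi u_int t (- exp z)) - eta_transform \<mu> (- exp z) = 0"
      using c(2)[of "- exp x"] Phi_u[OF slit_plane_neg[of "- exp x"]] by simp
  qed
  then show ?thesis by simp
qed

lemma eta_Phi:
  assumes "z \<in> Omega_t u t"
  shows "eta_transform \<nu> (Phi u_int t z) = eta_transform \<mu> z"
proof -
  obtain r \<theta> where z: "z = rcis r \<theta>" "r > 0" "A r < \<theta>" "\<theta> < pi" using assms by (auto simp: Omega_t_def)
  have p: "0 < \<theta>" using z A_bounds[of r] by simp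
  have w: "- exp (Complex (ln r) (\<theta> - pi)) = z" unfolding minus_exp_Complex using z by simp
  have "Complex (ln r) (\<theta> - pi) \<in> log_domain" using log_domain_neg[of "\<theta> - pi" "ln r"] z p by simp
  from eta_log_domain[OF this] show ?thesis unfolding w .
qed

text \<open>Both sides are logarithms of \<open>z / \<eta>\<^sub>\<mu> z\<close> on the upper half-plane, so they differ by a constant
  \<open>2 k \<pi> i\<close>.\<close>

lemma u_int_Ln:
  assumes "Im z > 0" shows "u_int z = Ln z - Ln (eta_transform \<mu> z)"
proof -
  define H where "H = {z. Im z > 0}"
  define f where "f z = u_int z - Ln z + Ln (eta_transform \<mu> z)" for z
  have H: "open H" "convex H" by (simp_all add: H_def open_halfspace_Im_gt convex_halfspace_Im_gt)
  have nz: "z \<noteq> 0" "z \<notin> \<real>\<^sub>\<le>\<^sub>0" "z \<in> slit_plane" if "z \<in> H" for z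
    using that by (auto simp: H_def complex_nonpos_Reals_iff slit_plane_iff)
  have eH: "eta_transform \<mu> z \<in> H" if "z \<in> H" for z using m.Im_eta_pos that by (simp add: H_def)
  have hol: "f holomorphic_on H" unfolding f_def
    by (intro holomorphic_intros holomorphic_on_subset[OF u_int_holomorphic] holomorphic_on_subset[OF m.eta_holomorphic])
       (use nz eH in auto)
  have ex: "exp (f z) = 1" if "z \<in> H" for z
  proof -
    have "exp (u_int z) = z / eta_transform \<mu> z"
      using logk nz(3)[OF that] u_eq_u_int[OF nz(3)[OF that]] unfolding is_log_kappa_def kappa_def by metis
    then show ?thesis using nz[OF that] nz[OF eH[OF that]] by (simp add: f_def exp_add exp_diff)
  qed
  have d0: "(f has_field_derivative 0) (at z within H)" if "z \<in> H" for z
  proof -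
    have 1: "(f has_field_derivative deriv f z) (at z)"
      using holomorphic_derivI[OF hol H(1) that] by simp
    then have "((\<lambda>z. exp (f z)) has_field_derivative exp (f z) * deriv f z) (at z)"
      by (rule DERIV_chain2[OF DERIV_exp])
    moreover have "((\<lambda>z. exp (f z)) has_field_derivative 0) (at z)"
      by (rule has_field_derivative_transform_within_open[OF DERIV_const[of 1] H(1) that]) (use ex in auto)
    ultimately have "exp (f z) * deriv f z = 0" by (rule DERIV_unique)
    then have "deriv f z = 0" by simp
    then show ?thesis using 1 has_field_derivative_at_within by metis
  qed
  obtain c where c: "\<And>z. z \<in> H \<Longrightarrow> f z = c"
    using has_field_derivative_zero_constant[OF H(2) d0] by auto
  have iH: "\<i> \<in> H" by (simp add: H_def)
  have "exp c = 1" using ex[OF iH] c[OF iH] by simp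
  then obtain k where k: "Re c = 0" "Im c = of_int (2 * k) * pi" by (auto simp: exp_eq_1)
  \<comment> \<open>near the negative axis Im u is close to 0 and Ln z to i pi, while the argument of eta stays between 0 and pi\<close>
  have "k = 0"
  proof -
    have "Im (u_int (rcis 1 pi)) = 0" using Im_u_int[OF tame_slit, of "-1"] by (simp add: rcis_pi slit_plane_iff)
    then have v0: "arg_loss 1 pi = 0" by (simp add: arg_loss_def)
    have "\<forall>\<^sub>F \<theta> in at pi. arg_loss 1 \<theta> < q * (pi/2)"
      using isCont_arg_loss(2)[of 1 pi] v0 q unfolding isCont_def by (intro order_tendstoD) auto
    then have "\<forall>\<^sub>F \<theta> in at_left pi. arg_loss 1 \<theta> < q * (pi/2)" by (rule filter_leD[rotated]) (simp add: at_le)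
    moreover have "\<forall>\<^sub>F \<theta> in at_left pi. pi/2 < \<theta> \<and> \<theta> < pi"
      by (auto simp: eventually_at_left_field intro!: exI[of _ "pi/2"])
    ultimately have "\<forall>\<^sub>F \<theta> in at_left pi. arg_loss 1 \<theta> < q * (pi/2) \<and> pi/2 < \<theta> \<and> \<theta> < pi" by eventually_elim auto
    then obtain \<theta> where \<theta>: "arg_loss 1 \<theta> < q * (pi/2)" "pi/2 < \<theta>" "\<theta> < pi"
      using eventually_happens[of _ "at_left pi"] by auto
    define z where "z = rcis 1 \<theta>"
    have p: "0 < \<theta>" using \<theta> pi_gt_zero by linarith
    have zH: "z \<in> H" using p \<theta> by (simp add: H_def z_def sin_gt_zero)
    have arg_loss: "arg_loss 1 \<theta> = - q * Im (u_int z)" by (simp add: arg_loss_def z_def)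
    have "q * (- Im (u_int z)) < q * (pi / 2)" using \<theta>(1) unfolding arg_loss by (simp add: algebra_simps)
    then have a1: "- Im (u_int z) < pi/2" using q mult_less_cancel_left_pos by blast
    have "q * (- Im (u_int z)) \<ge> 0" using arg_loss_nonneg[of 1 \<theta>] p \<theta> unfolding arg_loss by (simp add: algebra_simps)
    then have "q * Im (u_int z) \<le> q * 0" by simp
    then have a2: "Im (u_int z) \<le> 0" using mult_le_cancel_left_pos[OF q] by blast
    have a3: "Im (Ln z) = \<theta>" using p \<theta> by (simp add: z_def Arg_eq_Im_Ln[symmetric] Arg_rcis)
    have a4: "0 < Im (Ln (eta_transform \<mu> z))" "Im (Ln (eta_transform \<mu> z)) < pi"
      using eH[OF zH] Im_Ln_upper[of "eta_transform \<mu> z"] by (auto simp: H_def)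
    have "Im c = Im (u_int z) - \<theta> + Im (Ln (eta_transform \<mu> z))"
      unfolding c[OF zH, symmetric] f_def using a3 by simp
    then have "Im c < pi" "Im c > - 2 * pi" using a1 a2 a4 \<theta> by linarith+
    then have "2 * real_of_int k * pi < 1 * pi" "- 2 * pi < 2 * real_of_int k * pi" using k by auto
    then have "2 * real_of_int k < 1" "- 2 < 2 * real_of_int k"
      using mult_less_cancel_right_pos[OF pi_gt_zero] by blast+
    then show "k = 0" by linarith
  qed
  then have "c = 0" using k by (simp add: complex_eq_iff)
  then have "u_int z - Ln z + Ln (eta_transform \<mu> z) = 0" using c[of z] assms by (simp add: H_def f_def)
  then show ?thesis by algebra
qed

text \<open>Substituting \<open>u = Ln z - Ln \<eta>\<^sub>\<mu>\<close> and the functional equation into \<open>Ln (\<Phi> z) = Ln z + q u z\<close>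
  gives \<open>t Ln z = Ln \<zeta> + q Ln (\<eta>\<^sub>\<nu> \<zeta>)\<close> for \<open>\<zeta> = \<Phi> z\<close>. The right-hand side makes sense on the
  whole upper half-plane and defines the subordination function.\<close>

definition subord :: "complex \<Rightarrow> complex" where
  "subord \<zeta> = exp ((Ln \<zeta> + of_real q * Ln (eta_transform \<nu> \<zeta>)) / of_real t)"

lemma subord_Phi:
  assumes "z \<in> Omega_t u t" shows "subord (Phi u_int t z) = z"
proof -
  have z: "Im z > 0" "z \<noteq> 0" using assms Omega_iff by auto
  have "Ln (Phi u_int t z) + of_real q * Ln (eta_transform \<nu> (Phi u_int t z)) = F z + of_real q * (Ln z - u_int z)"
    using Ln_Phi[OF assms] eta_Phi[OF assms] u_int_Ln[OF z(1)] by simp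
  also have "\<dots> = of_real t * Ln z" by (simp add: F_def algebra_simps)
  finally show ?thesis using t z by (simp add: subord_def)
qed

lemma inj_Phi: "inj_on (Phi u_int t) (Omega_t u t)"
  by (metis inj_onI subord_Phi)

text \<open>The argument of \<open>subord \<zeta>\<close> is a convex combination of two arguments between \<open>0\<close> and \<open>\<pi>\<close>.\<close>

lemma subord_upper:
  assumes "Im \<zeta> > 0"
  shows "Im (subord \<zeta>) > 0" "Ln (subord \<zeta>) = (Ln \<zeta> + of_real q * Ln (eta_transform \<nu> \<zeta>)) / of_real t"
proof -
  define L where "L = (Ln \<zeta> + of_real q * Ln (eta_transform \<nu> \<zeta>)) / of_real t"
  have e: "Im (eta_transform \<nu> \<zeta>) > 0" using n.Im_eta_pos assms by simp
  have b: "0 < Im (Ln x)" "Im (Ln x) < pi" if "Im x > 0" for x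
    using Im_Ln_upper[OF that] by auto
  have L: "Im L = (Im (Ln \<zeta>) + q * Im (Ln (eta_transform \<nu> \<zeta>))) / t" by (simp add: L_def)
  have "Im L > 0" unfolding L using b[OF assms] b[OF e] q t by (intro divide_pos_pos add_pos_pos mult_pos_pos) auto
  moreover have "Im L < pi"
  proof -
    have "q * Im (Ln (eta_transform \<nu> \<zeta>)) < q * pi" using b[OF e] q by simp
    then have "Im (Ln \<zeta>) + q * Im (Ln (eta_transform \<nu> \<zeta>)) < t * pi" using b[OF assms] by (simp add: algebra_simps)
    then show ?thesis unfolding L using t by (simp add: pos_divide_less_eq mult.commute)
  qed
  ultimately show "Im (subord \<zeta>) > 0" "Ln (subord \<zeta>) = (Ln \<zeta> + of_real q * Ln (eta_transform \<nu> \<zeta>)) / of_real t"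
    unfolding subord_def L_def[symmetric] by (simp_all add: Im_exp sin_gt_zero)
qed

lemma subord_holomorphic: "subord holomorphic_on {z. Im z > 0}"
  unfolding subord_def using n.Im_eta_pos t
  by (intro holomorphic_intros holomorphic_on_subset[OF n.eta_holomorphic])
     (auto simp: complex_nonpos_Reals_iff slit_plane_iff less_imp_neq[symmetric])

lemma Omega_nonempty: "Omega_t u t \<noteq> {}"
proof -
  obtain \<theta> where "A 1 < \<theta>" "\<theta> < pi" using dense[OF A_bounds(2)[of 1]] by auto
  then have "rcis 1 \<theta> \<in> Omega_t u t" unfolding Omega_t_def using zero_less_one by blast
  then show ?thesis by auto
qed

text \<open>The identity holds on the image of \<open>\<Omega>\<^sub>t\<close>, which is open because \<open>\<Phi>\<close> is injective; the identity theorem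
  on the upper half-plane does the rest. In particular \<open>\<Phi>\<close> maps \<open>\<Omega>\<^sub>t\<close> onto the upper half-plane.\<close>

lemma F_subord:
  assumes "Im \<zeta> > 0" shows "F (subord \<zeta>) = Ln \<zeta>"
proof (rule analytic_continuation_open[where f = "\<lambda>\<zeta>. F (subord \<zeta>)" and g = Ln and s = "Phi u_int t ` Omega_t u t" and s' = "{z. Im z > 0}"])
  show "open (Phi u_int t ` Omega_t u t)"
    using Omega_iff slit_plane_upper
    by (intro open_mapping_thm3 inj_Phi open_Omega holomorphic_on_subset[OF Phi_holomorphic]) auto
  show "(\<lambda>\<zeta>. F (subord \<zeta>)) holomorphic_on {z. Im z > 0}"
    using subord_upper by (intro holomorphic_on_compose_gen[OF subord_holomorphic F_holomorphic, unfolded o_def]) auto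
  show "Ln holomorphic_on {z. Im z > 0}"
    by (intro holomorphic_intros) (auto simp: complex_nonpos_Reals_iff)
  show "connected {z. Im z > 0}" by (intro convex_connected convex_halfspace_Im_gt)
  show "F (subord z) = Ln z" if "z \<in> Phi u_int t ` Omega_t u t" for z
    using that subord_Phi Ln_Phi by auto
qed (use assms Im_Phi_pos Omega_nonempty open_halfspace_Im_gt in auto)

lemma subord_Omega: "Im \<zeta> > 0 \<Longrightarrow> subord \<zeta> \<in> Omega_t u t"
  using subord_upper(1)[of \<zeta>] F_subord[of \<zeta>] Im_Ln_upper[of \<zeta>] by (auto simp: Omega_iff)

lemma Phi_subord: "Im \<zeta> > 0 \<Longrightarrow> Phi u_int t (subord \<zeta>) = \<zeta>"
  using F_subord[of \<zeta>] exp_F[of "subord \<zeta>"] subord_upper(1)[of \<zeta>] by (metis exp_Ln zero_complex.simps(2) less_irrefl)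

end

section \<open>Monotonicity of h\<close>

context nevanlinna_power
begin

text \<open>On a fixed circle the argument of \<open>\<Phi>\<close> increases strictly with the angle inside \<open>\<Omega>\<^sub>t\<close>.\<close>

lemma angle_strict_mono:
  assumes r: "r > 0" and "A r < x" "x < y" "y < pi"
  shows "x - arg_loss r x < y - arg_loss r y"
proof -
  have p: "0 < x" using assms A_bounds[OF r] by simp
  have vx: "arg_loss r x < x" using arg_loss_less_iff[OF r p] assms by simp
  have "x * arg_loss r y \<le> y * arg_loss r x" using arg_loss_up[OF r p] assms by simp
  have "x * (x - arg_loss r x) < y * (x - arg_loss r x)" using vx assms by simp
  also have "\<dots> \<le> x * (y - arg_loss r y)" using \<open>x * arg_loss r y \<le> y * arg_loss r x\<close> by (simp add: algebra_simps)
  finally show ?thesis using p by simp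
qed

lemma rcis_in_Omega: "r > 0 \<Longrightarrow> A r < \<theta> \<Longrightarrow> \<theta> < pi \<Longrightarrow> rcis r \<theta> \<in> Omega_t u t"
  unfolding Omega_t_def by blast

lemma tendsto_u_int_ray:
  assumes r: "r > 0" shows "((\<lambda>\<theta>. u_int (rcis r \<theta>)) \<longlongrightarrow> u_int (curve r)) (at_right (A r))"
proof -
  note cb = closure_bound[OF r order_refl A_bounds(2)[OF r]]
  have lim: "((\<lambda>\<theta>. norm (rcis r \<theta> - curve r) * N (curve r)) \<longlongrightarrow> 0) (at_right (A r))"
  proof -
    have "isCont (\<lambda>\<theta>. norm (rcis r \<theta> - curve r) * N (curve r)) (A r)" by (intro continuous_intros)
    then show ?thesis unfolding isCont_def curve_def by (rule tendsto_mono[OF at_le, rotated, THEN tendsto_eq_rhs]) auto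
  qed
  have "((\<lambda>\<theta>. u_int (rcis r \<theta>) - u_int (curve r)) \<longlongrightarrow> 0) (at_right (A r))"
  proof (rule Lim_null_comparison[OF _ lim])
    have "\<forall>\<^sub>F \<theta> in at_right (A r). A r < \<theta> \<and> \<theta> < pi"
      using A_bounds[OF r] by (auto simp: eventually_at_right_field intro!: exI[of _ pi])
    then show "\<forall>\<^sub>F \<theta> in at_right (A r). norm (u_int (rcis r \<theta>) - u_int (curve r)) \<le> norm (rcis r \<theta> - curve r) * N (curve r)"
    proof eventually_elim
      case (elim \<theta>)
      note m = tame_N_mono[OF r A_bounds(1)[OF r], of \<theta>, OF _ _ cb(1)]
      have "norm (u_int (rcis r \<theta>) - u_int (curve r)) \<le> norm (rcis r \<theta> - curve r) * ((N (rcis r \<theta>) + N (curve r)) / 2)"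
        unfolding curve_def by (rule u_int_diff(3)[OF m(1) cb(1)]) (use elim in auto)
      also have "\<dots> \<le> norm (rcis r \<theta> - curve r) * N (curve r)"
        using m(2) elim unfolding curve_def by (intro mult_left_mono) auto
      finally show ?case .
    qed
  qed
  then show ?thesis by (simp add: LIM_zero_iff)
qed

lemma tendsto_Phi_abs: "r > 0 \<Longrightarrow> (Phi_abs r \<longlongrightarrow> h r) (at_right (A r))"
  unfolding h_eq Phi_abs_def[abs_def] by (intro tendsto_intros tendsto_u_int_ray)

text \<open>Near the boundary the argument of \<open>\<Phi>\<close> becomes arbitrarily small. Where the boundary is the slit
  this is just \<open>arg_loss r \<theta> \<ge> 0\<close>.\<close>

lemma small_angle:
  assumes r: "r > 0" and e: "e > 0"
  shows "\<exists>\<theta>. A r < \<theta> \<and> \<theta> < pi \<and> \<theta> - arg_loss r \<theta> < e"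
proof (cases "A r = 0")
  case True
  define \<theta> where "\<theta> = min e 1 / 2"
  have \<theta>: "0 < \<theta>" "\<theta> < pi" "\<theta> < e" using e pi_gt3 by (auto simp: \<theta>_def)
  then show ?thesis using arg_loss_nonneg[OF r, of \<theta>] True by (intro exI[of _ \<theta>]) auto
next
  case False
  then have p: "A r > 0" using A_bounds[OF r] by simp
  have "isCont (\<lambda>\<theta>. \<theta> - arg_loss r \<theta>) (A r)" using isCont_arg_loss(2)[OF r p] A_bounds[OF r] by auto
  then have "\<forall>\<^sub>F x in at (A r). x - arg_loss r x < e" using arg_loss_at_A[OF r p] e unfolding isCont_def by (intro order_tendstoD) auto
  then have "\<forall>\<^sub>F x in at_right (A r). x - arg_loss r x < e" by (rule filter_leD[rotated]) (simp add: at_le)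
  moreover have "\<forall>\<^sub>F x in at_right (A r). A r < x \<and> x < pi"
    using A_bounds[OF r] by (auto simp: eventually_at_right_field intro!: exI[of _ pi])
  ultimately have "\<forall>\<^sub>F x in at_right (A r). x - arg_loss r x < e \<and> A r < x \<and> x < pi" by eventually_elim auto
  then obtain x where "x - arg_loss r x < e \<and> A r < x \<and> x < pi"
    using eventually_happens[of _ "at_right (A r)"] by auto
  then show ?thesis by auto
qed

lemma angle_IVT:
  assumes r: "r > 0" and "A r < y" "y < pi" and e: "0 < e" "e \<le> y - arg_loss r y"
  shows "\<exists>\<theta>. A r < \<theta> \<and> \<theta> \<le> y \<and> \<theta> - arg_loss r \<theta> = e"
proof -
  obtain x where x: "A r < x" "x < pi" "x - arg_loss r x < e" using small_angle[OF r e(1)] by auto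
  have xy: "x \<le> y"
  proof (rule ccontr)
    assume "\<not> x \<le> y"
    then have "y - arg_loss r y < x - arg_loss r x" using angle_strict_mono[OF r, of y x] assms x by simp
    then show False using x e by simp
  qed
  have "\<exists>\<theta>\<ge>x. \<theta> \<le> y \<and> \<theta> - arg_loss r \<theta> = e"
  proof (rule IVT)
    show "\<forall>\<theta>. x \<le> \<theta> \<and> \<theta> \<le> y \<longrightarrow> isCont (\<lambda>\<theta>. \<theta> - arg_loss r \<theta>) \<theta>"
      using x assms A_bounds[OF r] by (auto intro!: continuous_intros isCont_arg_loss(2))
  qed (use x e xy in auto)
  then show ?thesis using x by (metis less_le_trans)
qed

end

context free_power
begin

lemma subord_rcis:
  assumes "x > 0" "0 < e" "e < pi"
  obtains r \<theta> where "subord (rcis x e) = rcis r \<theta>" "r = norm (subord (rcis x e))" "r > 0" "A r < \<theta>" "\<theta> < pi" "\<theta> - arg_loss r \<theta> = e" "Phi_abs r \<theta> = x"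
proof -
  have i: "Im (rcis x e) > 0" using assms by (simp add: sin_gt_zero)
  obtain r \<theta> where z: "subord (rcis x e) = rcis r \<theta>" "r > 0" "A r < \<theta>" "\<theta> < pi"
    using subord_Omega[OF i] by (auto simp: Omega_t_def)
  have p: "0 < \<theta>" using z A_bounds[of r] by simp
  have "Im (F (subord (rcis x e))) = e" unfolding F_subord[OF i] using assms by (simp add: Arg_eq_Im_Ln[symmetric] Arg_rcis)
  then have a: "\<theta> - arg_loss r \<theta> = e" unfolding z(1) using z p by (simp add: Im_F_rcis)
  have "rcis (Phi_abs r \<theta>) e = rcis x e" using Phi_subord[OF i] unfolding z(1) Phi_rcis a .
  then have "norm (rcis (Phi_abs r \<theta>) e) = norm (rcis x e)" by simp
  then have "Phi_abs r \<theta> = x" using assms z by (simp add: Phi_abs_def)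
  then show thesis using that[OF z(1)] z a by simp
qed

text \<open>On the ray of argument \<open>e\<close> the modulus of \<open>subord\<close> determines the point, by \<open>angle_strict_mono\<close>, so
  it is an injective continuous function of \<open>x\<close> and thus strictly monotone; it cannot decrease since
  it tends to infinity with \<open>x\<close>.\<close>

lemma subord_ray_strict_mono:
  assumes e: "0 < e" "e < pi"
  shows "strict_mono_on {0<..} (\<lambda>x. norm (subord (rcis x e)))"
proof -
  define m where "m x = norm (subord (rcis x e))" for x
  have cont: "continuous_on {0<..} m"
  proof -
    have "continuous_on {0<..} (\<lambda>x. subord (rcis x e))"
      by (rule continuous_on_compose2[OF holomorphic_on_imp_continuous_on[OF subord_holomorphic]])
         (use e in \<open>auto intro!: continuous_at_imp_continuous_on continuous_intros simp: sin_gt_zero\<close>)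
    then show ?thesis unfolding m_def by (intro continuous_intros)
  qed
  have inj: "inj_on m {0<..}"
  proof (rule inj_onI)
    fix x y :: real assume xy: "x \<in> {0<..}" "y \<in> {0<..}" "m x = m y"
    obtain r \<theta> where x: "r = m x" "r > 0" "A r < \<theta>" "\<theta> < pi" "\<theta> - arg_loss r \<theta> = e" "Phi_abs r \<theta> = x"
      using subord_rcis[of x e] xy(1) e unfolding m_def by (metis greaterThan_iff)
    obtain r' \<theta>' where y: "r' = m y" "r' > 0" "A r' < \<theta>'" "\<theta>' < pi" "\<theta>' - arg_loss r' \<theta>' = e" "Phi_abs r' \<theta>' = y"
      using subord_rcis[of y e] xy(2) e unfolding m_def by (metis greaterThan_iff)
    have rr: "r' = r" using x(1) y(1) xy(3) by simp
    have "\<theta>' = \<theta>"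
      using angle_strict_mono[OF x(2), of \<theta> \<theta>'] angle_strict_mono[OF x(2), of \<theta>' \<theta>] x y unfolding rr by linarith
    then show "x = y" using x(6) y(6) rr by simp
  qed
  have "strict_mono_on {0<..} m \<or> strict_antimono_on {0<..} m"
    using injective_eq_monotone_map[OF _ cont] inj by (simp add: is_interval_oi)
  moreover have "\<not> strict_antimono_on {0<..} m"
  proof
    assume anti: "strict_antimono_on {0<..} m"
    have mpos: "m x > 0" and mb: "x \<le> exp (pi^2/2) * neg_radius (m x)" if x0: "x > 0" for x
    proof -
      obtain r \<theta> where x: "r = m x" "r > 0" "A r < \<theta>" "\<theta> < pi" "Phi_abs r \<theta> = x"
        using subord_rcis[OF x0 e] unfolding m_def by metis
      show "m x > 0" using x by simp
      show "x \<le> exp (pi^2/2) * neg_radius (m x)" using Phi_abs_bounds(1)[OF x(2), of \<theta>] x by simp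
    qed
    \<comment> \<open>beyond this value the growth bound contradicts monotone decrease\<close>
    define X where "X = exp (pi^2/2) * neg_radius (m 1) + 2"
    have X: "X > 1" using neg_radius_pos[OF mpos[of 1]] by (simp add: X_def add_pos_pos)
    have "m X < m 1" using anti X by (auto simp: monotone_on_def)
    then have "neg_radius (m X) < neg_radius (m 1)" using neg_radius_strict_mono[OF mpos] X by simp
    then have "exp (pi^2/2) * neg_radius (m X) \<le> exp (pi^2/2) * neg_radius (m 1)" by simp
    moreover have "X \<le> exp (pi^2/2) * neg_radius (m X)" using mb[of X] X by simp
    moreover have "X = exp (pi^2/2) * neg_radius (m 1) + 2" by (rule X_def)
    ultimately show False by linarith
  qed
  ultimately show ?thesis by (simp add: m_def[abs_def])
qed

text \<open>Along a level curve of the argument of \<open>\<Phi>\<close>, the modulus of \<open>\<Phi>\<close> increases with \<open>r\<close>: the inverse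
  function does, by \<open>subord_ray_strict_mono\<close>.\<close>

lemma Phi_abs_less:
  assumes "0 < r1" "r1 < r2" "A r1 < x1" "x1 < pi" "A r2 < x2" "x2 < pi" "x1 - arg_loss r1 x1 = x2 - arg_loss r2 x2"
  shows "Phi_abs r1 x1 < Phi_abs r2 x2"
proof (rule ccontr)
  assume c: "\<not> Phi_abs r1 x1 < Phi_abs r2 x2"
  have r2: "0 < r2" using assms by simp
  define e where "e = x1 - arg_loss r1 x1"
  have p: "0 < x1" "0 < x2" using assms A_bounds[of r1] A_bounds[of r2] by auto
  have e: "0 < e" "e < pi"
    using arg_loss_less_iff[of r1 x1] arg_loss_nonneg[of r1 x1] p assms by (auto simp: e_def)
  have subord: "norm (subord (rcis (Phi_abs r x) e)) = r" if "r > 0" "A r < x" "x < pi" "x - arg_loss r x = e" for r x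
  proof -
    have "subord (rcis (Phi_abs r x) e) = rcis r x"
      using subord_Phi[OF rcis_in_Omega[OF that(1-3)]] unfolding Phi_rcis that(4) .
    then show ?thesis using that by simp
  qed
  have pos: "Phi_abs r1 x1 > 0" "Phi_abs r2 x2 > 0" using assms by (auto simp: Phi_abs_def)
  have "norm (subord (rcis (Phi_abs r2 x2) e)) \<le> norm (subord (rcis (Phi_abs r1 x1) e))"
  proof (cases "Phi_abs r2 x2 = Phi_abs r1 x1")
    case False
    then have "Phi_abs r2 x2 < Phi_abs r1 x1" using c by simp
    then have "norm (subord (rcis (Phi_abs r2 x2) e)) < norm (subord (rcis (Phi_abs r1 x1) e))"
      using subord_ray_strict_mono[OF e] pos by (auto simp: monotone_on_def)
    then show ?thesis by simp
  qed simp
  then show False using subord[OF assms(1,3,4)] subord[OF r2 assms(5,6)] assms by (simp add: e_def)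
qed

text \<open>The boundary curve is approached by level curves of the argument, on which \<open>Phi_abs_less\<close> applies.\<close>

lemma h_mono:
  assumes "0 < r1" "r1 < r2" shows "h r1 \<le> h r2"
proof (rule ccontr)
  assume "\<not> h r1 \<le> h r2"
  then obtain c where c: "h r2 < c" "c < h r1" using dense by (meson not_le)
  have r2: "0 < r2" using assms by simp
  have 1: "\<exists>y. A r < y \<and> y < pi \<and> (\<forall>x. A r < x \<longrightarrow> x \<le> y \<longrightarrow> Q (Phi_abs r x))"
    if r: "r > 0" and Q: "\<forall>\<^sub>F x in at_right (A r). Q (Phi_abs r x)" for r Q
  proof -
    obtain b where b: "A r < b" "\<And>x. A r < x \<Longrightarrow> x < b \<Longrightarrow> Q (Phi_abs r x)"
      using Q by (auto simp: eventually_at_right_field)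
    obtain y where "A r < y" "y < min b pi" using dense[of "A r" "min b pi"] b A_bounds[OF r] by auto
    then show ?thesis using b(2) by (intro exI[of _ y]) auto
  qed
  obtain y1 where y1: "A r1 < y1" "y1 < pi" "\<And>x. A r1 < x \<Longrightarrow> x \<le> y1 \<Longrightarrow> c < Phi_abs r1 x"
    using 1[OF assms(1), of "\<lambda>x. c < x"] order_tendstoD(1)[OF tendsto_Phi_abs[OF assms(1)] c(2)] by blast
  obtain y2 where y2: "A r2 < y2" "y2 < pi" "\<And>x. A r2 < x \<Longrightarrow> x \<le> y2 \<Longrightarrow> Phi_abs r2 x < c"
    using 1[OF r2, of "\<lambda>x. x < c"] order_tendstoD(2)[OF tendsto_Phi_abs[OF r2] c(1)] by blast
  \<comment> \<open>a common argument that both circles attain below the chosen angles\<close>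
  define e where "e = min (y1 - arg_loss r1 y1) (y2 - arg_loss r2 y2)"
  have "arg_loss r1 y1 < y1" using arg_loss_less_iff[OF assms(1), of y1] y1 A_bounds[OF assms(1)] by auto
  moreover have "arg_loss r2 y2 < y2" using arg_loss_less_iff[OF r2, of y2] y2 A_bounds[OF r2] by auto
  ultimately have e: "e > 0" "e \<le> y1 - arg_loss r1 y1" "e \<le> y2 - arg_loss r2 y2" by (auto simp: e_def)
  obtain x1 where x1: "A r1 < x1" "x1 \<le> y1" "x1 - arg_loss r1 x1 = e" using angle_IVT[OF assms(1) y1(1,2) e(1,2)] by blast
  obtain x2 where x2: "A r2 < x2" "x2 \<le> y2" "x2 - arg_loss r2 x2 = e" using angle_IVT[OF r2 y2(1,2) e(1,3)] by blast
  have "Phi_abs r1 x1 < Phi_abs r2 x2" using Phi_abs_less[OF assms x1(1) _ x2(1)] x1 x2 y1 y2 by simp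
  then show False using y1(3)[OF x1(1,2)] y2(3)[OF x2(1,2)] by simp
qed

end

section \<open>Gaps of the representing measure and the derivative of Phi\<close>

context nevanlinna_power
begin

text \<open>On the interval the kernel \<open>K y\<close> is at least \<open>1 / (y - x)\<^sup>2\<close>.\<close>

lemma rho_Ioc_le:
  assumes x: "x < y" and t: "tame (of_real y)"
  shows "measure \<rho> {x<..y} \<le> (y - x)^2 * N (of_real y)"
proof -
  have "measure \<rho> {x<..y} = (LINT s|\<rho>. indicator {x<..y} s)" by simp
  also have "\<dots> \<le> (LINT s|\<rho>. (y - x)^2 * K (of_real y) s)"
  proof (rule integral_mono_AE)
    show "AE s in \<rho>. indicator {x<..y} s \<le> (y - x)^2 * K (of_real y) s"
      using t[unfolded tame_def, THEN conjunct1]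
    proof eventually_elim
      case (elim s)
      show ?case
      proof (cases "s \<in> {x<..y}")
        case True
        then have s: "x < s" "s < y" using elim by auto
        have "(norm (complex_of_real y - complex_of_real s))^2 = (y - s)^2" by (simp flip: of_real_diff)
        moreover have "(y - s)^2 \<le> (y - x)^2 * (1 + s^2)"
        proof -
          have "(y - s)^2 * 1 \<le> (y - x)^2 * (1 + s^2)" using s by (intro mult_mono power_mono) auto
          then show ?thesis by simp
        qed
        ultimately have "1 \<le> (y - x)^2 * ((1 + s^2) / (y - s)^2)" and "K (of_real y) s = (1 + s^2) / (y - s)^2"
          using s by (simp_all add: K_def pos_le_divide_eq)
        then show ?thesis using True by simp
      qed (use K_nonneg in simp)
    qed
    show "integrable \<rho> (indicat_real {x<..y})"
      by (intro integrable_real_indicator) (auto simp: sets_rho less_top[symmetric])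
  qed (use t in \<open>auto simp: tame_def\<close>)
  also have "\<dots> = (y - x)^2 * N (of_real y)" by (simp add: N_def)
  finally show ?thesis .
qed

text \<open>By \<open>rho_Ioc_le\<close> the distribution function of \<open>\<rho>\<close> satisfies a Lipschitz condition of order two on
  such an interval, hence has zero derivative.\<close>

lemma rho_gap:
  assumes A0: "\<And>r. \<alpha> < r \<Longrightarrow> r < \<beta> \<Longrightarrow> r > 0 \<Longrightarrow> A r = 0" and "0 \<le> \<alpha>"
  shows "emeasure \<rho> {\<alpha><..<\<beta>} = 0"
proof (rule emeasure_open_eq_0_if_locally_0[OF sets_rho])
  fix r assume "r \<in> {\<alpha><..<\<beta>}"
  then have r: "\<alpha> < r" "r < \<beta>" by auto
  obtain c where c: "\<alpha> < c" "c < r" using dense r by blast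
  obtain d where d: "r < d" "d < \<beta>" using dense r by blast
  have c0: "0 < c" using c assms by simp
  define B where "B = 1 / (q * c)"
  have B: "B > 0" using q c0 by (simp add: B_def)
  define \<phi> where "\<phi> x = measure \<rho> {..x}" for x
  have diff: "\<phi> y - \<phi> x = measure \<rho> {x<..y}" if "x < y" for x y
  proof -
    have "measure \<rho> ({..x} \<union> {x<..y}) = measure \<rho> {..x} + measure \<rho> {x<..y}"
      by (rule finite_measure_Union) (auto simp: sets_rho)
    moreover have "{..x} \<union> {x<..y} = {..y}" using that by auto
    ultimately show ?thesis by (simp add: \<phi>_def)
  qed
  have quad: "\<bar>\<phi> y - \<phi> x\<bar> \<le> B * (y - x)^2" if "c \<le> x" "x < y" "y \<le> d" for x y
  proof -
    have y: "y > 0" "A y = 0" using A0[of y] that c d c0 by auto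
    have "q * c * N (of_real y) \<le> q * y * N (of_real y)" using that q N_nonneg by (intro mult_right_mono mult_left_mono) auto
    then have "N (of_real y) \<le> B" using N_bound_flat(2)[OF y] q c0 by (simp add: B_def field_simps)
    then have "(y - x)^2 * N (of_real y) \<le> (y - x)^2 * B" by (intro mult_left_mono) auto
    then show ?thesis using rho_Ioc_le[OF that(2) N_bound_flat(1)[OF y]] unfolding diff[OF that(2)] by (simp add: mult.commute)
  qed
  have quad': "\<bar>\<phi> y - \<phi> x\<bar> \<le> B * (y - x)^2" if "x \<in> {c..d}" "y \<in> {c..d}" for x y
    using quad[of x y] quad[of y x] that by (cases x y rule: linorder_cases) (auto simp: abs_minus_commute power2_commute)
  have "(\<phi> has_field_derivative 0) (at x within {c..d})" if x: "x \<in> {c..d}" for x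
    unfolding has_field_derivative_iff
  proof (rule Lim_null_comparison)
    show "((\<lambda>y. B * \<bar>y - x\<bar>) \<longlongrightarrow> 0) (at x within {c..d})" by (auto intro!: tendsto_eq_intros)
    show "\<forall>\<^sub>F y in at x within {c..d}. norm ((\<phi> y - \<phi> x) / (y - x)) \<le> B * \<bar>y - x\<bar>"
      unfolding eventually_at_filter
    proof (intro always_eventually allI impI)
      fix y assume "y \<noteq> x" "y \<in> {c..d}"
      then show "norm ((\<phi> y - \<phi> x) / (y - x)) \<le> B * \<bar>y - x\<bar>"
        using quad'[OF x, of y] by (simp add: abs_divide divide_le_eq power2_eq_square mult.assoc abs_mult_self_eq)
    qed
  qed
  then obtain k where "\<And>x. x \<in> {c..d} \<Longrightarrow> \<phi> x = k"
    using has_field_derivative_zero_constant[of "{c..d}" \<phi>] by auto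
  then have "\<phi> d - \<phi> c = 0" using c d by simp
  then have "measure \<rho> {c<..d} = 0" using diff[of c d] c d by simp
  then have z: "emeasure \<rho> {c<..d} = 0" by (simp add: emeasure_eq_measure)
  have "emeasure \<rho> {c<..<d} = 0" by (rule emeasure_eq_0[OF _ z]) (auto simp: sets_rho)
  then show "\<exists>U. open U \<and> r \<in> U \<and> emeasure \<rho> U = 0"
    using c d by (intro exI[of _ "{c<..<d}"]) auto
qed

definition u_int_deriv :: "complex \<Rightarrow> complex" where
  "u_int_deriv w = - (LINT s|\<rho>. complex_of_real (1 + s^2) / (w - complex_of_real s)^2)"

lemma u_int_deriv_cnj: "u_int_deriv (cnj w) = cnj (u_int_deriv w)"
  unfolding u_int_deriv_def complex_cnj_minus
  by (subst Bochner_Integration.integral_cnj[symmetric]) (simp del: Bochner_Integration.integral_cnj)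

text \<open>The difference of the two sides is \<open>2 (Im z)\<^sup>2 s / |z - s|\<^sup>4\<close>.\<close>

lemma Re_kernel_le:
  assumes "s \<ge> 0" "z \<noteq> complex_of_real s"
  shows "Re (z / (z - complex_of_real s)^2) \<le> Re z / (norm (z - complex_of_real s))^2"
proof -
  define x y where "x = Re z" and "y = Im z"
  define m where "m = (x - s)^2 + y^2"
  have n: "(norm (z - complex_of_real s))^2 = m" by (simp add: cmod_power2 m_def x_def y_def)
  have m: "m > 0" using assms(2) n by (metis eq_iff_diff_eq_0 zero_less_norm_iff zero_less_power)
  have "z / (z - complex_of_real s)^2 = z * (cnj (z - complex_of_real s))^2 / of_real (m^2)"
  proof -
    define w where "w = z - complex_of_real s"
    have w: "w \<noteq> 0" using assms(2) by (simp add: w_def)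
    have "w * cnj w = of_real m" using complex_norm_square[of w] n by (simp add: w_def)
    then have "w^2 * (cnj w)^2 = of_real (m^2)" by (metis of_real_power power_mult_distrib)
    then have "z * (cnj w)^2 / of_real (m^2) = z * (cnj w)^2 / (w^2 * (cnj w)^2)" by simp
    also have "\<dots> = z / w^2" using w by simp
    finally show ?thesis by (simp add: w_def)
  qed
  then have "Re (z / (z - complex_of_real s)^2) = Re (z * (cnj (z - complex_of_real s))^2) / m^2"
    by (simp only: Re_divide_of_real)
  also have "Re (z * (cnj (z - complex_of_real s))^2) = x * ((x - s)^2 - y^2) + 2 * y^2 * (x - s)"
    by (simp add: x_def y_def power2_eq_square algebra_simps)
  also have "\<dots> = x * m - 2 * (y^2 * s)" by (simp add: m_def power2_eq_square algebra_simps)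
  also have "(x * m - 2 * (y^2 * s)) / m^2 \<le> x * m / m^2" using assms(1) by (intro divide_right_mono) auto
  also have "\<dots> = x / m" using m by (simp add: power2_eq_square)
  finally show ?thesis by (simp add: n x_def)
qed

text \<open>The logarithmic derivative of \<open>\<Phi>\<close> has positive real part. By \<open>Re_kernel_le\<close> it is at least
  \<open>1 - q r cos \<theta> N\<close>, and \<open>q r sin \<theta> N \<le> \<theta>\<close> on the closure of \<open>\<Omega>\<^sub>t\<close>, so the claim reduces to
  \<open>\<theta> cos \<theta> < sin \<theta>\<close>.\<close>

lemma Re_deriv_pos:
  assumes r: "r > 0" and \<theta>: "A r \<le> \<theta>" "0 < \<theta>" "\<theta> < pi"
  shows "Re (1 + of_real q * rcis r \<theta> * u_int_deriv (rcis r \<theta>)) > 0"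
proof -
  define z where "z = rcis r \<theta>"
  have zs: "z \<in> slit_plane" using rcis_in_slit[OF r \<theta>(2,3)] by (simp add: z_def)
  obtain d where d: "d > 0" "AE s in \<rho>. d \<le> norm (z - complex_of_real s)" using slit_AE_dist[OF zs] by blast
  note i = u_int_has_field_derivative(2)[OF d]
  have tz: "tame z" by (rule tame_slit[OF zs])
  have sp: "sin \<theta> > 0" using \<theta> by (intro sin_gt_zero) auto
  define f where "f s = z * (complex_of_real (1 + s^2) / (z - complex_of_real s)^2)" for s
  have fi: "integrable \<rho> f" unfolding f_def using i by (rule integrable_mult_right)
  have "(LINT s|\<rho>. f s) = z * (LINT s|\<rho>. complex_of_real (1 + s^2) / (z - complex_of_real s)^2)"
    unfolding f_def by (rule integral_mult_right_zero)
  then have "(LINT s|\<rho>. f s) = - (z * u_int_deriv z)" by (simp add: u_int_deriv_def)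
  then have "- Re (z * u_int_deriv z) = Re (LINT s|\<rho>. f s)" by simp
  also have "\<dots> = (LINT s|\<rho>. Re (f s))" by (rule integral_Re[OF fi, symmetric])
  also have "\<dots> \<le> (LINT s|\<rho>. Re z * K z s)"
  proof (rule integral_mono_AE)
    show "AE s in \<rho>. Re (f s) \<le> Re z * K z s"
      using tz[unfolded tame_def, THEN conjunct1] rho_nonneg
    proof eventually_elim
      case (elim s)
      have "f s = of_real (1 + s^2) * (z / (z - complex_of_real s)^2)" by (simp add: f_def)
      then have "Re (f s) = (1 + s^2) * Re (z / (z - complex_of_real s)^2)" by (simp only: Re_complex_of_real Im_complex_of_real times_complex.simps)
      also have "\<dots> \<le> (1 + s^2) * (Re z / (norm (z - complex_of_real s))^2)"
        using Re_kernel_le[of s z] elim by (intro mult_left_mono) auto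
      finally show ?case by (simp add: K_def mult.commute)
    qed
  qed (use fi tz in \<open>auto simp: tame_def\<close>)
  also have "\<dots> = r * cos \<theta> * N z" by (simp add: N_def z_def)
  finally have *: "- Re (z * u_int_deriv z) \<le> r * cos \<theta> * N z" .
  have "q * (r * cos \<theta> * N z) < 1"
  proof (cases "cos \<theta> \<le> 0")
    case True
    then have "(q * r * N z) * cos \<theta> \<le> 0" using q r N_nonneg by (intro mult_nonneg_nonpos) auto
    then show ?thesis by (simp add: mult_ac)
  next
    case False
    have "q * r * sin \<theta> * N z \<le> \<theta>" using closure_bound(2)[OF r \<theta>(1,3)] by (simp add: z_def)
    then have "(q * r * sin \<theta> * N z) * cos \<theta> \<le> \<theta> * cos \<theta>" using False by (intro mult_right_mono) auto
    also have "\<dots> < sin \<theta>" using x_cos_less_sin \<theta> by simp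
    finally have "sin \<theta> * (q * (r * cos \<theta> * N z)) < sin \<theta> * 1" by (simp add: mult_ac)
    then show ?thesis using mult_less_cancel_left_pos[OF sp] by blast
  qed
  then have "q * (- Re (z * u_int_deriv z)) < 1" using mult_left_mono[OF *, of q] q by linarith
  moreover have "Re (1 + of_real q * z * u_int_deriv z) = 1 + q * Re (z * u_int_deriv z)" by (simp add: algebra_simps)
  ultimately show ?thesis unfolding z_def[symmetric] mult_minus_right by linarith
qed

lemma Phi_deriv:
  assumes "d > 0" "AE s in \<rho>. d \<le> norm (z - complex_of_real s)"
  shows "(Phi u_int t has_field_derivative exp (of_real q * u_int z) * (1 + of_real q * z * u_int_deriv z)) (at z)"
proof -
  have d: "(u_int has_field_derivative u_int_deriv z) (at z)" using u_int_has_field_derivative(1)[OF assms] by (simp add: u_int_deriv_def)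
  have e: "((\<lambda>z. exp (of_real q * u_int z)) has_field_derivative exp (of_real q * u_int z) * (of_real q * u_int_deriv z)) (at z)"
    by (rule DERIV_chain2[OF DERIV_exp DERIV_cmult[OF d]])
  have "Phi u_int t = (\<lambda>z. z * exp (of_real q * u_int z))" by (simp add: Phi_def fun_eq_iff)
  then show ?thesis using DERIV_mult[OF DERIV_ident e] by (simp add: algebra_simps)
qed

end

section \<open>Local inversion of Phi at the boundary\<close>

context nevanlinna_power
begin

text \<open>The two kinds of points at which \<open>\<Phi>\<close> can be inverted locally; the remaining ones, boundary points of
  \<open>V\<^sub>t\<close>, have empty interior.\<close>

definition regular :: "real \<Rightarrow> bool" where
  "regular r0 \<longleftrightarrow> r0 > 0 \<and> (A r0 > 0 \<or> (\<exists>d>0. \<forall>r>0. \<bar>r - r0\<bar> < d \<longrightarrow> A r = 0))"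

lemma ex_regular:
  assumes "0 < l" "l < b" shows "\<exists>r. l < r \<and> r < b \<and> regular r"
proof (cases "\<exists>r. l < r \<and> r < b \<and> A r > 0")
  case True
  then show ?thesis using assms by (auto simp: regular_def)
next
  case False
  define r0 where "r0 = (l + b) / 2"
  have "A r = 0" if "r > 0" "\<bar>r - r0\<bar> < (b - l) / 2" for r
  proof -
    have "l < r" "r < b" using that by (auto simp: r0_def abs_less_iff field_simps)
    then show ?thesis using False A_bounds[OF that(1)] by force
  qed
  then have "regular r0" using assms unfolding regular_def by (auto simp: r0_def intro!: exI[of _ "(b - l) / 2"])
  then show ?thesis using assms by (intro exI[of _ r0]) (auto simp: r0_def)
qed

text \<open>A neighbourhood of a point of the curve on which \<open>\<Phi>\<close> is analytic and injective and which its values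
  split correctly: values in the upper half-plane come from \<open>\<Omega>\<^sub>t\<close>, and real values from the curve.\<close>

definition local_patch :: "real \<Rightarrow> complex set \<Rightarrow> bool" where
  "local_patch r0 W \<longleftrightarrow> open W \<and> curve r0 \<in> W \<and> 0 \<notin> W \<and> u_int holomorphic_on W \<and> inj_on (Phi u_int t) W \<and>
     (\<forall>z\<in>W. Im (Phi u_int t z) > 0 \<longrightarrow> z \<in> Omega_t u t) \<and>
     (\<forall>z\<in>W. Im (Phi u_int t z) = 0 \<longrightarrow> z = curve (norm z)) \<and>
     (A r0 > 0 \<longrightarrow> W \<subseteq> {z. Im z > 0})"

lemma Phi_cnj: "Phi u_int t (cnj z) = cnj (Phi u_int t z)"
  by (simp add: Phi_def u_int_cnj exp_cnj)

lemma u_int_real: "Im (u_int (of_real x)) = 0"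
proof -
  have "u_int (of_real x) = cnj (u_int (of_real x))" by (metis complex_cnj_complex_of_real u_int_cnj)
  then show ?thesis by (simp add: complex_eq_iff)
qed

text \<open>Off the slit the derivative of \<open>\<Phi>\<close> is nonzero by \<open>Re_deriv_pos\<close>. Near the curve the imaginary part of
  \<open>F\<close> is small, so its sign is the sign of \<open>Im \<Phi>\<close>; it vanishes only on the curve.\<close>

lemma local_patch_curved:
  assumes r0: "r0 > 0" and A0: "A r0 > 0" shows "\<exists>W. local_patch r0 W"
proof -
  define z0 where "z0 = curve r0"
  define S where "S = {z. Im z > 0} \<inter> F -` {w. \<bar>Im w\<bar> < pi}"
  have oS: "open S" unfolding S_def
    by (intro continuous_open_preimage holomorphic_on_imp_continuous_on F_holomorphic open_halfspace_Im_gt open_strip)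
  have z0: "Im z0 > 0" using A0 A_bounds[OF r0] r0 by (simp add: z0_def curve_def sin_gt_zero)
  have "Im (F z0) = 0" unfolding z0_def curve_def using Im_F_rcis[OF r0, of "A r0"] curve_arg_loss[OF r0] A_bounds[OF r0] A0 by simp
  then have z0S: "z0 \<in> S" using z0 by (simp add: S_def)
  have Ss: "S \<subseteq> slit_plane" by (auto simp: S_def slit_plane_upper)
  obtain d where d: "d > 0" "AE s in \<rho>. d \<le> norm (z0 - complex_of_real s)"
    using slit_AE_dist[OF slit_plane_upper[OF z0]] by blast
  have "Re (1 + of_real q * z0 * u_int_deriv z0) > 0"
    unfolding z0_def curve_def using Re_deriv_pos[OF r0 order_refl A0] A_bounds[OF r0] by simp
  then have "1 + of_real q * z0 * u_int_deriv z0 \<noteq> 0" by (metis less_irrefl zero_complex.simps(1))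
  then have "deriv (Phi u_int t) z0 \<noteq> 0" using DERIV_imp_deriv[OF Phi_deriv[OF d]] by simp
  then obtain e where e: "e > 0" "ball z0 e \<subseteq> S" "inj_on (Phi u_int t) (ball z0 e)"
    using has_complex_derivative_locally_invertible[OF holomorphic_on_subset[OF Phi_holomorphic Ss] z0S oS] by metis
  have split: "z \<in> Omega_t u t \<or> Im (Phi u_int t z) \<le> 0" "Im (Phi u_int t z) = 0 \<longrightarrow> z = curve (norm z)" if "z \<in> ball z0 e" for z
  proof -
    have z: "Im z > 0" "\<bar>Im (F z)\<bar> < pi" using that e by (auto simp: S_def)
    have "Phi u_int t z = exp (F z)" using z exp_F[of z] by force
    then have Im: "Im (Phi u_int t z) = exp (Re (F z)) * sin (Im (F z))" by (simp add: Im_exp)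
    show "z \<in> Omega_t u t \<or> Im (Phi u_int t z) \<le> 0"
    proof (cases "Im (F z) > 0")
      case False
      then have "sin (- Im (F z)) \<ge> 0" using z by (intro sin_ge_zero) auto
      then show ?thesis unfolding Im by (simp add: mult_nonneg_nonpos)
    qed (use z Omega_iff in auto)
    show "Im (Phi u_int t z) = 0 \<longrightarrow> z = curve (norm z)"
    proof
      assume "Im (Phi u_int t z) = 0"
      then have s: "sin (Im (F z)) = 0" unfolding Im by simp
      have F0: "Im (F z) = 0"
      proof (rule ccontr)
        assume "Im (F z) \<noteq> 0"
        then have "sin \<bar>Im (F z)\<bar> > 0" using z by (intro sin_gt_zero) auto
        then show False using s by (auto simp: abs_if split: if_splits)
      qed
      obtain r \<theta> where rt: "z = rcis r \<theta>" "r > 0" "0 < \<theta>" "\<theta> < pi" using upper_rcis[OF z(1)] .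
      have vt: "arg_loss r \<theta> = \<theta>" using F0 rt Im_F_rcis[of r \<theta>] by simp
      have "\<theta> = A r"
      proof (rule ccontr)
        assume "\<theta> \<noteq> A r"
        moreover have "\<not> A r < \<theta>" using arg_loss_less_iff[OF rt(2-4)] vt by simp
        ultimately have lt: "\<theta> < A r" by simp
        then have "arg_loss r (A r) = A r" "A r > 0" using arg_loss_at_A[OF rt(2)] rt by auto
        then have "\<theta> * A r < A r * \<theta>" using arg_loss_up_strict[OF rt(2,3) lt] A_bounds[OF rt(2)] vt by simp
        then show False by simp
      qed
      then show "z = curve (norm z)" using rt by (simp add: curve_def)
    qed
  qed
  have "local_patch r0 (ball z0 e)"
    unfolding local_patch_def
  proof (intro conjI ballI impI)
    have "0 \<notin> S" by (simp add: S_def)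
    then show "0 \<notin> ball z0 e" using e(2) by blast
    show "ball z0 e \<subseteq> {z. Im z > 0}" using e by (auto simp: S_def)
    show "u_int holomorphic_on ball z0 e" using e Ss by (intro holomorphic_on_subset[OF u_int_holomorphic]) auto
  qed (use e split z0_def in force)+
  then show ?thesis by blast
qed

text \<open>Here the curve runs along the slit in a gap of \<open>\<rho>\<close>, and \<open>\<Phi>\<close> is analytic across it. The logarithmic
  derivative \<open>G\<close> of \<open>\<Phi>\<close> has positive real part in the upper half-disc by \<open>Re_deriv_pos\<close>, in the lower
  one by reflection, and a nonnegative one on the axis. A nonconstant analytic function with values in
  the closed right half-plane has no zero, by the open mapping theorem. Reflection also decides the
  sign of \<open>Im \<Phi>\<close>.\<close>

lemma local_patch_flat:
  assumes r0: "r0 > 0" and d: "d > 0" "\<And>r. r > 0 \<Longrightarrow> \<bar>r - r0\<bar> < d \<Longrightarrow> A r = 0" shows "\<exists>W. local_patch r0 W"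
proof -
  define e where "e = min d r0"
  have e: "e > 0" "e \<le> d" "e \<le> r0" using d r0 by (auto simp: e_def)
  have A0: "A r = 0" "r > 0" if "\<bar>r - r0\<bar> < e" for r using d(2)[of r] that e by auto
  have "emeasure \<rho> {r0 - e<..<r0 + e} = 0" using e A0 by (intro rho_gap) (auto simp: abs_less_iff)
  then have "AE s in \<rho>. s \<notin> {r0 - e<..<r0 + e}"
    by (intro AE_I[where N = "{r0 - e<..<r0 + e}"]) (auto simp: sets_rho)
  then have gap: "AE s in \<rho>. \<bar>s - r0\<bar> \<ge> e" by eventually_elim auto
  define B where "B = ball (complex_of_real r0) (e/2)"
  have far: "AE s in \<rho>. e/2 \<le> norm (z - complex_of_real s)" if "z \<in> B" for z
    using gap
  proof eventually_elim
    case (elim s)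
    have "\<bar>s - r0\<bar> = norm (complex_of_real s - complex_of_real r0)" by (simp flip: of_real_diff)
    also have "\<dots> \<le> norm (complex_of_real s - z) + norm (z - complex_of_real r0)"
      by (metis norm_triangle_ineq diff_add_cancel add_diff_eq)
    finally show ?case using elim that by (simp add: B_def dist_norm norm_minus_commute)
  qed
  have e2: "e / 2 > 0" using e by simp
  have der: "(u_int has_field_derivative u_int_deriv z) (at z)" if "z \<in> B" for z
    using u_int_has_field_derivative(1)[OF e2 far[OF that]] by (simp add: u_int_deriv_def)
  have holu: "u_int holomorphic_on B" unfolding holomorphic_on_def
    using der by (meson field_differentiable_at_within field_differentiable_def)
  have u_int_deriv: "deriv u_int z = u_int_deriv z" if "z \<in> B" for z using DERIV_imp_deriv[OF der[OF that]] .
  have oB: "open B" and cB: "connected B" and rB: "complex_of_real r0 \<in> B" using e by (simp_all add: B_def)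
  have holD: "u_int_deriv holomorphic_on B"
    using holomorphic_deriv[OF holu oB] by (rule holomorphic_transform) (use u_int_deriv in auto)
  define G where "G z = 1 + of_real q * z * u_int_deriv z" for z
  have holG: "G holomorphic_on B" unfolding G_def by (intro holomorphic_intros holD)
  have near: "\<bar>norm z - r0\<bar> < e" if "z \<in> B" for z
  proof -
    have "\<bar>norm z - norm (complex_of_real r0)\<bar> \<le> norm (z - complex_of_real r0)" by (rule norm_triangle_ineq3)
    also have "\<dots> < e" using that e by (simp add: B_def dist_norm norm_minus_commute)
    finally show ?thesis using r0 by simp
  qed
  have cnjB: "cnj z \<in> B" if "z \<in> B" for z
  proof -
    have "dist (complex_of_real r0) (cnj z) = norm (cnj (complex_of_real r0 - z))" by (simp add: dist_norm)
    then show ?thesis using that by (simp add: B_def dist_norm del: complex_cnj_diff)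
  qed
  have upO: "z \<in> Omega_t u t" if zB: "z \<in> B" and iz: "Im z > 0" for z
  proof -
    obtain r \<theta> where rt: "z = rcis r \<theta>" "r > 0" "0 < \<theta>" "\<theta> < pi" using upper_rcis[OF iz] .
    then show ?thesis using rcis_in_Omega[of r \<theta>] A0[of r] near[OF zB] by simp
  qed
  have Gup: "Re (G z) > 0" if zB: "z \<in> B" and iz: "Im z > 0" for z
  proof -
    obtain r \<theta> where rt: "z = rcis r \<theta>" "r > 0" "0 < \<theta>" "\<theta> < pi" using upper_rcis[OF iz] .
    have "A r = 0" using A0[of r] near[OF zB] rt by simp
    then show ?thesis unfolding G_def rt(1) using rt by (intro Re_deriv_pos) auto
  qed
  have Gcnj: "G (cnj z) = cnj (G z)" for z by (simp add: G_def u_int_deriv_cnj)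
  have Gre: "Re (G z) \<ge> 0" if z: "z \<in> B" for z
  proof -
    consider "Im z > 0" | "Im z < 0" | "Im z = 0" by linarith
    then show ?thesis
    proof cases
      case 1
      then show ?thesis using Gup z by force
    next
      case 2
      then show ?thesis using Gup[OF cnjB[OF z]] Gcnj[of z] by simp
    next
      case 3
      define x where "x = Re z"
      have zx: "z = complex_of_real x" using 3 by (simp add: complex_eq_iff x_def)
      have "\<bar>x - r0\<bar> = norm (z - complex_of_real r0)" unfolding zx by (simp flip: of_real_diff)
      then have "\<bar>x - r0\<bar> < e" using z e by (simp add: B_def dist_norm norm_minus_commute)
      then have x: "x > 0" "A x = 0" using A0 by auto
      have "u_int_deriv z = - complex_of_real (N z)"
      proof -
        have "complex_of_real (1 + s^2) / (z - complex_of_real s)^2 = complex_of_real (K z s)" for s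
        proof -
          have "(norm (z - complex_of_real s))^2 = (x - s)^2" unfolding zx by (simp flip: of_real_diff)
          then show ?thesis by (simp add: K_def zx)
        qed
        then show ?thesis unfolding u_int_deriv_def N_def by (simp only: integral_complex_of_real)
      qed
      then have "G z = complex_of_real (1 - q * x * N z)" by (simp add: G_def zx algebra_simps)
      then show ?thesis using N_bound_flat(2)[OF x] by (simp add: zx)
    qed
  qed
  \<comment> \<open>otherwise the open image of G would contain negative numbers\<close>
  have "G (complex_of_real r0) \<noteq> 0"
  proof
    assume G0: "G (complex_of_real r0) = 0"
    have up: "complex_of_real r0 + \<i> * of_real (e/4) \<in> B" (is "?w \<in> B") using e by (simp add: B_def dist_norm norm_mult)
    have "\<not> G constant_on B"
    proof
      assume "G constant_on B"
      then have "G ?w = G (complex_of_real r0)" using up rB unfolding constant_on_def by metis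
      then show False using Gup[OF up] G0 e by simp
    qed
    then have "open (G ` B)" using open_mapping_thm[OF holG oB cB oB order_refl] by blast
    moreover have "0 \<in> G ` B" using G0 rB by (metis image_eqI)
    ultimately obtain k where k: "k > 0" "ball 0 k \<subseteq> G ` B" using open_contains_ball by blast
    have "complex_of_real (- k / 2) \<in> ball 0 k" using k by (simp add: norm_divide)
    then obtain z where "z \<in> B" "G z = complex_of_real (- k / 2)" using k by (metis imageE subsetD)
    then show False using Gre[of z] k by simp
  qed
  then have dnz: "deriv (Phi u_int t) (complex_of_real r0) \<noteq> 0"
    using DERIV_imp_deriv[OF Phi_deriv[OF e2 far[OF rB]]] by (simp add: G_def)
  have holP: "Phi u_int t holomorphic_on B" unfolding Phi_def by (intro holomorphic_intros holu)
  obtain k where k: "k > 0" "ball (complex_of_real r0) k \<subseteq> B" "inj_on (Phi u_int t) (ball (complex_of_real r0) k)"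
    using has_complex_derivative_locally_invertible[OF holP rB oB dnz] by metis
  define W where "W = ball (complex_of_real r0) k"
  have WB: "W \<subseteq> B" using k by (simp add: W_def)
  have gr0: "curve r0 = complex_of_real r0" using A0[of r0] e by (simp add: curve_def)
  have low: "Im (Phi u_int t z) < 0" if "z \<in> B" "Im z < 0" for z
    using Im_Phi_pos[OF upO[OF cnjB[OF that(1)]]] that Phi_cnj[of z] by simp
  have real: "Im (Phi u_int t z) = 0" if "Im z = 0" for z
  proof -
    have "z = complex_of_real (Re z)" using that by (simp add: complex_eq_iff)
    then have "Im (u_int z) = 0" using u_int_real by metis
    then show ?thesis using that by (simp add: Phi_def Im_exp)
  qed
  have "local_patch r0 W" unfolding local_patch_def
  proof (intro conjI ballI impI)
    show "open W" "curve r0 \<in> W" using k gr0 by (simp_all add: W_def)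
    show "0 \<notin> W" using near[of 0] WB e by auto
    show "u_int holomorphic_on W" using holu WB by (rule holomorphic_on_subset)
    show "inj_on (Phi u_int t) W" using k by (simp add: W_def)
    show "z \<in> Omega_t u t" if "z \<in> W" "Im (Phi u_int t z) > 0" for z
      using low[of z] real[of z] upO[of z] that WB by (cases "Im z" "0::real" rule: linorder_cases) auto
    show "z = curve (norm z)" if z: "z \<in> W" "Im (Phi u_int t z) = 0" for z
    proof -
      have zB: "z \<in> B" using z WB by auto
      have "Im z = 0" using low[OF zB] Im_Phi_pos[OF upO[OF zB]] z by (cases "Im z" "0::real" rule: linorder_cases) auto
      moreover have "Re z > 0"
      proof -
        have "\<bar>Re (z - complex_of_real r0)\<bar> \<le> norm (z - complex_of_real r0)" by (rule abs_Re_le_cmod)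
        also have "\<dots> < e" using zB e by (simp add: B_def dist_norm norm_minus_commute)
        finally show ?thesis using e by simp
      qed
      ultimately have "z = complex_of_real (norm z)" by (simp add: complex_eq_iff cmod_def)
      then show ?thesis using A0[OF near[OF zB]] by (simp add: curve_def)
    qed
    show "W \<subseteq> {z. Im z > 0}" if "A r0 > 0" using that A0[of r0] e by simp
  qed
  then show ?thesis by blast
qed

lemma regular_patch: "regular r0 \<Longrightarrow> \<exists>W. local_patch r0 W"
  unfolding regular_def using local_patch_curved local_patch_flat by blast

end

context free_power
begin

text \<open>If \<open>h\<close> were constant on an interval, \<open>\<Phi>\<close> would be constant along the curve near a regular
  point, where it is injective.\<close>

lemma h_strict_mono:
  assumes r: "0 < r1" "r1 < r2" shows "h r1 < h r2"
proof (rule ccontr)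
  assume "\<not> h r1 < h r2"
  then have eq: "h r1 = h r2" using h_mono[OF r] by simp
  have const: "h x = h r1" if "r1 \<le> x" "x \<le> r2" for x
    using h_mono[of r1 x] h_mono[of x r2] that r eq by (cases "x = r1"; cases "x = r2") auto
  obtain r0 where r0: "r1 < r0" "r0 < r2" "regular r0" using ex_regular[OF r] by blast
  obtain W where W: "local_patch r0 W" using regular_patch[OF r0(3)] by blast
  have p: "r0 > 0" using r r0 by simp
  have "\<forall>\<^sub>F x in at r0. curve x \<in> W"
    using isCont_curve[OF p] W unfolding isCont_def local_patch_def by (intro topological_tendstoD) auto
  moreover have "\<forall>\<^sub>F x in at r0. r1 < x" "\<forall>\<^sub>F x in at r0. x < r2"
    using r0 by (auto intro: order_tendstoD[OF tendsto_ident_at])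
  moreover have "\<forall>\<^sub>F x in at r0. x \<noteq> r0" by (simp add: eventually_at_filter)
  ultimately have "\<forall>\<^sub>F x in at r0. curve x \<in> W \<and> r1 < x \<and> x < r2 \<and> x \<noteq> r0" by eventually_elim auto
  then obtain x where x: "curve x \<in> W" "r1 < x" "x < r2" "x \<noteq> r0"
    using eventually_happens[of _ "at r0"] by auto
  have "Phi u_int t (curve x) = Phi u_int t (curve r0)"
    using Phi_curve[of x] Phi_curve[OF p] const[of x] const[of r0] x r0 r by simp
  then have "curve x = curve r0" using W x unfolding local_patch_def inj_on_def by blast
  then have "norm (curve x) = norm (curve r0)" by simp
  then show False using x r p by (simp add: curve_def)
qed

text \<open>The transform \<open>\<eta>\<^sub>\<mu>\<close> expressed through \<open>u\<close>; unlike \<open>\<eta>\<^sub>\<mu>\<close> itself it is analytic across gaps of \<open>\<rho>\<close>.\<close>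

definition eta_ext :: "complex \<Rightarrow> complex" where "eta_ext z = z * exp (- u_int z)"

lemma eta_eq_ext: "Im z > 0 \<Longrightarrow> eta_transform \<mu> z = eta_ext z"
proof -
  assume z: "Im z > 0"
  have "exp (u_int z) = z / eta_transform \<mu> z"
    using logk slit_plane_upper[OF z] u_eq_u_int[OF slit_plane_upper[OF z]] unfolding is_log_kappa_def kappa_def by metis
  moreover have "eta_transform \<mu> z \<noteq> 0" using m.Im_eta_pos[OF z] by auto
  ultimately show ?thesis by (simp add: eta_ext_def exp_minus field_simps)
qed

text \<open>Compose \<open>eta_ext\<close> with a local inverse of \<open>\<Phi>\<close>; the functional equation says that this continues
  \<open>\<eta>\<^sub>\<nu>\<close> across the real axis.\<close>

lemma regular_extension:
  assumes r0: "regular r0"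
  obtains d E where "d > 0" "E holomorphic_on ball (of_real (h r0)) d"
    "\<And>\<zeta>. \<zeta> \<in> ball (of_real (h r0)) d \<Longrightarrow> Im \<zeta> > 0 \<Longrightarrow> eta_transform \<nu> \<zeta> = E \<zeta>"
    "\<And>x. of_real x \<in> ball (complex_of_real (h r0)) d \<Longrightarrow> \<exists>r>0. x = h r \<and> E (of_real x) = eta_ext (curve r) \<and> (A r0 > 0 \<longrightarrow> A r > 0)"
proof -
  obtain W where W: "local_patch r0 W" using regular_patch[OF r0] by blast
  have p: "r0 > 0" using r0 by (simp add: regular_def)
  have Wp: "open W" "curve r0 \<in> W" "0 \<notin> W" "u_int holomorphic_on W" "inj_on (Phi u_int t) W"
     "\<And>z. z \<in> W \<Longrightarrow> Im (Phi u_int t z) > 0 \<Longrightarrow> z \<in> Omega_t u t"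
     "\<And>z. z \<in> W \<Longrightarrow> Im (Phi u_int t z) = 0 \<Longrightarrow> z = curve (norm z)"
     "A r0 > 0 \<Longrightarrow> W \<subseteq> {z. Im z > 0}" using W unfolding local_patch_def by auto
  have holP: "Phi u_int t holomorphic_on W" unfolding Phi_def by (intro holomorphic_intros Wp)
  obtain g where g: "g holomorphic_on (Phi u_int t ` W)" "\<And>z. z \<in> W \<Longrightarrow> g (Phi u_int t z) = z"
    using holomorphic_has_inverse[OF holP Wp(1,5)] by metis
  have "open (Phi u_int t ` W)" by (rule open_mapping_thm3[OF holP Wp(1,5)])
  moreover have "complex_of_real (h r0) \<in> Phi u_int t ` W" using Phi_curve[OF p] Wp(2) by (metis image_eqI)
  ultimately obtain d where d: "d > 0" "ball (of_real (h r0)) d \<subseteq> Phi u_int t ` W" using open_contains_ball by blast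
  have gW: "g ` (Phi u_int t ` W) \<subseteq> W" using g by auto
  show thesis
  proof (rule that[of d "\<lambda>\<zeta>. eta_ext (g \<zeta>)"])
    have "(\<lambda>\<zeta>. u_int (g \<zeta>)) holomorphic_on (Phi u_int t ` W)"
      by (rule holomorphic_on_compose_gen[OF g(1) Wp(4) gW, unfolded o_def])
    then have "(\<lambda>\<zeta>. eta_ext (g \<zeta>)) holomorphic_on (Phi u_int t ` W)" unfolding eta_ext_def by (intro holomorphic_intros g(1))
    then show "(\<lambda>\<zeta>. eta_ext (g \<zeta>)) holomorphic_on ball (of_real (h r0)) d" using d(2) by (rule holomorphic_on_subset)
    show "eta_transform \<nu> \<zeta> = eta_ext (g \<zeta>)" if zb: "\<zeta> \<in> ball (of_real (h r0)) d" and iz: "Im \<zeta> > 0" for \<zeta>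
    proof -
      obtain z where z: "z \<in> W" "\<zeta> = Phi u_int t z" using d(2) zb by auto
      have "z \<in> Omega_t u t" using Wp(6) z iz by auto
      then have "eta_transform \<nu> (Phi u_int t z) = eta_transform \<mu> z" "Im z > 0" using eta_Phi Omega_iff by auto
      then show ?thesis using eta_eq_ext z g(2) by simp
    qed
    show "\<exists>r>0. x = h r \<and> eta_ext (g (of_real x)) = eta_ext (curve r) \<and> (A r0 > 0 \<longrightarrow> A r > 0)"
      if x: "of_real x \<in> ball (complex_of_real (h r0)) d" for x
    proof -
      obtain z where z: "z \<in> W" "of_real x = Phi u_int t z" using subsetD[OF d(2) x] by blast
      have "Im (Phi u_int t z) = 0" unfolding z(2)[symmetric] by simp
      then have zg: "z = curve (norm z)" using Wp(7) z by blast
      have pz: "norm z > 0" using z Wp(3) by auto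
      have "complex_of_real x = of_real (h (norm z))" using Phi_curve[OF pz] zg z(2) by metis
      then have "x = h (norm z)" by (simp only: of_real_eq_iff)
      moreover have "g (of_real x) = z" using g(2) z by simp
      moreover have "A (norm z) > 0" if "A r0 > 0"
      proof -
        have "Im (curve (norm z)) > 0" using Wp(8)[OF that] z zg by auto
        then have "A (norm z) \<noteq> 0" by (auto simp: curve_def)
        then show ?thesis using A_bounds[OF pz] by simp
      qed
      ultimately show ?thesis using pz zg by metis
    qed
  qed (rule d(1))
qed

end

section \<open>The density\<close>

context free_power
begin

lemma h_inj: "inj_on h {0<..}"
  by (rule inj_onI) (metis greaterThan_iff h_strict_mono less_irrefl linorder_neqE_linordered_idom)

text \<open>On \<open>V\<^sub>t\<close> the point of the curve lies off the slit, where \<open>u\<close> and \<open>\<Phi>\<close> are continuous, and it is an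
  accumulation point of \<open>\<Omega>\<^sub>t\<close>; hence the limits in \<open>boundary_value\<close> are values.\<close>

lemma boundary_limits:
  assumes r: "r \<in> V_plus \<rho> t"
  shows "h_fun u t r = h r" "l_fun u t r = r * exp (- Re (u_int (curve r)))"
proof -
  have p: "r > 0" "A r > 0" "A r < pi" using r V_plus_iff A_bounds by auto
  have z: "curve r \<in> slit_plane" unfolding curve_def using p by (intro rcis_in_slit)
  have lp: "curve r islimpt Omega_t u t"
  proof (rule islimptI)
    fix T assume T: "curve r \<in> T" "open T"
    have "isCont (rcis r) (A r)" by (intro continuous_intros)
    then have "\<forall>\<^sub>F \<theta> in at (A r). rcis r \<theta> \<in> T" using T unfolding isCont_def curve_def by (intro topological_tendstoD)
    then have "\<forall>\<^sub>F \<theta> in at_right (A r). rcis r \<theta> \<in> T" by (rule filter_leD[rotated]) (simp add: at_le)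
    moreover have "\<forall>\<^sub>F x in at_right (A r). A r < x \<and> x < pi"
      using p by (auto simp: eventually_at_right_field intro!: exI[of _ pi])
    ultimately have "\<forall>\<^sub>F x in at_right (A r). rcis r x \<in> T \<and> A r < x \<and> x < pi" by eventually_elim auto
    then obtain x where x: "rcis r x \<in> T" "A r < x" "x < pi"
      using eventually_happens[of _ "at_right (A r)"] by auto
    have "rcis r x \<noteq> curve r"
    proof
      assume "rcis r x = curve r"
      then have "Arg (rcis r x) = Arg (rcis r (A r))" by (simp add: curve_def)
      then show False using x p by (simp add: Arg_rcis)
    qed
    then show "\<exists>y\<in>Omega_t u t. y \<in> T \<and> y \<noteq> curve r" using rcis_in_Omega[OF p(1) x(2,3)] x(1) by blast
  qed
  then have nt: "at (curve r) within Omega_t u t \<noteq> bot" using trivial_limit_within by blast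
  have bv: "boundary_value u t f r = f' (curve r)" if "isCont f' (curve r)" "\<And>z. z \<in> slit_plane \<Longrightarrow> f z = f' z" for f f'
  proof -
    have "(f' \<longlongrightarrow> f' (curve r)) (at (curve r) within Omega_t u t)"
      using that(1) continuous_at_imp_continuous_at_within continuous_within by blast
    then have "(f \<longlongrightarrow> f' (curve r)) (at (curve r) within Omega_t u t)"
      by (rule Lim_transform_eventually)
         (use that(2) slit_plane_upper Omega_iff in \<open>auto simp: eventually_at_filter\<close>)
    then show ?thesis unfolding boundary_value_def curve_def[symmetric] by (rule tendsto_Lim[OF nt])
  qed
  have cP: "isCont (Phi u_int t) (curve r)"
    using holomorphic_on_imp_continuous_on[OF Phi_holomorphic] open_slit_plane z
    by (simp add: continuous_on_eq_continuous_at)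
  have "boundary_value u t (Phi u t) r = Phi u_int t (curve r)" by (rule bv[OF cP Phi_u])
  then show "h_fun u t r = h r" unfolding h_fun_def by (simp add: Phi_curve[OF p(1)])
  have "boundary_value u t u r = u_int (curve r)" by (rule bv[OF continuous_u_int_slit[OF z] u_eq_u_int])
  then show "l_fun u t r = r * exp (- Re (u_int (curve r)))" by (simp add: l_fun_def)
qed

lemma S_set_eq: "S_set u \<rho> t = (\<lambda>r. 1 / h r) ` V_plus \<rho> t"
  unfolding S_set_def using boundary_limits(1) by (auto simp: image_iff)

definition density_formula :: "real \<Rightarrow> real" where
  "density_formula r = 1 / pi * (h_fun u t r * l_fun u t r * sin (theta_fun u t r) /
                    (1 - 2 * l_fun u t r * cos (theta_fun u t r) + (l_fun u t r)\<^sup>2))"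

text \<open>The boundary equation \<open>- q Im u = A\<close> turns the argument \<open>A - Im u\<close> into \<open>A + A / q = t A / (t - 1)\<close>.\<close>

lemma eta_ext_curve:
  assumes r: "r \<in> V_plus \<rho> t"
  shows "eta_ext (curve r) = rcis (l_fun u t r) (theta_fun u t r)" "Im (eta_ext (curve r)) > 0"
proof -
  have p: "r > 0" "A r > 0" "A r < pi" using r V_plus_iff A_bounds by auto
  have "- q * Im (u_int (curve r)) = A r" using arg_loss_at_A[OF p(1,2)] by (simp add: arg_loss_def curve_def)
  then have im: "- Im (u_int (curve r)) = A r / q" using q by (simp add: field_simps)
  have th: "A r - Im (u_int (curve r)) = theta_fun u t r"
    unfolding theta_fun_def using im q by (simp add: field_simps)
  have "exp (- u_int (curve r)) = rcis (exp (- Re (u_int (curve r)))) (- Im (u_int (curve r)))"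
    by (simp add: rcis_def exp_eq_polar)
  then have "eta_ext (curve r) = rcis (r * exp (- Re (u_int (curve r)))) (A r - Im (u_int (curve r)))"
    unfolding eta_ext_def by (simp add: curve_def rcis_mult)
  then show "eta_ext (curve r) = rcis (l_fun u t r) (theta_fun u t r)" unfolding th boundary_limits(2)[OF r] .
  have "Im (curve r) > 0" unfolding curve_def using p by (simp add: sin_gt_zero)
  then show "Im (eta_ext (curve r)) > 0" using eta_eq_ext m.Im_eta_pos by metis
qed

lemma Im_resolvent:
  "Im (of_real c / (1 - rcis l \<theta>)) = c * l * sin \<theta> / (1 - 2 * l * cos \<theta> + l^2)"
proof -
  have "1 - 2 * l * cos \<theta> + l^2 = (1 - l * cos \<theta>)^2 + (l * sin \<theta>)^2"
  proof -
    have "(1 - l * cos \<theta>)^2 + (l * sin \<theta>)^2 = 1 - 2 * l * cos \<theta> + l^2 * ((sin \<theta>)^2 + (cos \<theta>)^2)" by algebra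
    then show ?thesis by simp
  qed
  then show ?thesis by (simp add: Im_divide)
qed

lemma density_formula_eq:
  assumes r: "r \<in> V_plus \<rho> t"
  shows "Im (of_real (h r) / (1 - eta_ext (curve r))) / pi = density_formula r" "density_formula r > 0"
proof -
  have p: "r > 0" using r V_plus_iff by auto
  show eq: "Im (of_real (h r) / (1 - eta_ext (curve r))) / pi = density_formula r"
    unfolding eta_ext_curve(1)[OF r] Im_resolvent density_formula_def boundary_limits(1)[OF r] by simp
  have ne: "1 - eta_ext (curve r) \<noteq> 0" using eta_ext_curve(2)[OF r] by auto
  have "Im (of_real (h r) / (1 - eta_ext (curve r))) = h r * Im (eta_ext (curve r)) / (norm (1 - eta_ext (curve r)))^2"
    by (simp add: Im_divide cmod_power2)
  also have "\<dots> > 0" using h_pos[OF p] eta_ext_curve(2)[OF r] ne by (intro divide_pos_pos mult_pos_pos) auto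
  finally show "density_formula r > 0" unfolding eq[symmetric] by simp
qed

text \<open>An analytic continuation \<open>E\<close> of \<open>\<eta>\<^sub>\<nu>\<close> across a point where \<open>E \<noteq> 1\<close> continues the Cauchy transform
  of \<open>\<nu>\<close> across the inverted point, which lies below the axis when the original point lies above.\<close>

lemma stieltjes_eta:
  assumes h0: "h0 > 0" and E: "E holomorphic_on ball (complex_of_real h0) d"
    and eE: "\<And>\<zeta>. \<zeta> \<in> ball (of_real h0) d \<Longrightarrow> Im \<zeta> > 0 \<Longrightarrow> eta_transform \<nu> \<zeta> = E \<zeta>"
    and x1: "x1 > 0" "of_real (1 / x1) \<in> ball (complex_of_real h0) d" "E (of_real (1 / x1)) \<noteq> 1"
  shows "\<exists>e H. e > 0 \<and> H holomorphic_on ball (of_real x1) (2 * e) \<and>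
    (\<forall>x. \<bar>x - x1\<bar> < 2 * e \<longrightarrow> x > 0 \<and> of_real (1 / x) \<in> ball (complex_of_real h0) d \<and>
        H (of_real x) = of_real (1 / x) / (1 - E (of_real (1 / x)))) \<and>
    (\<forall>B\<in>sets borel. B \<subseteq> {x1-e<..<x1+e} \<longrightarrow>
       emeasure \<nu> B = (\<integral>\<^sup>+x\<in>B. ennreal (Im (H (of_real x)) / pi) \<partial>lborel))"
proof -
  define D where "D = ball (complex_of_real h0) d"
  define H where "H w = (1 / w) / (1 - E (1 / w))" for w
  define U0 where "U0 = {w::complex. Re w > 0} \<inter> (\<lambda>w. 1 / w) -` D"
  have oU0: "open U0" unfolding U0_def D_def
    by (intro continuous_open_preimage continuous_intros) (auto simp: open_halfspace_Re_gt)
  have invc: "(\<lambda>w. 1 / w) holomorphic_on U0" by (intro holomorphic_intros) (auto simp: U0_def)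
  have Ei: "(\<lambda>w. E (1 / w)) holomorphic_on U0"
    by (rule holomorphic_on_compose_gen[OF invc E[folded D_def], unfolded o_def]) (auto simp: U0_def)
  define U where "U = U0 \<inter> (\<lambda>w. E (1 / w)) -` (- {1})"
  have oU: "open U" unfolding U_def
    by (intro continuous_open_preimage holomorphic_on_imp_continuous_on Ei oU0) auto
  have x1U: "complex_of_real x1 \<in> U" using x1 by (simp add: U_def U0_def D_def)
  obtain k where k: "k > 0" "ball (complex_of_real x1) k \<subseteq> U" using oU x1U open_contains_ball by blast
  have holH: "H holomorphic_on U" unfolding H_def
    by (intro holomorphic_intros holomorphic_on_subset[OF Ei]) (auto simp: U_def U0_def)
  define e where "e = k / 2"
  have e: "e > 0" "2 * e = k" using k by (auto simp: e_def)
  have hb: "H holomorphic_on ball (of_real x1) (2 * e)" unfolding e by (rule holomorphic_on_subset[OF holH k(2)])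
  have HC: "cauchy_tr \<nu> w = H w" if "w \<in> ball (of_real x1) (2 * e)" "Im w < 0" for w
  proof -
    have wU: "w \<in> U" using that k e by auto
    have iw: "Im (1 / w) > 0" using that(2) by (simp add: Im_divide divide_neg_pos sum_power2_gt_zero_iff)
    have "cauchy_tr \<nu> (1 / (1 / w)) = (1 / w) / (1 - eta_transform \<nu> (1 / w))"
      by (rule n.cauchy_tr_eta[OF slit_plane_upper[OF iw]])
    also have "eta_transform \<nu> (1 / w) = E (1 / w)"
      using wU iw by (intro eE) (auto simp: U_def U0_def D_def)
    finally show ?thesis by (simp add: H_def)
  qed
  note st = stieltjes_local[OF n.finite_measure_axioms n.sets_M e(1) holomorphic_on_imp_continuous_on[OF hb] HC]
  have "x > 0 \<and> of_real (1 / x) \<in> ball (complex_of_real h0) d \<and>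
        H (of_real x) = of_real (1 / x) / (1 - E (of_real (1 / x)))" if "\<bar>x - x1\<bar> < 2 * e" for x
  proof -
    have "complex_of_real x \<in> ball (of_real x1) k" using that e by (simp add: dist_real_def abs_minus_commute)
    then have "complex_of_real x \<in> U" using k by auto
    then show ?thesis by (simp add: U_def U0_def D_def H_def)
  qed
  then show ?thesis using e(1) hb st(2) by blast
qed

definition ac_density_fun :: "real \<Rightarrow> real" where "ac_density_fun x = density_formula (the_inv_into {0<..} h (1 / x))"

lemma ac_density_fun_eq: "r \<in> V_plus \<rho> t \<Longrightarrow> ac_density_fun (1 / h r) = density_formula r"
  unfolding ac_density_fun_def using V_plus_iff by (simp add: the_inv_into_f_f[OF h_inj])

text \<open>Near a point of \<open>S\<^sub>t\<close> all real points are \<open>1 / h r\<close> with \<open>r \<in> V\<^sub>t\<close>, and there \<open>\<eta>\<^sub>\<nu>\<close> extends with a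
  value of positive imaginary part, in particular different from \<open>1\<close>.\<close>

lemma density_local:
  assumes "x0 \<in> S_set u \<rho> t"
  shows "\<exists>e H. e > 0 \<and> H holomorphic_on ball (of_real x0) (2 * e) \<and>
    (\<forall>x. \<bar>x - x0\<bar> < 2 * e \<longrightarrow> x \<in> S_set u \<rho> t \<and> ac_density_fun x = Im (H (of_real x)) / pi \<and> ac_density_fun x > 0) \<and>
    (\<forall>B\<in>sets borel. B \<subseteq> {x0-e<..<x0+e} \<longrightarrow> emeasure \<nu> B = (\<integral>\<^sup>+x\<in>B. ennreal (ac_density_fun x) \<partial>lborel))"
proof -
  obtain r0 where r0: "r0 \<in> V_plus \<rho> t" "x0 = 1 / h r0" using assms unfolding S_set_eq by auto
  have p: "r0 > 0" "A r0 > 0" using r0 V_plus_iff by auto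
  have hp: "h r0 > 0" using h_pos[OF p(1)] .
  have reg: "regular r0" using p by (simp add: regular_def)
  obtain d E where E: "d > 0" "E holomorphic_on ball (of_real (h r0)) d"
    "\<And>\<zeta>. \<zeta> \<in> ball (of_real (h r0)) d \<Longrightarrow> Im \<zeta> > 0 \<Longrightarrow> eta_transform \<nu> \<zeta> = E \<zeta>"
    "\<And>x. of_real x \<in> ball (complex_of_real (h r0)) d \<Longrightarrow> \<exists>r>0. x = h r \<and> E (of_real x) = eta_ext (curve r) \<and> (A r0 > 0 \<longrightarrow> A r > 0)"
    using regular_extension[OF reg] by metis
  have real: "\<exists>r\<in>V_plus \<rho> t. x = h r \<and> E (of_real x) = eta_ext (curve r)" if "of_real x \<in> ball (complex_of_real (h r0)) d" for x
    using E(4)[OF that] p V_plus_iff by blast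
  have c: "complex_of_real (1 / x0) \<in> ball (complex_of_real (h r0)) d" using r0 E(1) hp by simp
  have x0p: "x0 > 0" using r0 hp by simp
  have E1: "E (of_real (1 / x0)) \<noteq> 1"
  proof -
    obtain r where "r \<in> V_plus \<rho> t" "E (of_real (1 / x0)) = eta_ext (curve r)" using real[OF c] by blast
    then show ?thesis using eta_ext_curve(2) by force
  qed
  have "\<exists>e H. e > 0 \<and> H holomorphic_on ball (of_real x0) (2 * e) \<and>
    (\<forall>x. \<bar>x - x0\<bar> < 2 * e \<longrightarrow> x > 0 \<and> of_real (1 / x) \<in> ball (complex_of_real (h r0)) d \<and>
        H (of_real x) = of_real (1 / x) / (1 - E (of_real (1 / x)))) \<and>
    (\<forall>B\<in>sets borel. B \<subseteq> {x0-e<..<x0+e} \<longrightarrow>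
       emeasure \<nu> B = (\<integral>\<^sup>+x\<in>B. ennreal (Im (H (of_real x)) / pi) \<partial>lborel))"
    by (rule stieltjes_eta[OF hp E(2,3) x0p c E1])
  then obtain e H where H: "e > 0" "H holomorphic_on ball (of_real x0) (2 * e)"
    "\<And>x. \<bar>x - x0\<bar> < 2 * e \<Longrightarrow> x > 0 \<and> of_real (1 / x) \<in> ball (complex_of_real (h r0)) d \<and>
        H (of_real x) = of_real (1 / x) / (1 - E (of_real (1 / x)))"
    "\<And>B. B \<in> sets borel \<Longrightarrow> B \<subseteq> {x0-e<..<x0+e} \<Longrightarrow>
       emeasure \<nu> B = (\<integral>\<^sup>+x\<in>B. ennreal (Im (H (of_real x)) / pi) \<partial>lborel)"
    by auto
  have loc: "x \<in> S_set u \<rho> t \<and> ac_density_fun x = Im (H (of_real x)) / pi \<and> ac_density_fun x > 0" if "\<bar>x - x0\<bar> < 2 * e" for x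
  proof -
    note Hx = H(3)[OF that]
    have "\<exists>r\<in>V_plus \<rho> t. 1 / x = h r \<and> E (of_real (1 / x)) = eta_ext (curve r)"
      by (rule real) (use Hx in blast)
    then obtain r where r: "r \<in> V_plus \<rho> t" "1 / x = h r" "E (of_real (1 / x)) = eta_ext (curve r)" by blast
    have x: "x = 1 / h r" unfolding r(2)[symmetric] by simp
    have "H (of_real x) = of_real (1 / x) / (1 - E (of_real (1 / x)))" using Hx by blast
    then have "H (of_real x) = of_real (h r) / (1 - eta_ext (curve r))" unfolding r(3) unfolding r(2) .
    then have D: "Im (H (of_real x)) / pi = density_formula r" using density_formula_eq(1)[OF r(1)] by simp
    have "ac_density_fun x = density_formula r" using ac_density_fun_eq[OF r(1)] unfolding x .
    moreover have "x \<in> S_set u \<rho> t" unfolding S_set_eq x using r(1) by (rule imageI)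
    ultimately show ?thesis using D density_formula_eq(2)[OF r(1)] by simp
  qed
  have "emeasure \<nu> B = (\<integral>\<^sup>+x\<in>B. ennreal (ac_density_fun x) \<partial>lborel)" if B: "B \<in> sets borel" "B \<subseteq> {x0-e<..<x0+e}" for B
  proof -
    have "ennreal (Im (H (of_real x)) / pi) * indicator B x = ennreal (ac_density_fun x) * indicator B x" for x
      using loc[of x] B(2) H(1) by (cases "x \<in> B") (auto simp: abs_less_iff subset_iff)
    then show ?thesis using H(4)[OF B] by simp
  qed
  then show ?thesis using H(1,2) loc by blast
qed

lemma open_S: "open (S_set u \<rho> t)"
  unfolding open_dist
proof
  fix x0 assume "x0 \<in> S_set u \<rho> t"
  then obtain e where "e > 0" "\<And>x. \<bar>x - x0\<bar> < 2 * e \<Longrightarrow> x \<in> S_set u \<rho> t" using density_local[of x0] by blast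
  then show "\<exists>e>0. \<forall>y. dist y x0 < e \<longrightarrow> y \<in> S_set u \<rho> t"
    by (intro exI[of _ "2 * e"]) (auto simp: dist_real_def)
qed

text \<open>The density is locally the imaginary part of an analytic function; its power series has the imaginary
  parts of the coefficients.\<close>

lemma ac_density_fun_real_analytic:
  assumes "\<And>x. x \<in> S_set u \<rho> t \<Longrightarrow> f x = ac_density_fun x"
  shows "real_analytic_on f (S_set u \<rho> t)"
  unfolding real_analytic_on_def
proof
  fix x0 assume "x0 \<in> S_set u \<rho> t"
  then obtain e H where H: "e > 0" "H holomorphic_on ball (of_real x0) (2 * e)"
    "\<And>x. \<bar>x - x0\<bar> < 2 * e \<Longrightarrow> x \<in> S_set u \<rho> t \<and> ac_density_fun x = Im (H (of_real x)) / pi \<and> ac_density_fun x > 0" using density_local[of x0] by auto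
  define c where "c n = (deriv ^^ n) H (of_real x0) / (fact n)" for n
  have "(\<lambda>n. Im (c n) / pi * (y - x0) ^ n) sums f y" if y: "y \<in> ball x0 (2 * e)" for y
  proof -
    have "complex_of_real y \<in> ball (of_real x0) (2 * e)" using y by simp
    then have "(\<lambda>n. c n * (of_real y - of_real x0) ^ n) sums H (of_real y)"
      unfolding c_def by (rule holomorphic_power_series[OF H(2)])
    then have "(\<lambda>n. Im (c n * (of_real y - of_real x0) ^ n)) sums Im (H (of_real y))" by (rule sums_Im)
    moreover have "Im (c n * (of_real y - of_real x0) ^ n) = Im (c n) * (y - x0) ^ n" for n
      by (simp flip: of_real_diff of_real_power)
    ultimately have "(\<lambda>n. Im (c n) * (y - x0) ^ n) sums Im (H (of_real y))" by simp
    then have "(\<lambda>n. Im (c n) * (y - x0) ^ n / pi) sums (Im (H (of_real y)) / pi)" by (rule sums_divide)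
    moreover have "\<bar>y - x0\<bar> < 2 * e" using y by (simp add: dist_real_def abs_minus_commute)
    then have "Im (H (of_real y)) / pi = f y" using H(3)[of y] assms[of y] by simp
    ultimately show ?thesis by simp
  qed
  then show "\<exists>e>0. \<exists>c. \<forall>y\<in>ball x0 e. (\<lambda>n. c n * (y - x0) ^ n) sums f y"
    using H(1) by (intro exI[of _ "2 * e"] conjI exI[of _ "\<lambda>n. Im (c n) / pi"]) auto
qed

lemma ac_density_fun_continuous: "continuous_on (S_set u \<rho> t) ac_density_fun"
proof (rule continuous_at_imp_continuous_on, rule ballI)
  fix x0 assume "x0 \<in> S_set u \<rho> t"
  then obtain e H where H: "e > 0" "H holomorphic_on ball (of_real x0) (2 * e)"
    "\<And>x. \<bar>x - x0\<bar> < 2 * e \<Longrightarrow> x \<in> S_set u \<rho> t \<and> ac_density_fun x = Im (H (of_real x)) / pi \<and> ac_density_fun x > 0" using density_local[of x0] by auto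
  have "isCont H (of_real x0)" using holomorphic_on_imp_continuous_on[OF H(2)] H(1) by (simp add: continuous_on_eq_continuous_at)
  then have "isCont (\<lambda>x. Im (H (of_real x)) / pi) x0"
    by (intro continuous_intros isCont_Im isCont_o2[where f = of_real and g = H]) auto
  moreover have "\<forall>\<^sub>F x in nhds x0. ac_density_fun x = Im (H (of_real x)) / pi"
    using H(1,3) by (intro eventually_nhds_metric[THEN iffD2] exI[of _ "2 * e"]) (auto simp: dist_real_def)
  ultimately show "isCont ac_density_fun x0" using isCont_cong by metis
qed

end

section \<open>The absolutely continuous part and its support\<close>

context free_power
begin

lemma ac_nu:
  shows "sets (ac_part \<nu>) = sets borel" "absolutely_continuous lborel (ac_part \<nu>)"
    "\<And>B. B \<in> sets borel \<Longrightarrow> emeasure (ac_part \<nu>) B \<le> emeasure \<nu> B"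
    "\<exists>N\<in>null_sets lborel. \<forall>B\<in>sets borel. emeasure (ac_part \<nu>) B = emeasure \<nu> (B - N)"
proof -
  obtain N where N: "N \<in> null_sets lborel" "sets (ac_part \<nu>) = sets borel"
    "absolutely_continuous lborel (ac_part \<nu>)"
    "\<And>B. B \<in> sets borel \<Longrightarrow> emeasure (ac_part \<nu>) B = emeasure \<nu> (B - N)"
    using ac_part_finite[OF n.finite_measure_axioms n.sets_M] by blast
  show "sets (ac_part \<nu>) = sets borel" "absolutely_continuous lborel (ac_part \<nu>)" by fact+
  show "emeasure (ac_part \<nu>) B \<le> emeasure \<nu> B" if "B \<in> sets borel" for B
    unfolding N(4)[OF that] using that N(1) n.sets_M by (intro emeasure_mono) auto
  show "\<exists>N\<in>null_sets lborel. \<forall>B\<in>sets borel. emeasure (ac_part \<nu>) B = emeasure \<nu> (B - N)" using N by blast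
qed

lemma ac_nu_null: "emeasure lborel B = 0 \<Longrightarrow> B \<in> sets borel \<Longrightarrow> emeasure (ac_part \<nu>) B = 0"
  using ac_nu(2) unfolding absolutely_continuous_def by (auto simp: null_sets_def)

text \<open>Such a point is \<open>1 / h r0\<close> with \<open>A = 0\<close> near \<open>r0\<close>. The continuation \<open>E\<close> of \<open>\<eta>\<^sub>\<nu>\<close> is real on the real axis,
  so the density vanishes wherever \<open>E \<noteq> 1\<close>. Since \<open>\<eta>\<^sub>\<nu>\<close> never takes the value \<open>1\<close> in the upper half-plane,
  \<open>E\<close> is not constantly \<open>1\<close>, so the exceptional points are isolated, and a single point is a null set for
  the absolutely continuous part.\<close>

lemma flat_null:
  assumes x0: "x0 > 0" "x0 \<notin> closure (S_set u \<rho> t)"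
  shows "\<exists>U. open U \<and> x0 \<in> U \<and> emeasure (ac_part \<nu>) U = 0"
proof -
  let ?Cl = "closure (S_set u \<rho> t)"
  obtain r0 where r0: "r0 > 0" "h r0 = 1 / x0" using h_surj[of "1 / x0"] x0 by auto
  have hp: "h r0 > 0" using h_pos[OF r0(1)] .
  have "isCont (\<lambda>r. 1 / h r) r0" using hp r0(1) by (intro continuous_intros isCont_h) auto
  then have "\<forall>\<^sub>F r in at r0. 1 / h r \<in> - ?Cl"
    unfolding isCont_def using x0 r0 by (intro topological_tendstoD) auto
  then obtain \<delta> where \<delta>: "\<delta> > 0" "\<And>r. r \<noteq> r0 \<Longrightarrow> \<bar>r - r0\<bar> < \<delta> \<Longrightarrow> 1 / h r \<notin> ?Cl"
    by (auto simp: eventually_at dist_real_def)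
  have notV: "A r = 0" if "r > 0" "1 / h r \<notin> ?Cl" for r
  proof -
    have "1 / h r \<notin> S_set u \<rho> t" using that(2) closure_subset by blast
    then have "r \<notin> V_plus \<rho> t" unfolding S_set_eq by blast
    then show ?thesis using that(1) V_plus_iff A_bounds[OF that(1)] by force
  qed
  have A0: "A r = 0" if "r > 0" "\<bar>r - r0\<bar> < \<delta>" for r
    using notV[OF that(1)] \<delta>(2)[of r] that x0 r0 by (cases "r = r0") auto
  have reg: "regular r0" using r0 A0 \<delta>(1) unfolding regular_def by blast
  obtain d E where E: "d > 0" "E holomorphic_on ball (of_real (h r0)) d"
    "\<And>\<zeta>. \<zeta> \<in> ball (of_real (h r0)) d \<Longrightarrow> Im \<zeta> > 0 \<Longrightarrow> eta_transform \<nu> \<zeta> = E \<zeta>"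
    "\<And>x. of_real x \<in> ball (complex_of_real (h r0)) d \<Longrightarrow> \<exists>r>0. x = h r \<and> E (of_real x) = eta_ext (curve r) \<and> (A r0 > 0 \<longrightarrow> A r > 0)"
    using regular_extension[OF reg] by metis
  have Ereal: "Im (E (of_real (1 / x))) = 0" if xb: "of_real (1 / x) \<in> ball (complex_of_real (h r0)) d" and xCl: "x \<notin> ?Cl" for x
  proof -
    obtain r where r: "r > 0" "1 / x = h r" "E (of_real (1 / x)) = eta_ext (curve r)" using E(4)[OF xb] by blast
    have "x = 1 / h r" unfolding r(2)[symmetric] by simp
    then have "A r = 0" using notV[OF r(1)] xCl by simp
    then have "curve r = of_real r" by (simp add: curve_def)
    then show ?thesis unfolding r(3) eta_ext_def using u_int_real[of r] by (simp add: Im_exp)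
  qed
  define \<xi> where "\<xi> = complex_of_real (h r0)"
  have "\<exists>k>0. \<forall>\<zeta>\<in>ball \<xi> k. \<zeta> \<noteq> \<xi> \<longrightarrow> E \<zeta> \<noteq> 1"
  proof (cases "E \<xi> = 1")
    case True
    \<comment> \<open>a point of the upper half-plane, where E coincides with eta and cannot equal 1\<close>
    define \<beta> where "\<beta> = \<xi> + \<i> * of_real (d/2)"
    have b: "\<beta> \<in> ball \<xi> d" "Im \<beta> > 0" using E(1) by (simp_all add: \<beta>_def dist_norm norm_mult \<xi>_def)
    have "E \<beta> \<noteq> 1" using n.Im_eta_pos[OF b(2)] E(3)[of \<beta>] b by (auto simp: \<xi>_def)
    then have "E \<beta> - 1 \<noteq> 0" "E \<xi> - 1 = 0" using True by simp_all
    moreover have "(\<lambda>z. E z - 1) holomorphic_on ball \<xi> d" using E(2) unfolding \<xi>_def by (intro holomorphic_intros)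
    ultimately obtain k where "0 < k" "ball \<xi> k \<subseteq> ball \<xi> d" "\<And>z. z \<in> ball \<xi> k - {\<xi>} \<Longrightarrow> E z - 1 \<noteq> 0"
      using isolated_zeros[OF _ open_ball connected_ball, of "\<lambda>z. E z - 1" \<xi> d \<xi> \<beta>] b(1) E(1)
      by (metis centre_in_ball)
    then show ?thesis by (intro exI[of _ k]) auto
  next
    case False
    have "open (ball \<xi> d \<inter> E -` (- {1}))"
      using E(2) unfolding \<xi>_def by (intro continuous_open_preimage holomorphic_on_imp_continuous_on) auto
    moreover have "\<xi> \<in> ball \<xi> d \<inter> E -` (- {1})" using False E(1) by simp
    ultimately obtain k where "k > 0" "ball \<xi> k \<subseteq> ball \<xi> d \<inter> E -` (- {1})" using open_contains_ball by blast
    then show ?thesis by blast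
  qed
  then obtain k where k: "k > 0" "\<And>\<zeta>. \<zeta> \<in> ball \<xi> k \<Longrightarrow> \<zeta> \<noteq> \<xi> \<Longrightarrow> E \<zeta> \<noteq> 1" by blast
  define U where "U = ({0<..} \<inter> (\<lambda>x. complex_of_real (1 / x)) -` (ball \<xi> d \<inter> ball \<xi> k)) \<inter> - ?Cl"
  have "open ({0<..} \<inter> (\<lambda>x. complex_of_real (1 / x)) -` (ball \<xi> d \<inter> ball \<xi> k))"
    by (intro continuous_open_preimage continuous_intros) auto
  then have oU: "open U" unfolding U_def by (rule open_Int) (rule open_Compl, rule closed_closure)
  have "complex_of_real (1 / x0) = \<xi>" by (simp only: \<xi>_def r0(2))
  then have "complex_of_real (1 / x0) \<in> ball \<xi> d \<inter> ball \<xi> k" using k(1) E(1) by (simp del: of_real_divide)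
  then have x0U: "x0 \<in> U" unfolding U_def using x0 by blast
  have "emeasure \<nu> (U - {x0}) = 0"
  proof (rule emeasure_open_eq_0_if_locally_0[OF n.sets_M])
    fix x1 assume "x1 \<in> U - {x0}"
    then have x1: "x1 \<in> U" "x1 \<noteq> x0" by auto
    have x1p: "x1 > 0" and x1b: "complex_of_real (1 / x1) \<in> ball \<xi> d" "complex_of_real (1 / x1) \<in> ball \<xi> k"
      using x1(1) unfolding U_def by blast+
    have "1 / x1 \<noteq> h r0" using x1(2) x1p x0(1) unfolding r0(2) by (simp add: field_simps)
    then have "complex_of_real (1 / x1) \<noteq> \<xi>" unfolding \<xi>_def of_real_eq_iff .
    then have ne: "E (complex_of_real (1 / x1)) \<noteq> 1" using k(2)[OF x1b(2)] by blast
    have "\<exists>e H. e > 0 \<and> H holomorphic_on ball (of_real x1) (2 * e) \<and>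
      (\<forall>x. \<bar>x - x1\<bar> < 2 * e \<longrightarrow> x > 0 \<and> of_real (1 / x) \<in> ball (complex_of_real (h r0)) d \<and>
        H (of_real x) = of_real (1 / x) / (1 - E (of_real (1 / x)))) \<and>
      (\<forall>B\<in>sets borel. B \<subseteq> {x1-e<..<x1+e} \<longrightarrow>
       emeasure \<nu> B = (\<integral>\<^sup>+x\<in>B. ennreal (Im (H (of_real x)) / pi) \<partial>lborel))"
      by (rule stieltjes_eta[OF hp E(2,3) x1p x1b(1)[unfolded \<xi>_def] ne])
    then obtain e H where H: "e > 0" "H holomorphic_on ball (of_real x1) (2 * e)"
       "\<And>x. \<bar>x - x1\<bar> < 2 * e \<Longrightarrow> x > 0 \<and> of_real (1 / x) \<in> ball (complex_of_real (h r0)) d \<and>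
          H (of_real x) = of_real (1 / x) / (1 - E (of_real (1 / x)))"
       "\<And>B. B \<in> sets borel \<Longrightarrow> B \<subseteq> {x1-e<..<x1+e} \<Longrightarrow>
          emeasure \<nu> B = (\<integral>\<^sup>+x\<in>B. ennreal (Im (H (of_real x)) / pi) \<partial>lborel)" by auto
    define B where "B = U \<inter> {x1-e<..<x1+e}"
    have oB: "open B" using oU by (simp add: B_def open_Int)
    have z: "ennreal (Im (H (of_real x)) / pi) * indicator B x = 0" for x
    proof (cases "x \<in> B")
      case True
      then have xU: "x \<in> U" and xe: "\<bar>x - x1\<bar> < 2 * e" using H(1) by (auto simp: B_def)
      have "Im (E (of_real (1 / x))) = 0" by (rule Ereal) (use xU in \<open>unfold U_def \<xi>_def, blast+\<close>)
      moreover have "H (of_real x) = of_real (1 / x) / (1 - E (of_real (1 / x)))" using H(3)[OF xe] by blast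
      ultimately have "Im (H (of_real x)) = 0" by (simp add: Im_divide)
      then show ?thesis by simp
    qed simp
    have "emeasure \<nu> B = (\<integral>\<^sup>+x\<in>B. ennreal (Im (H (of_real x)) / pi) \<partial>lborel)"
      by (rule H(4)) (use oB in \<open>auto simp: B_def\<close>)
    then have B0: "emeasure \<nu> B = 0" unfolding z by simp
    have "x1 \<in> B" using x1(1) H(1) by (simp add: B_def)
    then show "\<exists>U. open U \<and> x1 \<in> U \<and> emeasure \<nu> U = 0"
      using oB B0 by blast
  qed
  then have "emeasure (ac_part \<nu>) (U - {x0}) = 0" using ac_nu(3)[of "U - {x0}"] oU by auto
  moreover have "emeasure (ac_part \<nu>) {x0} = 0" by (intro ac_nu_null) auto
  ultimately have "emeasure (ac_part \<nu>) ((U - {x0}) \<union> {x0}) = 0"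
    using emeasure_subadditive[of "U - {x0}" "ac_part \<nu>" "{x0}"] oU ac_nu(1) by auto
  then have "emeasure (ac_part \<nu>) U = 0" using x0U by (simp add: insert_absorb)
  then show ?thesis using oU x0U by blast
qed

lemma ac_concentrated: "emeasure (ac_part \<nu>) (- closure (S_set u \<rho> t)) = 0"
proof -
  let ?Cl = "closure (S_set u \<rho> t)"
  have 1: "emeasure (ac_part \<nu>) ({0<..} - ?Cl) = 0"
    by (rule emeasure_open_eq_0_if_locally_0[OF ac_nu(1)]) (use flat_null in auto)
  have "emeasure \<nu> {..<0} = 0" using n.M by (simp add: prob_nonneg_nontrivial_def borel_on_nonneg_def)
  then have 2: "emeasure (ac_part \<nu>) {..<0} = 0" using ac_nu(3)[of "{..<0}"] by simp
  have 3: "emeasure (ac_part \<nu>) {0} = 0" by (intro ac_nu_null) auto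
  have "{0<..} - ?Cl \<in> null_sets (ac_part \<nu>)" "{..<0} \<in> null_sets (ac_part \<nu>)" "{0} \<in> null_sets (ac_part \<nu>)"
    using 1 2 3 ac_nu(1) by (auto simp: null_sets_def)
  then have n: "({0<..} - ?Cl) \<union> {..<0} \<union> {0} \<in> null_sets (ac_part \<nu>)" by (intro null_sets.Un)
  have "- ?Cl \<subseteq> ({0<..} - ?Cl) \<union> {..<0} \<union> {0}" by force
  then show ?thesis using n emeasure_eq_0 null_setsD1 null_setsD2 by metis
qed

lemma ac_local:
  assumes "x0 \<in> S_set u \<rho> t"
  shows "\<exists>e>0. (\<forall>x. \<bar>x - x0\<bar> < e \<longrightarrow> x \<in> S_set u \<rho> t \<and> ac_density_fun x > 0) \<and>
    (\<forall>B\<in>sets borel. B \<subseteq> {x0-e<..<x0+e} \<longrightarrow> emeasure (ac_part \<nu>) B = (\<integral>\<^sup>+x\<in>B. ennreal (ac_density_fun x) \<partial>lborel))"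
proof -
  obtain e where e: "e > 0" "\<And>x. \<bar>x - x0\<bar> < 2 * e \<Longrightarrow> x \<in> S_set u \<rho> t \<and> ac_density_fun x > 0"
    "\<And>B. B \<in> sets borel \<Longrightarrow> B \<subseteq> {x0-e<..<x0+e} \<Longrightarrow> emeasure \<nu> B = (\<integral>\<^sup>+x\<in>B. ennreal (ac_density_fun x) \<partial>lborel)"
    using density_local[OF assms] by blast
  obtain N where N: "N \<in> null_sets lborel" "\<And>B. B \<in> sets borel \<Longrightarrow> emeasure (ac_part \<nu>) B = emeasure \<nu> (B - N)"
    using ac_nu(4) by blast
  have Nb: "N \<in> sets borel" using N(1) by auto
  have "emeasure (ac_part \<nu>) B = (\<integral>\<^sup>+x\<in>B. ennreal (ac_density_fun x) \<partial>lborel)" if B: "B \<in> sets borel" "B \<subseteq> {x0-e<..<x0+e}" for B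
  proof -
    have "emeasure (ac_part \<nu>) B = (\<integral>\<^sup>+x\<in>(B - N). ennreal (ac_density_fun x) \<partial>lborel)"
      unfolding N(2)[OF B(1)] using B Nb by (intro e(3)) auto
    also have "\<dots> = (\<integral>\<^sup>+x\<in>B. ennreal (ac_density_fun x) \<partial>lborel)"
      by (intro nn_integral_cong_AE) (use AE_not_in[OF N(1)] in \<open>eventually_elim, auto simp: indicator_def\<close>)
    finally show ?thesis .
  qed
  then show ?thesis using e(1,2) by (intro exI[of _ e]) auto
qed

text \<open>A Radon-Nikodym density, changed on \<open>S\<^sub>t\<close> into the explicit one. The two agree almost
  everywhere there, because the set where they differ is locally null.\<close>

lemma ac_density:
  obtains f where "is_lebesgue_density f (ac_part \<nu>)" "\<And>x. x \<in> S_set u \<rho> t \<Longrightarrow> f x = ac_density_fun x"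
proof -
  let ?S = "S_set u \<rho> t" and ?\<tau> = "ac_part \<nu>"
  obtain g where g: "g \<in> borel_measurable lborel" "density lborel g = ?\<tau>"
    using sigma_finite_measure.Radon_Nikodym[OF sigma_finite_lborel ac_nu(2)] ac_nu(1) by auto
  have gm[measurable]: "g \<in> borel_measurable borel" using g(1) by simp
  have f0m[measurable]: "(\<lambda>x. indicator ?S x *\<^sub>R ac_density_fun x) \<in> borel_measurable borel"
    by (intro borel_measurable_continuous_on_indicator ac_density_fun_continuous) (use open_S in auto)
  have Sb[measurable]: "?S \<in> sets borel" using open_S by auto
  define f where "f x = indicator ?S x *\<^sub>R ac_density_fun x + indicator (- ?S) x * enn2real (g x)" for x
  have fm[measurable]: "f \<in> borel_measurable borel" unfolding f_def by measurable
  have f0pos: "ac_density_fun x > 0" if "x \<in> ?S" for x using ac_local[OF that] by force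
  have fS: "f x = ac_density_fun x" if "x \<in> ?S" for x using that by (simp add: f_def)
  have fpos: "f x \<ge> 0" for x using f0pos[of x] by (cases "x \<in> ?S") (auto simp: f_def less_imp_le)
  have gfin: "AE x in lborel. g x \<noteq> \<infinity>"
  proof (rule nn_integral_PInf_AE)
    have "(\<integral>\<^sup>+x. g x \<partial>lborel) = emeasure ?\<tau> UNIV" unfolding g(2)[symmetric] by (subst emeasure_density) auto
    also have "\<dots> \<le> emeasure \<nu> UNIV" by (rule ac_nu(3)) simp
    also have "\<dots> < \<infinity>" by (simp add: n.emeasure_eq_measure)
    finally show "(\<integral>\<^sup>+x. g x \<partial>lborel) \<noteq> \<infinity>" by simp
  qed simp
  define bad where "bad = {x\<in>?S. g x \<noteq> ennreal (f x)}"
  have badm[measurable]: "bad \<in> sets borel" unfolding bad_def by measurable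
  have e_bad: "emeasure (density lborel (indicator bad)) B = emeasure lborel (B \<inter> bad)" if "B \<in> sets borel" for B
    using that by (subst emeasure_density) (auto simp: indicator_inter_arith[symmetric] Int_commute)
  have "emeasure (density lborel (indicator bad)) ?S = 0"
  proof (rule emeasure_open_eq_0_if_locally_0)
    fix x0 assume x0S: "x0 \<in> ?S"
    obtain e where e: "e > 0" "\<And>x. \<bar>x - x0\<bar> < e \<Longrightarrow> x \<in> ?S"
      "\<And>B. B \<in> sets borel \<Longrightarrow> B \<subseteq> {x0-e<..<x0+e} \<Longrightarrow> emeasure ?\<tau> B = (\<integral>\<^sup>+x\<in>B. ennreal (ac_density_fun x) \<partial>lborel)"
      using ac_local[OF x0S] by blast
    define U where "U = {x0-e<..<x0+e}"
    have Um[measurable]: "U \<in> sets borel" by (simp add: U_def)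
    have US: "x \<in> ?S" if "x \<in> U" for x using e(2)[of x] that by (auto simp: U_def)
    have "density lborel (\<lambda>x. g x * indicator U x) = density lborel (\<lambda>x. ennreal (f x) * indicator U x)"
    proof (rule measure_eqI)
      fix B assume "B \<in> sets (density lborel (\<lambda>x. g x * indicator U x))"
      then have B[measurable]: "B \<in> sets borel" by simp
      have "emeasure (density lborel (\<lambda>x. g x * indicator U x)) B = (\<integral>\<^sup>+x. g x * indicator (U \<inter> B) x \<partial>lborel)"
        by (subst emeasure_density) (auto simp: indicator_inter_arith mult_ac intro!: nn_integral_cong)
      also have "\<dots> = emeasure ?\<tau> (U \<inter> B)" unfolding g(2)[symmetric] by (subst emeasure_density) auto
      also have "\<dots> = (\<integral>\<^sup>+x\<in>(U \<inter> B). ennreal (ac_density_fun x) \<partial>lborel)" by (rule e(3)) (auto simp: U_def)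
      also have "\<dots> = (\<integral>\<^sup>+x\<in>(U \<inter> B). ennreal (f x) \<partial>lborel)"
        using fS[OF US] by (intro nn_integral_cong) (auto simp: indicator_def)
      also have "\<dots> = emeasure (density lborel (\<lambda>x. ennreal (f x) * indicator U x)) B"
        by (subst emeasure_density) (auto simp: indicator_inter_arith mult_ac intro!: nn_integral_cong)
      finally show "emeasure (density lborel (\<lambda>x. g x * indicator U x)) B = emeasure (density lborel (\<lambda>x. ennreal (f x) * indicator U x)) B" .
    qed simp
    then have "AE x in lborel. g x * indicator U x = ennreal (f x) * indicator U x"
      by (intro sigma_finite_measure.density_unique[OF sigma_finite_lborel]) auto
    then have "AE x in lborel. x \<notin> U \<inter> bad" by eventually_elim (auto simp: bad_def indicator_def)
    then have "emeasure lborel (U \<inter> bad) = 0" by (subst (asm) AE_iff_measurable[of "U \<inter> bad"]) auto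
    then show "\<exists>U. open U \<and> x0 \<in> U \<and> emeasure (density lborel (indicator bad)) U = 0"
      using e(1) e_bad[OF Um] by (intro exI[of _ U]) (auto simp: U_def)
  qed simp
  then have "emeasure lborel (?S \<inter> bad) = 0" using e_bad[OF Sb] by simp
  moreover have "?S \<inter> bad = bad" by (auto simp: bad_def)
  ultimately have "AE x in lborel. x \<notin> bad" by (intro AE_not_in) (auto simp: null_sets_def)
  with gfin have "AE x in lborel. g x = ennreal (f x)"
  proof eventually_elim
    case (elim x)
    then show ?case by (cases "x \<in> ?S") (auto simp: bad_def f_def less_top)
  qed
  then have "?\<tau> = density lborel (\<lambda>x. ennreal (f x))"
    unfolding g(2)[symmetric] by (intro density_cong) auto
  then have "is_lebesgue_density f ?\<tau>" unfolding is_lebesgue_density_def using fpos by simp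
  then show thesis using that fS by blast
qed

text \<open>Strict positivity of the density on \<open>S\<^sub>t\<close> gives one inclusion, \<open>ac_concentrated\<close> the other.\<close>

lemma msupport_ac: "msupport (ac_part \<nu>) = closure (S_set u \<rho> t)"
proof
  let ?S = "S_set u \<rho> t" and ?\<tau> = "ac_part \<nu>"
  show "msupport ?\<tau> \<subseteq> closure ?S"
  proof
    fix x assume x: "x \<in> msupport ?\<tau>"
    show "x \<in> closure ?S"
    proof (rule ccontr)
      assume "x \<notin> closure ?S"
      then have "open (- closure ?S) \<and> x \<in> - closure ?S" by auto
      then have "emeasure ?\<tau> (- closure ?S) > 0" using x unfolding msupport_def by blast
      then show False using ac_concentrated by simp
    qed
  qed
  show "closure ?S \<subseteq> msupport ?\<tau>"
  proof
    fix x assume x: "x \<in> closure ?S"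
    have "emeasure ?\<tau> U > 0" if U: "open U" "x \<in> U" for U
    proof (rule ccontr)
      assume "\<not> emeasure ?\<tau> U > 0"
      then have U0: "emeasure ?\<tau> U = 0" by simp
      have "U \<inter> ?S \<noteq> {}" using x U by (auto simp: closure_iff_nhds_not_empty)
      then obtain y where y: "y \<in> U" "y \<in> ?S" by blast
      obtain e where e: "e > 0" "\<And>x. \<bar>x - y\<bar> < e \<Longrightarrow> x \<in> ?S \<and> ac_density_fun x > 0"
        "\<And>B. B \<in> sets borel \<Longrightarrow> B \<subseteq> {y-e<..<y+e} \<Longrightarrow> emeasure ?\<tau> B = (\<integral>\<^sup>+x\<in>B. ennreal (ac_density_fun x) \<partial>lborel)"
        using ac_local[OF y(2)] by blast
      obtain k where k: "k > 0" "ball y k \<subseteq> U" using U y open_contains_ball by blast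
      define c where "c = min e k"
      define B where "B = {y-c<..<y+c}"
      have c: "c > 0" "c \<le> e" "c \<le> k" using e k by (auto simp: c_def)
      have BU: "B \<subseteq> U" using k c by (auto simp: B_def dist_real_def abs_less_iff subset_iff)
      have Be: "B \<subseteq> {y-e<..<y+e}" using c by (auto simp: B_def)
      have BS: "x \<in> ?S \<and> ac_density_fun x > 0" if "x \<in> B" for x using e(2)[of x] that c by (auto simp: B_def)
      have Bm: "B \<in> sets borel" by (simp add: B_def)
      have m: "(\<lambda>x. ennreal (ac_density_fun x) * indicator B x) \<in> borel_measurable lborel"
      proof -
        have "(\<lambda>x. indicator ?S x *\<^sub>R ac_density_fun x) \<in> borel_measurable borel"
          by (intro borel_measurable_continuous_on_indicator ac_density_fun_continuous) (use open_S in auto)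
        then have "(\<lambda>x. ennreal (indicator ?S x *\<^sub>R ac_density_fun x) * indicator B x) \<in> borel_measurable borel" using Bm by measurable
        moreover have "(\<lambda>x. ennreal (indicator ?S x *\<^sub>R ac_density_fun x) * indicator B x) = (\<lambda>x. ennreal (ac_density_fun x) * indicator B x)"
          using BS by (auto simp: indicator_def fun_eq_iff)
        ultimately show ?thesis by simp
      qed
      have "U \<in> sets ?\<tau>" using U(1) ac_nu(1) by simp
      then have "emeasure ?\<tau> B = 0" using emeasure_eq_0[OF _ U0 BU] by simp
      then have "(\<integral>\<^sup>+x\<in>B. ennreal (ac_density_fun x) \<partial>lborel) = 0" using e(3)[OF Bm Be] by simp
      then have "AE x in lborel. ennreal (ac_density_fun x) * indicator B x = 0" using nn_integral_0_iff_AE[OF m] by simp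
      then have "AE x in lborel. x \<notin> B"
        by eventually_elim (use BS in \<open>force simp: indicator_def split: if_splits\<close>)
      then have "emeasure lborel B = 0" using Bm by (subst (asm) AE_iff_measurable[of B]) auto
      then show False using c by (simp add: B_def)
    qed
    then show "x \<in> msupport ?\<tau>" unfolding msupport_def by blast
  qed
qed

end

section \<open>Counting components; convexity of g\<close>

text \<open>The map sends each component of \<open>K1\<close> into one component of \<open>K2\<close>, and every component of \<open>K2\<close>
  arises in this way.\<close>

lemma num_components_le:
  fixes \<phi> :: "real \<Rightarrow> real"
  assumes cont: "continuous_on K1 \<phi>" and sub: "\<phi> ` K1 \<subseteq> K2"
    and meet: "\<And>C. C \<in> components K2 \<Longrightarrow> C \<inter> \<phi> ` K1 \<noteq> {}"
  shows "num_components K2 \<le> num_components K1"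
proof -
  define f where "f C = connected_component_set K2 (\<phi> (SOME x. x \<in> C))" for C
  have surj: "components K2 \<subseteq> f ` components K1"
  proof
    fix C2 assume C2: "C2 \<in> components K2"
    then obtain x where x: "x \<in> K1" "\<phi> x \<in> C2" using meet by blast
    define C1 where "C1 = connected_component_set K1 x"
    have C1: "C1 \<in> components K1" "x \<in> C1" using x by (auto simp: C1_def components_def)
    have "connected C1" "C1 \<subseteq> K1" by (auto simp: C1_def connected_component_subset)
    then have "connected (\<phi> ` C1)" "\<phi> ` C1 \<subseteq> K2"
      using connected_continuous_image[OF continuous_on_subset[OF cont]] sub by blast+
    then have "\<phi> ` C1 \<subseteq> C2" using components_maximal[OF C2] x C1(2) by blast
    moreover have "(SOME x. x \<in> C1) \<in> C1" using C1(2) by (rule someI)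
    ultimately have s: "\<phi> (SOME x. x \<in> C1) \<in> C2" by blast
    have "f C1 = C2" unfolding f_def
    proof -
      obtain y where y: "C2 = connected_component_set K2 y" using C2 by (auto simp: components_def)
      show "connected_component_set K2 (\<phi> (SOME x. x \<in> C1)) = C2"
        using s unfolding y by (rule connected_component_eq[symmetric, OF _, THEN sym])
    qed
    then show "C2 \<in> f ` components K1" using C1(1) by blast
  qed
  show ?thesis
  proof (cases "finite (components K1)")
    case True
    then have "finite (components K2)" "card (components K2) \<le> card (components K1)"
      using finite_subset[OF surj finite_imageI[OF True]] surj_card_le[OF True surj] by simp_all
    then show ?thesis using True by (simp add: num_components_def)
  qed (simp add: num_components_def)
qed

text \<open>The closure of \<open>W2\<close> may have components without points of \<open>W2\<close>, as limits of shrinking components.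
  If such a component missed the closure of \<open>W1\<close>, it could be enclosed by two points off the closure of
  \<open>W2\<close> with no point of \<open>W1\<close> between them; a point of \<open>W2\<close> in between could not be joined to \<open>W1\<close>.\<close>

lemma component_closure_meet:
  fixes W1 W2 :: "real set"
  assumes sub: "W1 \<subseteq> W2" and seg: "\<And>w. w \<in> W2 \<Longrightarrow> \<exists>v\<in>W1. closed_segment w v \<subseteq> W2"
    and C: "C \<in> components (closure W2)"
  shows "C \<inter> closure W1 \<noteq> {}"
proof
  assume disj: "C \<inter> closure W1 = {}"
  let ?K2 = "closure W2"
  obtain c where c: "c \<in> C" using C in_components_nonempty by blast
  have cK: "c \<in> ?K2" using c C in_components_subset by blast
  have c1: "c \<notin> closure W1" using c disj by blast
  have s12: "closure W1 \<subseteq> ?K2" using sub by (rule closure_mono)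
  have in_C: "y \<in> C" if "{min c y..max c y} \<subseteq> ?K2" for y
  proof -
    have "c \<in> {min c y..max c y}" "y \<in> {min c y..max c y}" by auto
    moreover from this(1) c have "{min c y..max c y} \<subseteq> C"
      by (intro components_maximal[OF C _ that]) auto
    ultimately show ?thesis by blast
  qed
  \<comment> \<open>a point below c that separates it from all smaller points of W1\<close>
  have L: "\<exists>p<c. \<forall>d\<in>W1. d < c \<longrightarrow> d \<le> p \<and> p \<notin> ?K2"
  proof (cases "\<exists>y\<in>W1. y < c")
    case True
    define Q where "Q = closure W1 \<inter> {..c}"
    obtain y where "y \<in> W1" "y < c" using True by blast
    then have "y \<in> Q" using closure_subset[of W1] by (auto simp: Q_def)
    moreover have "bdd_above Q" by (intro bdd_aboveI[of _ c]) (auto simp: Q_def)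
    moreover have "closed Q" unfolding Q_def by (intro closed_Int closed_closure closed_atMost)
    ultimately have Q: "Q \<noteq> {}" "bdd_above Q" "closed Q" by blast+
    define a where "a = Sup Q"
    have a: "a \<in> closure W1" "a \<le> c" using closed_contains_Sup[OF Q] by (auto simp: a_def Q_def)
    then have ac: "a < c" using c1 by (cases "a = c") auto
    have "a \<notin> C" using a disj by blast
    then have "\<not> {a..c} \<subseteq> ?K2" using in_C[of a] ac by auto
    then obtain p where "p \<in> {a..c}" and pK: "p \<notin> ?K2" by blast
    then have p: "a \<le> p" "p \<le> c" "p \<notin> ?K2" by auto
    have "p < c" using p cK by (cases "p = c") auto
    moreover have "d \<le> p" if "d \<in> W1" "d < c" for d
    proof -
      have "d \<in> Q" using that closure_subset[of W1] by (auto simp: Q_def)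
      then have "d \<le> a" unfolding a_def using Q(2) by (rule cSup_upper)
      then show ?thesis using p by simp
    qed
    ultimately show ?thesis using p by blast
  next
    case False
    then show ?thesis by (intro exI[of _ "c - 1"]) auto
  qed
  \<comment> \<open>the same above c\<close>
  have U: "\<exists>p>c. \<forall>d\<in>W1. d > c \<longrightarrow> d \<ge> p \<and> p \<notin> ?K2"
  proof (cases "\<exists>y\<in>W1. y > c")
    case True
    define Q where "Q = closure W1 \<inter> {c..}"
    obtain y where "y \<in> W1" "y > c" using True by blast
    then have "y \<in> Q" using closure_subset[of W1] by (auto simp: Q_def)
    moreover have "bdd_below Q" by (intro bdd_belowI[of _ c]) (auto simp: Q_def)
    moreover have "closed Q" unfolding Q_def by (intro closed_Int closed_closure closed_atLeast)
    ultimately have Q: "Q \<noteq> {}" "bdd_below Q" "closed Q" by blast+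
    define a where "a = Inf Q"
    have a: "a \<in> closure W1" "a \<ge> c" using closed_contains_Inf[OF Q] by (auto simp: a_def Q_def)
    then have ac: "a > c" using c1 by (cases "a = c") auto
    have "a \<notin> C" using a disj by blast
    then have "\<not> {c..a} \<subseteq> ?K2" using in_C[of a] ac by auto
    then obtain p where "p \<in> {c..a}" and pK: "p \<notin> ?K2" by blast
    then have p: "a \<ge> p" "p \<ge> c" "p \<notin> ?K2" by auto
    have "p > c" using p cK by (cases "p = c") auto
    moreover have "d \<ge> p" if "d \<in> W1" "d > c" for d
    proof -
      have "d \<in> Q" using that closure_subset[of W1] by (auto simp: Q_def)
      then have "a \<le> d" unfolding a_def using Q(2) by (rule cInf_lower)
      then show ?thesis using p by simp
    qed
    ultimately show ?thesis using p by blast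
  next
    case False
    then show ?thesis by (intro exI[of _ "c + 1"]) auto
  qed
  obtain p where p: "p < c" "\<And>d. d \<in> W1 \<Longrightarrow> d < c \<Longrightarrow> d \<le> p \<and> p \<notin> ?K2" using L by blast
  obtain p' where p': "c < p'" "\<And>d. d \<in> W1 \<Longrightarrow> d > c \<Longrightarrow> p' \<le> d \<and> p' \<notin> ?K2" using U by blast
  have "{p<..<p'} \<inter> W2 \<noteq> {}" using open_Int_closure_eq_empty[of "{p<..<p'}" W2] cK p(1) p'(1) by auto
  then obtain c' where c': "c' \<in> W2" "p < c'" "c' < p'" by auto
  obtain d where d: "d \<in> W1" "closed_segment c' d \<subseteq> W2" using seg[OF c'(1)] by blast
  have dc: "d \<noteq> c" using d(1) c1 closure_subset[of W1] by blast
  show False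
  proof (cases "d < c")
    case True
    then have "p \<in> closed_segment c' d" "p \<notin> ?K2" using p(2)[OF d(1)] c' by (auto simp: closed_segment_eq_real_ivl)
    then show False using d(2) closure_subset[of W2] by blast
  next
    case False
    then have "c < d" using dc by simp
    then have "p' \<in> closed_segment c' d" "p' \<notin> ?K2" using p'(2)[OF d(1)] c' by (auto simp: closed_segment_eq_real_ivl)
    then show False using d(2) closure_subset[of W2] by blast
  qed
qed

text \<open>The kernel of \<open>g\<close> increases towards its pole. The condition says that \<open>x\<close> is on the side of \<open>r\<close>
  nearer to \<open>s\<close>, for \<open>r\<close> and \<open>x\<close> on the same side of \<open>s\<close>.\<close>

lemma kernel_cross_mono:
  fixes r x s :: real
  assumes "0 < r" "0 < x" "0 \<le> s" "(x - r) * (s\<^sup>2 - r * x) \<ge> 0"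
  shows "ennreal (r * (s\<^sup>2 + 1)) / ennreal ((r - s)\<^sup>2) \<le> ennreal (x * (s\<^sup>2 + 1)) / ennreal ((x - s)\<^sup>2)"
proof (cases "x = s")
  case True
  then show ?thesis using assms by (simp add: ennreal_divide_zero add_nonneg_pos less_imp_neq[symmetric])
next
  case False
  have id: "x * (r - s)^2 - r * (x - s)^2 = (x - r) * (s\<^sup>2 - r * x)" by algebra
  then have le: "r * (x - s)^2 \<le> x * (r - s)^2" using assms(4) by simp
  have "r * (x - s)^2 > 0" using False assms by simp
  then have rs: "(r - s)^2 > 0" using le assms(2) by (smt (verit) mult_nonneg_nonpos zero_less_mult_pos)
  have "r / (r - s)^2 \<le> x / (x - s)^2" using le rs False by (simp add: divide_simps mult.commute)
  then have "r * (s\<^sup>2 + 1) / (r - s)^2 \<le> x * (s\<^sup>2 + 1) / (x - s)^2"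
    using mult_right_mono[of "r / (r - s)^2" "x / (x - s)^2" "s\<^sup>2 + 1"] by simp
  then show ?thesis using rs False assms by (simp add: divide_ennreal)
qed

text \<open>In the coordinate \<open>ln r\<close> the kernel of \<open>g\<close> is, up to a factor, \<open>1 / (4 sinh\<^sup>2)\<close>.\<close>

lemma exp_kernel_convex:
  fixes s :: real
  assumes s: "s \<ge> 0" and C: "convex C" and ne: "\<And>x. x \<in> C \<Longrightarrow> exp x \<noteq> s"
  shows "convex_on C (\<lambda>x. exp x / (exp x - s)^2)"
proof (rule f''_ge0_imp_convex[OF C])
  fix x assume x: "x \<in> C"
  have n: "exp x - s \<noteq> 0" using ne[OF x] by simp
  show "((\<lambda>x. exp x / (exp x - s)^2) has_real_derivative - (exp x * (exp x + s)) / (exp x - s)^3) (at x)"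
  proof -
    define e where "e = exp x"
    have "((\<lambda>x. exp x / (exp x - s)^2) has_real_derivative (e * (e - s)^2 - e * (2 * (e - s) * e)) / ((e - s)^2 * (e - s)^2)) (at x)"
      using n unfolding e_def by (auto intro!: derivative_eq_intros)
    moreover have "(e * (e - s)^2 - e * (2 * (e - s) * e)) / ((e - s)^2 * (e - s)^2) = - (e * (e + s)) / (e - s)^3"
    proof -
      have "e * (e - s)^2 - e * (2 * (e - s) * e) = - (e * (e + s)) * (e - s)" by algebra
      moreover have "(e - s)^2 * (e - s)^2 = (e - s)^3 * (e - s)" by algebra
      ultimately show ?thesis using n by (simp add: e_def)
    qed
    ultimately show ?thesis by (simp add: e_def)
  qed
  show "((\<lambda>x. - (exp x * (exp x + s)) / (exp x - s)^3) has_real_derivative exp x * (exp x ^ 2 + 4 * exp x * s + s^2) / (exp x - s)^4) (at x)"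
  proof -
    define e where "e = exp x"
    have "((\<lambda>x. - (exp x * (exp x + s)) / (exp x - s)^3) has_real_derivative
       (- (e * (e + s) + e * e) * (e - s)^3 - - (e * (e + s)) * (3 * (e - s)^2 * e)) / ((e - s)^3 * (e - s)^3)) (at x)"
      using n unfolding e_def by (auto intro!: derivative_eq_intros simp: algebra_simps)
    moreover have "(- (e * (e + s) + e * e) * (e - s)^3 - - (e * (e + s)) * (3 * (e - s)^2 * e)) / ((e - s)^3 * (e - s)^3) =
       e * (e ^ 2 + 4 * e * s + s^2) / (e - s)^4"
    proof -
      have e1: "- (e * (e + s) + e * e) * (e - s)^3 - - (e * (e + s)) * (3 * (e - s)^2 * e) = e * (e ^ 2 + 4 * e * s + s^2) * (e - s)^2" by algebra
      have e2: "(e - s)^3 * (e - s)^3 = (e - s)^4 * (e - s)^2" by algebra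
      show ?thesis unfolding e1 e2 using n by (intro nonzero_mult_divide_mult_cancel_right) (simp add: e_def)
    qed
    ultimately show ?thesis by (simp add: e_def)
  qed
  show "exp x * (exp x ^ 2 + 4 * exp x * s + s^2) / (exp x - s)^4 \<ge> 0"
    using s by (intro divide_nonneg_nonneg mult_nonneg_nonneg add_nonneg_nonneg) auto
qed

text \<open>The weights come from the convexity of the kernel in \<open>ln r\<close> and do not depend on \<open>s\<close>, so the
  inequality can be integrated. At a pole the right-hand side is infinite.\<close>

lemma kernel_interpolate:
  fixes \<alpha> \<beta> r s :: real
  assumes "0 < \<alpha>" "\<alpha> < r" "r < \<beta>" "0 \<le> s" "s \<notin> {\<alpha><..<\<beta>}"
  defines "k \<equiv> (ln r - ln \<alpha>) / (ln \<beta> - ln \<alpha>)"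
  shows "ennreal (r * (s\<^sup>2 + 1)) / ennreal ((r - s)\<^sup>2) \<le>
     ennreal (1 - k) * (ennreal (\<alpha> * (s\<^sup>2 + 1)) / ennreal ((\<alpha> - s)\<^sup>2)) + ennreal k * (ennreal (\<beta> * (s\<^sup>2 + 1)) / ennreal ((\<beta> - s)\<^sup>2))"
proof -
  have ln: "ln \<alpha> < ln r" "ln r < ln \<beta>" using assms(1-3) by auto
  then have k: "0 < k" "k < 1" by (auto simp: k_def)
  have pos: "s\<^sup>2 + 1 > 0" by (simp add: add_nonneg_pos)
  show ?thesis
  proof (cases "s = \<alpha> \<or> s = \<beta>")
    case True
    then show ?thesis
    proof
      assume s: "s = \<alpha>"
      have "ennreal (\<alpha> * (s\<^sup>2 + 1)) / ennreal ((\<alpha> - s)\<^sup>2) = \<top>" using s assms(1) pos by (simp add: ennreal_divide_zero)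
      then show ?thesis using k by (simp add: ennreal_mult_top)
    next
      assume s: "s = \<beta>"
      have "ennreal (\<beta> * (s\<^sup>2 + 1)) / ennreal ((\<beta> - s)\<^sup>2) = \<top>" using s assms(1-3) pos by (simp add: ennreal_divide_zero)
      then show ?thesis using k by (simp add: ennreal_mult_top)
    qed
  next
    case False
    then have ns: "s < \<alpha> \<or> \<beta> < s" using assms(5) by auto
    have conv: "convex_on {ln \<alpha>..ln \<beta>} (\<lambda>x. exp x / (exp x - s)^2)"
    proof (rule exp_kernel_convex[OF assms(4)])
      fix x assume x: "x \<in> {ln \<alpha>..ln \<beta>}"
      then have "exp (ln \<alpha>) \<le> exp x" "exp x \<le> exp (ln \<beta>)" by auto
      then show "exp x \<noteq> s" using ns assms(1-3) by auto
    qed auto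
    have "k * (ln \<beta> - ln \<alpha>) = ln r - ln \<alpha>" using ln by (simp add: k_def)
    then have "ln r = (1 - k) * ln \<alpha> + k * ln \<beta>" by (simp add: algebra_simps)
    then have "exp (ln r) / (exp (ln r) - s)^2 \<le> (1 - k) * (exp (ln \<alpha>) / (exp (ln \<alpha>) - s)^2) + k * (exp (ln \<beta>) / (exp (ln \<beta>) - s)^2)"
      using convex_onD[OF conv, of k "ln \<alpha>" "ln \<beta>"] k ln by simp
    then have c: "r / (r - s)^2 \<le> (1 - k) * (\<alpha> / (\<alpha> - s)^2) + k * (\<beta> / (\<beta> - s)^2)" using assms(1-3) by simp
    have nz: "(r - s)^2 > 0" "(\<alpha> - s)^2 > 0" "(\<beta> - s)^2 > 0" using ns assms(1-3) by auto
    have "r * (s\<^sup>2 + 1) / (r - s)^2 \<le> (1 - k) * (\<alpha> * (s\<^sup>2 + 1) / (\<alpha> - s)^2) + k * (\<beta> * (s\<^sup>2 + 1) / (\<beta> - s)^2)"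
      using mult_right_mono[OF c, of "s\<^sup>2 + 1"] pos by (simp add: algebra_simps)
    then have "ennreal (r * (s\<^sup>2 + 1) / (r - s)^2) \<le> ennreal (1 - k) * ennreal (\<alpha> * (s\<^sup>2 + 1) / (\<alpha> - s)^2) + ennreal k * ennreal (\<beta> * (s\<^sup>2 + 1) / (\<beta> - s)^2)"
      using k assms(1-3) by (simp add: ennreal_leI flip: ennreal_mult ennreal_plus)
    then show ?thesis using nz assms(1-3) pos by (simp add: divide_ennreal)
  qed
qed

context nevanlinna
begin

lemma g_fun_mono_if:
  assumes "0 < r" "0 < x" "AE s in \<rho>. (x - r) * (s\<^sup>2 - r * x) \<ge> 0"
  shows "g_fun \<rho> r \<le> g_fun \<rho> x"
  unfolding g_fun_def
  by (intro nn_integral_mono_AE) (use rho_nonneg assms(3) in \<open>eventually_elim, use kernel_cross_mono assms(1,2) in blast\<close>)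

lemma g_fun_interpolate:
  assumes "0 < \<alpha>" "\<alpha> < r" "r < \<beta>" "AE s in \<rho>. s \<notin> {\<alpha><..<\<beta>}" "g_fun \<rho> \<alpha> \<le> c" "g_fun \<rho> \<beta> \<le> c"
  shows "g_fun \<rho> r \<le> c"
proof -
  define k where "k = (ln r - ln \<alpha>) / (ln \<beta> - ln \<alpha>)"
  have ln: "ln \<alpha> < ln r" "ln r < ln \<beta>" using assms(1-3) by auto
  then have k: "0 < k" "k < 1" by (auto simp: k_def)
  have "g_fun \<rho> r \<le> (\<integral>\<^sup>+s. ennreal (1 - k) * (ennreal (\<alpha> * (s\<^sup>2 + 1)) / ennreal ((\<alpha> - s)\<^sup>2)) + ennreal k * (ennreal (\<beta> * (s\<^sup>2 + 1)) / ennreal ((\<beta> - s)\<^sup>2)) \<partial>\<rho>)"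
    unfolding g_fun_def k_def
    by (intro nn_integral_mono_AE) (use rho_nonneg assms(4) in \<open>eventually_elim, use kernel_interpolate[OF assms(1-3)] in blast\<close>)
  also have "\<dots> = ennreal (1 - k) * g_fun \<rho> \<alpha> + ennreal k * g_fun \<rho> \<beta>"
    unfolding g_fun_def by (subst nn_integral_add) (auto simp: nn_integral_cmult)
  also have "\<dots> \<le> ennreal (1 - k) * c + ennreal k * c" using assms(5,6) by (intro add_mono mult_left_mono) auto
  also have "\<dots> = c" using k by (simp flip: distrib_right ennreal_plus)
  finally show ?thesis .
qed

end

section \<open>Monotonicity of the number of components\<close>

context nevanlinna_power
begin

lemma open_V_plus: "open (V_plus \<rho> t)"
proof -
  have c: "continuous_on {0<..} A" by (intro continuous_at_imp_continuous_on ballI isCont_A) auto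
  have "V_plus \<rho> t = {0<..} \<inter> A -` {0<..}" using V_plus_iff by auto
  moreover have "open \<dots>" by (rule continuous_open_preimage[OF c]) auto
  ultimately show ?thesis by simp
qed

text \<open>An atom of \<open>\<rho>\<close> at \<open>0\<close> makes \<open>g r\<close> at least of order \<open>1 / r\<close>, so small \<open>r\<close> would belong to \<open>V\<^sub>t\<close>.\<close>

lemma rho_atom_0:
  assumes b: "b > 0" and A0: "\<And>r. 0 < r \<Longrightarrow> r < b \<Longrightarrow> A r = 0"
  shows "AE s in \<rho>. s \<noteq> 0"
proof -
  have le: "q * measure \<rho> {0} \<le> r" if r: "0 < r" "r < b" for r
  proof -
    note tm = N_bound_flat[OF r(1) A0[OF r]]
    have "measure \<rho> {0} = (LINT s|\<rho>. indicator {0} s)" by simp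
    also have "\<dots> \<le> (LINT s|\<rho>. r^2 * K (of_real r) s)"
    proof (rule integral_mono)
      show "integrable \<rho> (indicat_real {0})" by (intro integrable_real_indicator) (auto simp: sets_rho less_top[symmetric])
      show "indicat_real {0} s \<le> r^2 * K (of_real r) s" for s
        using r(1) K_nonneg[of "of_real r" s] by (cases "s = 0") (auto simp: K_def)
    qed (use tm(1) in \<open>auto simp: tame_def\<close>)
    also have "\<dots> = r^2 * N (of_real r)" by (simp add: N_def)
    finally have "q * measure \<rho> {0} \<le> q * (r^2 * N (of_real r))" using q by (intro mult_left_mono) auto
    also have "\<dots> = r * (q * r * N (of_real r))" by (simp add: power2_eq_square)
    also have "\<dots> \<le> r * 1" using tm(2) r by (intro mult_left_mono) auto
    finally show ?thesis by simp
  qed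
  have "q * measure \<rho> {0} \<le> 0"
  proof (rule ccontr)
    assume "\<not> q * measure \<rho> {0} \<le> 0"
    then obtain r where "0 < r" "r < min b (q * measure \<rho> {0})" using dense[of 0 "min b (q * measure \<rho> {0})"] b by auto
    then show False using le[of r] by simp
  qed
  then have "measure \<rho> {0} = 0" using q measure_nonneg[of \<rho> "{0}"] by (simp add: mult_le_0_iff)
  then show ?thesis by (intro AE_I[where N = "{0}"]) (auto simp: emeasure_eq_measure sets_rho)
qed

end

context nevanlinna
begin

lemma V_plus_mono:
  assumes "1 < t1" "t1 \<le> t2" shows "V_plus \<rho> t1 \<subseteq> V_plus \<rho> t2"
proof
  fix r assume "r \<in> V_plus \<rho> t1"
  moreover have "ennreal (1 / (t2 - 1)) \<le> ennreal (1 / (t1 - 1))" using assms by (intro ennreal_leI divide_left_mono) auto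
  ultimately show "r \<in> V_plus \<rho> t2" by (auto simp: V_plus_def intro: order_le_less_trans)
qed

text \<open>Suppose that the component of \<open>V\<close> at \<open>r0\<close> for the exponent \<open>t2\<close> misses the one for \<open>t1\<close>. Then \<open>\<rho>\<close> does
  not charge it, and \<open>g\<close> at \<open>r0\<close> is bounded by its values at the ends of the component: by interpolation if
  both ends are positive numbers, by monotonicity of the kernel if the component extends to \<open>0\<close> (where
  \<open>rho_atom_0\<close> excludes an atom) or to infinity. These values are too small for \<open>r0\<close> to belong to \<open>V\<close>.\<close>

lemma component_meets:
  assumes t: "1 < t1" "t1 \<le> t2" and r0: "r0 \<in> V_plus \<rho> t2"
  shows "\<exists>r1\<in>V_plus \<rho> t1. closed_segment r0 r1 \<subseteq> V_plus \<rho> t2"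
proof (rule ccontr)
  assume no: "\<not> (\<exists>r1\<in>V_plus \<rho> t1. closed_segment r0 r1 \<subseteq> V_plus \<rho> t2)"
  interpret p1: nevanlinna_power u a \<rho> t1 by standard (rule t)
  interpret p2: nevanlinna_power u a \<rho> t2 by standard (use t in simp)
  let ?V1 = "V_plus \<rho> t1" and ?V2 = "V_plus \<rho> t2"
  define c where "c = ennreal (1 / (t2 - 1))"
  have r0p: "r0 > 0" "g_fun \<rho> r0 > c" using r0 by (auto simp: V_plus_def c_def)
  have notV: "g_fun \<rho> r \<le> c" if "r > 0" "r \<notin> ?V2" for r using that by (auto simp: V_plus_def c_def not_less)
  \<comment> \<open>the left end of the component; 0 is not in V, so the supremum exists and is 0 if the component extends to 0\<close>
  define L where "L = {0..r0} \<inter> - ?V2"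
  have L: "L \<noteq> {}" "bdd_above L" "closed L"
  proof -
    have "0 \<in> L" using r0p by (simp add: L_def V_plus_def)
    then show "L \<noteq> {}" by blast
    show "bdd_above L" by (intro bdd_aboveI[of _ r0]) (auto simp: L_def)
    show "closed L" unfolding L_def using p2.open_V_plus by (intro closed_Int closed_Compl) auto
  qed
  define \<alpha> where "\<alpha> = Sup L"
  have \<alpha>: "0 \<le> \<alpha>" "\<alpha> \<le> r0" "\<alpha> \<notin> ?V2" using closed_contains_Sup[OF L] by (auto simp: \<alpha>_def L_def)
  have \<alpha>r: "\<alpha> < r0" using \<alpha> r0 by (cases "\<alpha> = r0") auto
  have lowV: "x \<in> ?V2" if "\<alpha> < x" "x \<le> r0" for x
  proof (rule ccontr)
    assume "x \<notin> ?V2"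
    then have "x \<in> L" using that \<alpha> by (auto simp: L_def)
    then have "x \<le> \<alpha>" unfolding \<alpha>_def using L(2) by (rule cSup_upper)
    then show False using that by simp
  qed
  have notV1: "x \<notin> ?V1" if "closed_segment r0 x \<subseteq> ?V2" for x using no that by blast
  have A0: "p1.A x = 0" if "x > 0" "x \<notin> ?V1" for x using that p1.V_plus_iff[of x] p1.A_bounds[of x] by auto
  have atom: "AE s in \<rho>. s \<noteq> 0" if "\<alpha> = 0" "r0 < b" "\<And>x. \<alpha> < x \<Longrightarrow> x < b \<Longrightarrow> x \<notin> ?V1" for b
    by (rule p1.rho_atom_0[of b]) (use that r0p A0 in auto)
  show False
  proof (cases "\<exists>x>r0. x \<notin> ?V2")
    case True
    \<comment> \<open>the right end, if there is one\<close>
    define R where "R = {r0..} \<inter> - ?V2"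
    have R: "R \<noteq> {}" "bdd_below R" "closed R"
    proof -
      obtain x where "r0 < x" "x \<notin> ?V2" using True by blast
      then have "x \<in> R" by (simp add: R_def)
      then show "R \<noteq> {}" by blast
      show "bdd_below R" by (intro bdd_belowI[of _ r0]) (auto simp: R_def)
      show "closed R" unfolding R_def using p2.open_V_plus by (intro closed_Int closed_Compl) auto
    qed
    define \<beta> where "\<beta> = Inf R"
    have \<beta>: "r0 \<le> \<beta>" "\<beta> \<notin> ?V2" using closed_contains_Inf[OF R] by (auto simp: \<beta>_def R_def)
    have \<beta>r: "r0 < \<beta>" using \<beta> r0 by (cases "\<beta> = r0") auto
    have upV: "x \<in> ?V2" if "r0 \<le> x" "x < \<beta>" for x
    proof (rule ccontr)
      assume "x \<notin> ?V2"
      then have "x \<in> R" using that by (auto simp: R_def)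
      then have "\<beta> \<le> x" unfolding \<beta>_def using R(2) by (rule cInf_lower)
      then show False using that by simp
    qed
    have n1: "x \<notin> ?V1" if "\<alpha> < x" "x < \<beta>" for x
    proof (rule notV1)
      show "closed_segment r0 x \<subseteq> ?V2"
      proof
        fix y assume "y \<in> closed_segment r0 x"
        then have "\<alpha> < y" "y < \<beta>" using that \<alpha>r \<beta>r by (auto simp: closed_segment_eq_real_ivl split: if_splits)
        then show "y \<in> ?V2" using lowV upV by (cases "y \<le> r0") auto
      qed
    qed
    have "emeasure \<rho> {\<alpha><..<\<beta>} = 0" by (rule p1.rho_gap[OF _ \<alpha>(1)]) (use n1 A0 in auto)
    then have gap: "AE s in \<rho>. s \<notin> {\<alpha><..<\<beta>}" by (intro AE_I[where N = "{\<alpha><..<\<beta>}"]) (auto simp: sets_rho)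
    have gb: "g_fun \<rho> \<beta> \<le> c" using \<beta> \<beta>r r0p by (intro notV) auto
    show False
    proof (cases "\<alpha> = 0")
      case True
      have at0: "AE s in \<rho>. s \<noteq> 0" by (rule atom[OF True \<beta>r]) (rule n1)
      have "g_fun \<rho> r0 \<le> g_fun \<rho> \<beta>"
      proof (rule g_fun_mono_if)
        show "AE s in \<rho>. (\<beta> - r0) * (s\<^sup>2 - r0 * \<beta>) \<ge> 0"
          using gap at0 rho_nonneg
        proof eventually_elim
          case (elim s)
          then have "\<beta> \<le> s" using True by auto
          then have "r0 * \<beta> \<le> s * s" using \<beta>r r0p by (intro mult_mono) auto
          then show ?case using \<beta>r by (simp add: power2_eq_square)
        qed
      qed (use r0p \<beta>r in auto)
      then show False using gb r0p by (meson leD order_trans)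
    next
      case False
      then have ap: "\<alpha> > 0" using \<alpha> by simp
      have "g_fun \<rho> r0 \<le> c" by (rule g_fun_interpolate[OF ap \<alpha>r \<beta>r gap notV[OF ap \<alpha>(3)] gb])
      then show False using r0p by (meson leD)
    qed
  next
    case False
    then have upV: "x \<in> ?V2" if "r0 \<le> x" for x using that r0 by (cases "x = r0") auto
    have n1: "x \<notin> ?V1" if "\<alpha> < x" for x
    proof (rule notV1)
      show "closed_segment r0 x \<subseteq> ?V2"
      proof
        fix y assume "y \<in> closed_segment r0 x"
        then have "\<alpha> < y" using that \<alpha>r by (auto simp: closed_segment_eq_real_ivl split: if_splits)
        then show "y \<in> ?V2" using lowV upV by (cases "y \<le> r0") auto
      qed
    qed
    have gap: "AE s in \<rho>. s \<le> \<alpha>"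
    proof -
      have "AE s in \<rho>. \<forall>n::nat. s \<notin> {\<alpha><..<real n}"
      proof (rule AE_all_countable[THEN iffD2], rule allI)
        fix n :: nat
        have "emeasure \<rho> {\<alpha><..<real n} = 0" by (rule p1.rho_gap[OF _ \<alpha>(1)]) (use n1 A0 in auto)
        then show "AE s in \<rho>. s \<notin> {\<alpha><..<real n}" by (intro AE_I[where N = "{\<alpha><..<real n}"]) (auto simp: sets_rho)
      qed
      then show ?thesis
      proof eventually_elim
        case (elim s)
        obtain n :: nat where "s < real n" using reals_Archimedean2 by blast
        then show ?case using elim by force
      qed
    qed
    show False
    proof (cases "\<alpha> = 0")
      case True
      have at0: "AE s in \<rho>. s \<noteq> 0" by (rule atom[OF True, of "r0 + 1"]) (use n1 in auto)
      have "AE s in \<rho>. False"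
        using gap at0 rho_nonneg by eventually_elim (use True in auto)
      then have "g_fun \<rho> r0 = (\<integral>\<^sup>+s. 0 \<partial>\<rho>)" unfolding g_fun_def by (intro nn_integral_cong_AE) (auto elim: eventually_mono)
      then show False using r0p by simp
    next
      case False
      then have ap: "\<alpha> > 0" using \<alpha> by simp
      have "g_fun \<rho> r0 \<le> g_fun \<rho> \<alpha>"
      proof (rule g_fun_mono_if[OF r0p(1) ap])
        show "AE s in \<rho>. (\<alpha> - r0) * (s\<^sup>2 - r0 * \<alpha>) \<ge> 0"
          using gap rho_nonneg
        proof eventually_elim
          case (elim s)
          then have "s * s \<le> r0 * \<alpha>" using \<alpha>r by (intro mult_mono) auto
          then show ?case using \<alpha>r by (intro mult_nonpos_nonpos) (auto simp: power2_eq_square)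
        qed
      qed
      then show False using notV[OF ap \<alpha>(3)] r0p by (meson leD order_trans)
    qed
  qed
qed

text \<open>The set \<open>V\<^sub>t\<close> in the coordinate \<open>1 / r\<close>, in which the homeomorphism onto \<open>S\<^sub>t\<close> is increasing and extends
  to \<open>0\<close>. The point \<open>0\<close>, which stands for \<open>r\<close> at infinity, may belong to the closures.\<close>

definition V_recip :: "real \<Rightarrow> real set" where "V_recip t = (\<lambda>r. 1 / r) ` V_plus \<rho> t"

lemma V_recip_iff: "x \<in> V_recip t \<longleftrightarrow> x > 0 \<and> 1 / x \<in> V_plus \<rho> t"
proof
  assume "x \<in> V_recip t"
  then show "x > 0 \<and> 1 / x \<in> V_plus \<rho> t" by (auto simp: V_recip_def V_plus_def)
next
  assume *: "x > 0 \<and> 1 / x \<in> V_plus \<rho> t"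
  then show "x \<in> V_recip t" unfolding V_recip_def by (intro image_eqI[of _ _ "1 / x"]) auto
qed

lemma num_components_V_recip:
  assumes t: "1 < t1" "t1 \<le> t2"
  shows "num_components (closure (V_recip t2)) \<le> num_components (closure (V_recip t1))"
proof -
  have sub: "V_recip t1 \<subseteq> V_recip t2" using V_plus_mono[OF t] by (auto simp: V_recip_def)
  show ?thesis
  proof (rule num_components_le[where \<phi> = "\<lambda>x. x"])
    show "(\<lambda>x. x) ` closure (V_recip t1) \<subseteq> closure (V_recip t2)" using closure_mono[OF sub] by simp
    fix C assume C: "C \<in> components (closure (V_recip t2))"
    have "C \<inter> closure (V_recip t1) \<noteq> {}"
    proof (rule component_closure_meet[OF sub _ C])
      fix w assume w: "w \<in> V_recip t2"
      then have wp: "w > 0" "1 / w \<in> V_plus \<rho> t2" using V_recip_iff by auto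
      obtain r1 where r1: "r1 \<in> V_plus \<rho> t1" "closed_segment (1 / w) r1 \<subseteq> V_plus \<rho> t2"
        using component_meets[OF t wp(2)] by blast
      have r1p: "r1 > 0" using r1 by (simp add: V_plus_def)
      have "closed_segment w (1 / r1) \<subseteq> V_recip t2"
      proof
        fix y assume y: "y \<in> closed_segment w (1 / r1)"
        then have yb: "min w (1 / r1) \<le> y" "y \<le> max w (1 / r1)" by (auto simp: closed_segment_eq_real_ivl split: if_splits)
        moreover have "min w (1 / r1) > 0" using wp r1p by simp
        ultimately have yp: "y > 0" by linarith
        have "min (1 / w) r1 \<le> 1 / y \<and> 1 / y \<le> max (1 / w) r1"
        proof (cases "w \<le> 1 / r1")
          case True
          then have "w \<le> y" "y \<le> 1 / r1" using yb by auto
          then have "1 / y \<le> 1 / w" "r1 \<le> 1 / y" using wp(1) yp r1p by (simp_all add: field_simps)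
          then show ?thesis by auto
        next
          case False
          then have "1 / r1 \<le> y" "y \<le> w" using yb by auto
          then have "1 / w \<le> 1 / y" "1 / y \<le> r1" using wp(1) yp r1p by (simp_all add: field_simps)
          then show ?thesis by auto
        qed
        then have "1 / y \<in> closed_segment (1 / w) r1"
          by (auto simp: closed_segment_eq_real_ivl min_def max_def split: if_splits)
        then show "y \<in> V_recip t2" using r1(2) yp V_recip_iff by blast
      qed
      moreover have "1 / r1 \<in> V_recip t1" using r1(1) by (auto simp: V_recip_def)
      ultimately show "\<exists>v\<in>V_recip t1. closed_segment w v \<subseteq> V_recip t2" by blast
    qed
    then show "C \<inter> (\<lambda>x. x) ` closure (V_recip t1) \<noteq> {}" by simp
  qed simp
qed

end

lemma strict_mono_surj_homeo:
  fixes f :: "real \<Rightarrow> real"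
  assumes "strict_mono f" "surj f"
  shows "continuous_on UNIV f" "continuous_on UNIV (inv f)"
proof -
  show "continuous_on UNIV f"
    by (rule continuous_onI_mono) (use assms in \<open>auto simp: strict_mono_less_eq\<close>)
  have m: "inv f x \<le> inv f y" if "x \<le> y" for x y
    using that assms by (metis strict_mono_less_eq surj_f_inv_f)
  have "surj (inv f)" using assms by (simp add: strict_mono_imp_inj_on inj_imp_surj_inv)
  then show "continuous_on UNIV (inv f)" by (intro continuous_onI_mono) (use m in auto)
qed

context free_power
begin

text \<open>The homeomorphism from \<open>V_recip t\<close> to \<open>S\<^sub>t\<close>, extended to the whole line by the identity.\<close>

definition recip_h :: "real \<Rightarrow> real" where "recip_h x = (if x \<le> 0 then x else 1 / h (1 / x))"

lemma recip_h_strict_mono: "strict_mono recip_h"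
proof (rule strict_monoI)
  fix x y :: real assume xy: "x < y"
  have pos: "recip_h x > 0" if "x > 0" for x using h_pos[of "1 / x"] that by (simp add: recip_h_def)
  show "recip_h x < recip_h y"
  proof (cases "x > 0")
    case True
    then have "h (1 / y) < h (1 / x)" using xy by (intro h_strict_mono) (auto simp: field_simps)
    then show ?thesis using True xy h_pos[of "1 / y"] by (simp add: recip_h_def frac_less2)
  next
    case False
    then have mx: "recip_h x = x" by (simp add: recip_h_def)
    show ?thesis
    proof (cases "y > 0")
      case True
      then show ?thesis using pos[OF True] \<open>\<not> x > 0\<close> mx by linarith
    next
      case False
      then have "recip_h y = y" by (simp add: recip_h_def)
      then show ?thesis using mx xy by simp
    qed
  qed
qed

lemma recip_h_surj: "surj recip_h"
proof -
  have "\<exists>x. y = recip_h x" for y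
  proof (cases "y \<le> 0")
    case True
    then show ?thesis by (intro exI[of _ y]) (simp add: recip_h_def)
  next
    case False
    then obtain r where "r > 0" "h r = 1 / y" using h_surj[of "1 / y"] by auto
    then show ?thesis by (intro exI[of _ "1 / r"]) (simp add: recip_h_def)
  qed
  then show ?thesis by (auto simp: surj_def)
qed

lemma recip_h_V_recip: "recip_h ` V_recip t = S_set u \<rho> t"
proof -
  have "recip_h ` V_recip t = (\<lambda>r. recip_h (1 / r)) ` V_plus \<rho> t" by (simp add: V_recip_def image_image)
  also have "\<dots> = S_set u \<rho> t" unfolding S_set_eq
    by (intro image_cong refl) (auto simp: recip_h_def V_plus_def not_le)
  finally show ?thesis .
qed

lemma num_components_S: "num_components (closure (S_set u \<rho> t)) = num_components (closure (V_recip t))"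
proof (rule antisym)
  note c = strict_mono_surj_homeo[OF recip_h_strict_mono recip_h_surj]
  note im = image_closure_subset[OF continuous_on_subset[OF c(1) subset_UNIV] closed_closure, of "V_recip t" "S_set u \<rho> t"]
  note im' = image_closure_subset[OF continuous_on_subset[OF c(2) subset_UNIV] closed_closure, of "S_set u \<rho> t" "V_recip t"]
  have inj: "inv recip_h (recip_h x) = x" for x using recip_h_strict_mono by (simp add: strict_mono_imp_inj_on)
  have 1: "recip_h ` closure (V_recip t) \<subseteq> closure (S_set u \<rho> t)" using im recip_h_V_recip closure_subset by blast
  have "inv recip_h ` S_set u \<rho> t = V_recip t" unfolding recip_h_V_recip[symmetric] image_image inj by simp
  then have 2: "inv recip_h ` closure (S_set u \<rho> t) \<subseteq> closure (V_recip t)" using im' closure_subset by blast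
  have 3: "closure (S_set u \<rho> t) \<subseteq> recip_h ` closure (V_recip t)"
  proof
    fix y assume "y \<in> closure (S_set u \<rho> t)"
    then have "inv recip_h y \<in> closure (V_recip t)" using 2 by blast
    moreover have "y = recip_h (inv recip_h y)" using recip_h_surj by (simp add: surj_f_inv_f)
    ultimately show "y \<in> recip_h ` closure (V_recip t)" by blast
  qed
  have 4: "closure (V_recip t) \<subseteq> inv recip_h ` closure (S_set u \<rho> t)"
  proof
    fix x assume "x \<in> closure (V_recip t)"
    then have "recip_h x \<in> closure (S_set u \<rho> t)" using 1 by blast
    then show "x \<in> inv recip_h ` closure (S_set u \<rho> t)" using inj[of x] by (metis imageI)
  qed
  show "num_components (closure (S_set u \<rho> t)) \<le> num_components (closure (V_recip t))"
    by (rule num_components_le[OF continuous_on_subset[OF c(1)] 1])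
      (use 3 in_components_nonempty in_components_subset in \<open>auto, fastforce\<close>)
  show "num_components (closure (V_recip t)) \<le> num_components (closure (S_set u \<rho> t))"
    by (rule num_components_le[OF continuous_on_subset[OF c(2)] 2])
      (use 4 in_components_nonempty in_components_subset in \<open>auto, fastforce\<close>)
qed

end

theorem theorem3p10:
  fixes \<mu> \<rho> :: "real measure"
    and u :: "complex \<Rightarrow> complex"
    and a :: real
    and P :: "real \<Rightarrow> real measure"
  assumes "\<mu> \<in> prob_nonneg_nontrivial"
    and "is_log_kappa \<mu> u"
    and "nevanlinna_rep u a \<rho>"
    and "\<And>t. t > 1 \<Longrightarrow> is_free_mult_power \<mu> t (P t)"
  shows "(\<forall>t>1.
           concentrated_on (ac_part (P t)) (closure (S_set u \<rho> t)) \<and>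
           (\<exists>f. is_lebesgue_density f (ac_part (P t)) \<and>
             real_analytic_on f (S_set u \<rho> t) \<and>
             (\<forall>r\<in>V_plus \<rho> t.
                f (1 / h_fun u t r) =
                  1 / pi * (h_fun u t r * l_fun u t r * sin (theta_fun u t r) /
                    (1 - 2 * l_fun u t r * cos (theta_fun u t r) + (l_fun u t r)\<^sup>2))))) \<and>
         antimono_on {1<..} (\<lambda>t. num_components (msupport (ac_part (P t))))"
proof (intro conjI allI impI)
  interpret nv: nevanlinna u a \<rho> by standard (rule assms(3))
  have fp: "free_power u a \<rho> t \<mu> (P t)" if "t > 1" for t
    by (intro free_power.intro nevanlinna_power.intro nevanlinna_power_axioms.intro free_power_axioms.intro
        nv.nevanlinna_axioms assms that)
  {
    fix t :: real assume t: "t > 1"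
    interpret fp: free_power u a \<rho> t \<mu> "P t" by (rule fp[OF t])
    show "concentrated_on (ac_part (P t)) (closure (S_set u \<rho> t))"
      unfolding concentrated_on_def by (rule fp.ac_concentrated)
    obtain f where f: "is_lebesgue_density f (ac_part (P t))" "\<And>x. x \<in> S_set u \<rho> t \<Longrightarrow> f x = fp.ac_density_fun x"
      using fp.ac_density by blast
    have "f (1 / h_fun u t r) = fp.density_formula r" if r: "r \<in> V_plus \<rho> t" for r
    proof -
      have "1 / fp.h r \<in> S_set u \<rho> t" unfolding fp.S_set_eq using r by (rule imageI)
      then show ?thesis using f(2) fp.ac_density_fun_eq[OF r] fp.boundary_limits(1)[OF r] by simp
    qed
    then show "\<exists>f. is_lebesgue_density f (ac_part (P t)) \<and>
             real_analytic_on f (S_set u \<rho> t) \<and>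
             (\<forall>r\<in>V_plus \<rho> t.
                f (1 / h_fun u t r) =
                  1 / pi * (h_fun u t r * l_fun u t r * sin (theta_fun u t r) /
                    (1 - 2 * l_fun u t r * cos (theta_fun u t r) + (l_fun u t r)\<^sup>2)))"
      using f(1) fp.ac_density_fun_real_analytic[OF f(2)] unfolding fp.density_formula_def by blast
  }
  show "antimono_on {1<..} (\<lambda>t. num_components (msupport (ac_part (P t))))"
  proof (rule monotone_onI)
    fix t1 t2 :: real assume t: "t1 \<in> {1<..}" "t2 \<in> {1<..}" "t1 \<le> t2"
    have n: "num_components (msupport (ac_part (P t))) = num_components (closure (nv.V_recip t))" if "t > 1" for t
    proof -
      interpret fp: free_power u a \<rho> t \<mu> "P t" by (rule fp[OF that])
      show ?thesis unfolding fp.msupport_ac fp.num_components_S ..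
    qed
    show "num_components (msupport (ac_part (P t2))) \<le> num_components (msupport (ac_part (P t1)))"
      using nv.num_components_V_recip[of t1 t2] n t by simp
  qed
qed

end
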